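(* Let $1\le p\le q<\infty$ and $1/r=1/p-1/q$ (with $r=\infty$ if $p=q$). Let $X_1,\ldots,X_m$ be Banach lattices, $Y$ a Banach space, and $T\colon X_1\times\cdots\times X_m\to Y$ a multilinear operator. Suppose that the Fremlin tensor product $X_1\otimes_{|\pi|}\cdots\otimes_{|\pi|}X_m$ is (continuously) embedded in a $p$-convex Banach lattice $E$ (with $p$-convexity constant $1$). Then the following statements are equivalent. (i) There is a constant $C>0$ such that for every $n$ and every choice of finite sequences $(x_i^j)_{i=1}^n$ in $X_j$, $1\le j\le m$, $$\Big(\sum_{i=1}^n\|T(x_i^1,\ldots,x_i^m)\|_Y^q\Big)^{1/q}\le C\sup_{(\beta_i)\in B_r^n}\Big\|\Big(\sum_{i=1}^n\big|\beta_i\,(x_i^1\otimes\cdots\otimes x_i^m)\big|^p\Big)^{1/p}\Big\|_E.$$ (ii) There are a constant $C>0$ and a regular Borel probability measure $\nu$ on the weak$^*$ compact set $B^{+}_{(E_p)^*}$ such that for every $(x_1,\ldots,x_m)\in X_1\times\cdots\times X_m$, $$\|T(x_1,\ldots,x_m)\|_Y\le C\Big(\int_{B^{+}_{(E_p)^*}}\big\langle|x_1\otimes\cdots\otimes x_m|^p,x^*\big\rangle^{q/p}\,d\nu(x^* )\Big)^{1/q}.$$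
   Context: $B_r^n$ is the closed unit ball of $\ell_r^n=(\mathbb R^n,\|\cdot\|_r)$. Fremlin tensor product: for Archimedean Riesz spaces $X_1,\ldots,X_m$, $X_1\bar\otimes\cdots\bar\otimes X_m$ denotes Fremlin's Archimedean Riesz space tensor product, which contains the algebraic tensor product and comes with the canonical Riesz $m$-morphism $(x_1,\ldots,x_m)\mapsto x_1\otimes\cdots\otimes x_m$ (so $|x_1\otimes\cdots\otimes x_m|=|x_1|\otimes\cdots\otimes|x_m|$). For Banach lattices $X_j$, the positive-projective norm on it is $$\|x\|_{|\pi|}=\inf\Big\{\sum_{i=1}^n\prod_{j=1}^m\|x_{i,j}\|_{X_j}:\ x_{i,j}\in X_j^{+},\ |x|\le\sum_{i=1}^nx_{i,1}\otimes\cdots\otimes x_{i,m}\Big\},$$ and $X_1\otimes_{|\pi|}\cdots\otimes_{|\pi|}X_m$ is the Banach lattice obtained by completion. Via the embedding into $E$, each $x_1\otimes\cdots\otimes x_m$ is regarded as an element of $E$, and the moduli and powers in (i), (ii) are taken in $E$. A Banach lattice $E$ is $p$-convex with constant $1$ if $\|(\sum_{k=1}^n|x_k|^p)^{1/p}\|_E\le(\sum_{k=1}^n\|x_k\|_E^p)^{1/p}$ for all finite sequences in $E$ (Krivine functional calculus). Its $p$-concavification $E_p$ is the Banach lattice with the same underlying ordered set, addition $x\oplus y=(x^p+y^p)^{1/p}$ and scalar multiplication $a\odot x=a^{1/p}x$ (signed powers), and norm $x\mapsto\|x\|_E^p$; for $x\in E$, $|x|^p$ denotes $|x|$ regarded as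 a positive element of $E_p$. $B^{+}_{(E_p)^*}$ is the set of positive functionals in the closed unit ball of $(E_p)^*$, with the weak$^*$ topology. *)

theory Defs
  imports "HOL-Analysis.Analysis" "HOL-Probability.Probability" "HOL-Library.Lattice_Algebras"
begin

section \<open>Riesz spaces and Banach lattices with explicit carriers\<close>

text \<open>
  The factors \<open>X\<^sub>1, \<dots>, X\<^sub>m\<close> are different spaces, the universal property of the Fremlin tensor
  product quantifies over Riesz spaces, and \<open>E\<^sub>p\<close> puts a second vector space structure on the
  set \<open>E\<close>. None of this can be done with type classes, so these spaces are records. A family
  \<open>X\<^sub>j\<close> only shares the type its carriers are subsets of.
\<close>

record 'a vs =
  vcarrier :: "'a set"
  vzero :: 'a
  vadd :: "'a \<Rightarrow> 'a \<Rightarrow> 'a"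
  vscale :: "real \<Rightarrow> 'a \<Rightarrow> 'a"

record 'a vlat = "'a vs" +
  vle :: "'a \<Rightarrow> 'a \<Rightarrow> bool"

record 'a nvlat = "'a vlat" +
  vnorm :: "'a \<Rightarrow> real"

locale real_vs =
  fixes V :: "('a, 'm) vs_scheme"
  assumes zero_closed: "vzero V \<in> vcarrier V"
    and add_closed: "\<lbrakk>x \<in> vcarrier V; y \<in> vcarrier V\<rbrakk> \<Longrightarrow> vadd V x y \<in> vcarrier V"
    and scale_closed: "x \<in> vcarrier V \<Longrightarrow> vscale V c x \<in> vcarrier V"
    and add_assoc: "\<lbrakk>x \<in> vcarrier V; y \<in> vcarrier V; z \<in> vcarrier V\<rbrakk>
          \<Longrightarrow> vadd V (vadd V x y) z = vadd V x (vadd V y z)"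
    and add_commute: "\<lbrakk>x \<in> vcarrier V; y \<in> vcarrier V\<rbrakk> \<Longrightarrow> vadd V x y = vadd V y x"
    and add_zero: "x \<in> vcarrier V \<Longrightarrow> vadd V x (vzero V) = x"
    and scale_zero_left: "x \<in> vcarrier V \<Longrightarrow> vscale V 0 x = vzero V"
    and scale_one: "x \<in> vcarrier V \<Longrightarrow> vscale V 1 x = x"
    and scale_scale: "x \<in> vcarrier V \<Longrightarrow> vscale V b (vscale V c x) = vscale V (b * c) x"
    and scale_add_left: "x \<in> vcarrier V
          \<Longrightarrow> vscale V (b + c) x = vadd V (vscale V b x) (vscale V c x)"
    and scale_add_right: "\<lbrakk>x \<in> vcarrier V; y \<in> vcarrier V\<rbrakk>
          \<Longrightarrow> vscale V c (vadd V x y) = vadd V (vscale V c x) (vscale V c y)"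

definition is_vsup :: "('a, 'm) vlat_scheme \<Rightarrow> 'a \<Rightarrow> 'a \<Rightarrow> 'a \<Rightarrow> bool" where
  "is_vsup L x y s \<longleftrightarrow> s \<in> vcarrier L \<and> vle L x s \<and> vle L y s \<and>
     (\<forall>z\<in>vcarrier L. vle L x z \<and> vle L y z \<longrightarrow> vle L s z)"

definition vsup :: "('a, 'm) vlat_scheme \<Rightarrow> 'a \<Rightarrow> 'a \<Rightarrow> 'a" where
  "vsup L x y = (THE s. is_vsup L x y s)"

definition vabs :: "('a, 'm) vlat_scheme \<Rightarrow> 'a \<Rightarrow> 'a" where
  "vabs L x = vsup L x (vscale L (-1) x)"

locale riesz_space = real_vs L for L :: "('a, 'm) vlat_scheme" +
  assumes le_refl: "x \<in> vcarrier L \<Longrightarrow> vle L x x"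
    and le_antisym: "\<lbrakk>x \<in> vcarrier L; y \<in> vcarrier L; vle L x y; vle L y x\<rbrakk> \<Longrightarrow> x = y"
    and le_trans: "\<lbrakk>x \<in> vcarrier L; y \<in> vcarrier L; z \<in> vcarrier L; vle L x y; vle L y z\<rbrakk>
          \<Longrightarrow> vle L x z"
    and add_right_mono: "\<lbrakk>x \<in> vcarrier L; y \<in> vcarrier L; z \<in> vcarrier L; vle L x y\<rbrakk>
          \<Longrightarrow> vle L (vadd L x z) (vadd L y z)"
    and scale_mono: "\<lbrakk>x \<in> vcarrier L; y \<in> vcarrier L; vle L x y; 0 \<le> c\<rbrakk>
          \<Longrightarrow> vle L (vscale L c x) (vscale L c y)"
    and sup_exists: "\<lbrakk>x \<in> vcarrier L; y \<in> vcarrier L\<rbrakk> \<Longrightarrow> \<exists>s. is_vsup L x y s"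

locale archimedean_riesz_space = riesz_space L for L :: "('a, 'm) vlat_scheme" +
  assumes archimedean: "\<lbrakk>x \<in> vcarrier L; y \<in> vcarrier L; vle L (vzero L) x;
      \<And>n::nat. vle L (vscale L (real n) x) y\<rbrakk> \<Longrightarrow> x = vzero L"

locale banach_lattice_space = riesz_space L for L :: "('a, 'm) nvlat_scheme" +
  assumes norm_nonneg: "x \<in> vcarrier L \<Longrightarrow> 0 \<le> vnorm L x"
    and norm_eq_zero: "x \<in> vcarrier L \<Longrightarrow> vnorm L x = 0 \<longleftrightarrow> x = vzero L"
    and norm_scale: "x \<in> vcarrier L \<Longrightarrow> vnorm L (vscale L c x) = \<bar>c\<bar> * vnorm L x"
    and norm_triangle: "\<lbrakk>x \<in> vcarrier L; y \<in> vcarrier L\<rbrakk>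
          \<Longrightarrow> vnorm L (vadd L x y) \<le> vnorm L x + vnorm L y"
    and norm_abs_mono: "\<lbrakk>x \<in> vcarrier L; y \<in> vcarrier L; vle L (vabs L x) (vabs L y)\<rbrakk>
          \<Longrightarrow> vnorm L x \<le> vnorm L y"
    and complete: "Metric_space.mcomplete (vcarrier L)
          (\<lambda>x y. vnorm L (vadd L x (vscale L (-1) y)))"


section \<open>Banach lattices as a type class\<close>

class banach_lattice = banach + ordered_real_vector + lattice_ab_group_add_abs +
  assumes norm_abs_mono: "\<bar>x\<bar> \<le> \<bar>y\<bar> \<Longrightarrow> norm x \<le> norm y"

instance real :: banach_lattice
  by standard simp

definition type_vs :: "'y::real_vector vs" where
  "type_vs = \<lparr>vcarrier = UNIV, vzero = 0, vadd = (+), vscale = scaleR\<rparr>"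

definition sub_vlat :: "'z::banach_lattice set \<Rightarrow> 'z vlat" where
  "sub_vlat D = \<lparr>vcarrier = D, vzero = 0, vadd = (+), vscale = scaleR, vle = (\<le>)\<rparr>"

definition type_nvlat :: "'z::banach_lattice nvlat" where
  "type_nvlat = \<lparr>vcarrier = UNIV, vzero = 0, vadd = (+), vscale = scaleR, vle = (\<le>), vnorm = norm\<rparr>"

definition riesz_subspace :: "'z::banach_lattice set \<Rightarrow> bool" where
  "riesz_subspace D \<longleftrightarrow> subspace D \<and> (\<forall>x\<in>D. \<forall>y\<in>D. sup x y \<in> D)"

lemma vsup_type_nvlat: "vsup type_nvlat x y = sup x y"
  unfolding vsup_def is_vsup_def type_nvlat_def by (rule the_equality) (auto intro: antisym)

lemma vabs_type_nvlat: "vabs type_nvlat x = \<bar>x\<bar>"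
  unfolding vabs_def vsup_type_nvlat by (simp add: type_nvlat_def abs_lattice)

text \<open>The two notions of Banach lattice agree.\<close>

lemma banach_lattice_space_type: "banach_lattice_space (type_nvlat :: 'z::banach_lattice nvlat)"
proof
  have eq: "(\<lambda>x y. vnorm type_nvlat (vadd type_nvlat x (vscale type_nvlat (-1) y))) =
      (dist :: 'z \<Rightarrow> _)" "vcarrier (type_nvlat :: 'z nvlat) = UNIV"
    by (auto simp: type_nvlat_def dist_norm fun_eq_iff)
  show "Metric_space.mcomplete (vcarrier type_nvlat)
      (\<lambda>x y::'z. vnorm type_nvlat (vadd type_nvlat x (vscale type_nvlat (-1) y)))"
    unfolding eq using complete_UNIV mcomplete_iff_complete by blast
  show "\<exists>s. is_vsup type_nvlat x y s" for x y :: 'z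
    by (rule exI[of _ "sup x y"]) (simp add: is_vsup_def type_nvlat_def)
  show "vnorm type_nvlat x \<le> vnorm type_nvlat y"
    if "vle type_nvlat (vabs type_nvlat x) (vabs type_nvlat y)" for x y :: 'z
    using that norm_abs_mono unfolding vabs_type_nvlat by (simp add: type_nvlat_def)
qed (auto simp: type_nvlat_def algebra_simps scaleR_left_mono norm_triangle_ineq)


section \<open>Multilinear maps and Riesz multimorphisms\<close>

definition vlinear :: "('a, 'm) vs_scheme \<Rightarrow> ('b, 'n) vs_scheme \<Rightarrow> ('a \<Rightarrow> 'b) \<Rightarrow> bool" where
  "vlinear V W f \<longleftrightarrow> (\<forall>x\<in>vcarrier V. f x \<in> vcarrier W) \<and>
     (\<forall>x\<in>vcarrier V. \<forall>y\<in>vcarrier V. f (vadd V x y) = vadd W (f x) (f y)) \<and>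
     (\<forall>c. \<forall>x\<in>vcarrier V. f (vscale V c x) = vscale W c (f x))"

definition family :: "('i \<Rightarrow> ('a, 'm) vs_scheme) \<Rightarrow> ('i \<Rightarrow> 'a) set" where
  "family X = {x. \<forall>j. x j \<in> vcarrier (X j)}"

definition multilinear ::
    "('i \<Rightarrow> ('a, 'm) vs_scheme) \<Rightarrow> ('b, 'n) vs_scheme \<Rightarrow> (('i \<Rightarrow> 'a) \<Rightarrow> 'b) \<Rightarrow> bool" where
  "multilinear X W f \<longleftrightarrow> (\<forall>x\<in>family X. \<forall>j. vlinear (X j) W (\<lambda>u. f (x(j := u))))"

definition riesz_hom :: "('a, 'm) vlat_scheme \<Rightarrow> ('b, 'n) vlat_scheme \<Rightarrow> ('a \<Rightarrow> 'b) \<Rightarrow> bool" where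
  "riesz_hom L M h \<longleftrightarrow> vlinear L M h \<and>
     (\<forall>x\<in>vcarrier L. \<forall>y\<in>vcarrier L. h (vsup L x y) = vsup M (h x) (h y))"

definition riesz_multimorphism ::
    "('i \<Rightarrow> ('a, 'm) vlat_scheme) \<Rightarrow> ('b, 'n) vlat_scheme \<Rightarrow> (('i \<Rightarrow> 'a) \<Rightarrow> 'b) \<Rightarrow> bool" where
  "riesz_multimorphism X M f \<longleftrightarrow> multilinear X M f \<and>
     (\<forall>x\<in>family X. \<forall>j. (\<forall>k. k \<noteq> j \<longrightarrow> vle (X k) (vzero (X k)) (x k)) \<longrightarrow>
        riesz_hom (X j) M (\<lambda>u. f (x(j := u))))"


section \<open>The Fremlin tensor product and the positive-projective tensor product\<close>

text \<open>
  \<open>(F, t)\<close> is the Fremlin tensor product: every Riesz multimorphism from the \<open>X j\<close> into an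
  Archimedean Riesz space \<open>G\<close> factors uniquely through \<open>t\<close>. HOL cannot quantify over the type that
  carries \<open>G\<close>, but no generality is lost by taking carriers inside \<open>('i \<Rightarrow> 'a) + 'f\<close>: for existence,
  \<open>G\<close> may be replaced by the Riesz subspace generated by the image of the multimorphism, which is
  trivial if some \<open>X j\<close> is trivial and otherwise has at most the cardinality of the product of the
  \<open>X j\<close>; for uniqueness, \<open>G\<close> may be replaced by the Riesz subspace generated by the images of two
  competing homomorphisms, which has at most the cardinality of \<open>F\<close>.
\<close>

definition fremlin_tensor_product ::
    "('i \<Rightarrow> ('a, 'm) vlat_scheme) \<Rightarrow> 'f vlat \<Rightarrow> (('i \<Rightarrow> 'a) \<Rightarrow> 'f) \<Rightarrow> bool" where
  "fremlin_tensor_product X F t \<longleftrightarrow> archimedean_riesz_space F \<and> riesz_multimorphism X F t \<and>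
     (\<forall>(G :: (('i \<Rightarrow> 'a) + 'f) vlat) \<phi>.
        archimedean_riesz_space G \<and> riesz_multimorphism X G \<phi> \<longrightarrow>
        (\<exists>!h. h \<in> extensional (vcarrier F) \<and> riesz_hom F G h \<and> (\<forall>x\<in>family X. h (t x) = \<phi> x)))"

definition pos_proj_norm ::
    "('i::finite \<Rightarrow> ('a, 'm) nvlat_scheme) \<Rightarrow> (('i \<Rightarrow> 'a) \<Rightarrow> 'z::banach_lattice) \<Rightarrow> 'z \<Rightarrow> real" where
  "pos_proj_norm X t x = Inf {(\<Sum>i<n. \<Prod>j\<in>UNIV. vnorm (X j) (u i j)) | (n::nat) u.
     (\<forall>i<n. u i \<in> family X \<and> (\<forall>j. vle (X j) (vzero (X j)) (u i j))) \<and> \<bar>x\<bar> \<le> (\<Sum>i<n. t (u i))}"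

text \<open>
  The Banach lattice \<open>'z\<close> together with \<open>t\<close> is the completion of the Fremlin tensor product (the
  Riesz subspace \<open>D\<close>) under the positive-projective norm. This determines \<open>('z, t)\<close> up to isometric
  lattice isomorphism.
\<close>

definition pos_proj_tensor_product ::
    "('i::finite \<Rightarrow> ('a, 'm) nvlat_scheme) \<Rightarrow> (('i \<Rightarrow> 'a) \<Rightarrow> 'z::banach_lattice) \<Rightarrow> bool" where
  "pos_proj_tensor_product X t \<longleftrightarrow>
     (\<exists>D. riesz_subspace D \<and> fremlin_tensor_product X (sub_vlat D) t \<and>
        (\<forall>x\<in>D. norm x = pos_proj_norm X t x) \<and> closure D = UNIV)"


section \<open>Krivine functional calculus, p-convexity and p-concavification\<close>

text \<open>
  Continuous positively homogeneous functions on \<open>\<real>\<^sup>n\<close>, a point of \<open>\<real>\<^sup>n\<close> being given by the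
  coordinates below \<open>n\<close> of a sequence. For a function of finitely many coordinates, continuity in
  the product topology of \<open>nat \<Rightarrow> real\<close> is continuity on \<open>\<real>\<^sup>n\<close>.
\<close>

definition pos_homogeneous :: "nat \<Rightarrow> ((nat \<Rightarrow> real) \<Rightarrow> real) set" where
  "pos_homogeneous n = {f. continuous_on UNIV f \<and> (\<forall>c t. 0 \<le> c \<longrightarrow> f (\<lambda>k. c * t k) = c * f t) \<and>
     (\<forall>s t. (\<forall>k<n. s k = t k) \<longrightarrow> f s = f t)}"

definition krivine_hom ::
    "nat \<Rightarrow> (nat \<Rightarrow> 'e::banach_lattice) \<Rightarrow> (((nat \<Rightarrow> real) \<Rightarrow> real) \<Rightarrow> 'e) \<Rightarrow> bool" where
  "krivine_hom n x \<tau> \<longleftrightarrow> (\<forall>k<n. \<tau> (\<lambda>t. t k) = x k) \<and>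
     (\<forall>f\<in>pos_homogeneous n. \<forall>g\<in>pos_homogeneous n. \<tau> (\<lambda>t. f t + g t) = \<tau> f + \<tau> g) \<and>
     (\<forall>c. \<forall>f\<in>pos_homogeneous n. \<tau> (\<lambda>t. c * f t) = c *\<^sub>R \<tau> f) \<and>
     (\<forall>f\<in>pos_homogeneous n. \<forall>g\<in>pos_homogeneous n. \<tau> (\<lambda>t. max (f t) (g t)) = sup (\<tau> f) (\<tau> g))"

text \<open>\<open>f(x\<^sub>0, \<dots>, x\<^bsub>n-1\<^esub>)\<close>, the value at \<open>f\<close> of the unique homomorphism of Krivine's theorem.\<close>

definition krivine ::
    "nat \<Rightarrow> (nat \<Rightarrow> 'e::banach_lattice) \<Rightarrow> ((nat \<Rightarrow> real) \<Rightarrow> real) \<Rightarrow> 'e" where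
  "krivine n x f = (THE y. \<exists>\<tau>. krivine_hom n x \<tau> \<and> y = \<tau> f)"

definition p_sum :: "real \<Rightarrow> nat \<Rightarrow> (nat \<Rightarrow> 'e::banach_lattice) \<Rightarrow> 'e" where
  "p_sum p n x = krivine n x (\<lambda>t. (\<Sum>k<n. \<bar>t k\<bar> powr p) powr (1 / p))"

definition p_convex :: "real \<Rightarrow> real \<Rightarrow> 'e::banach_lattice itself \<Rightarrow> bool" where
  "p_convex p M _ \<longleftrightarrow> (\<forall>n (x :: nat \<Rightarrow> 'e).
     norm (p_sum p n x) \<le> M * (\<Sum>k<n. norm (x k) powr p) powr (1 / p))"

text \<open>
  \<open>E\<^sub>p\<close> has the elements and the order of \<open>E\<close>, so \<open>\<bar>x\<bar>\<^sup>p\<close>, regarded as an element of \<open>E\<^sub>p\<close>, is \<open>\<bar>x\<bar>\<close>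
  itself: the pairing \<open>\<langle>\<bar>x\<bar>\<^sup>p, \<phi>\<rangle>\<close> is \<open>\<phi> \<bar>x\<bar>\<close>. The powers below are signed.
\<close>

definition spow :: "real \<Rightarrow> real \<Rightarrow> real" where
  "spow p a = sgn a * \<bar>a\<bar> powr p"

definition concavification :: "real \<Rightarrow> 'e::banach_lattice nvlat" where
  "concavification p =
     \<lparr>vcarrier = UNIV,
      vzero = 0,
      vadd = (\<lambda>x y. krivine 2 (\<lambda>k. if k = 0 then x else y)
                      (\<lambda>t. spow (1 / p) (spow p (t 0) + spow p (t 1)))),
      vscale = (\<lambda>a x. spow (1 / p) a *\<^sub>R x),
      vle = (\<le>),
      vnorm = (\<lambda>x. norm x powr p)\<rparr>"


section \<open>The positive dual ball and regular Borel measures\<close>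

definition dual_space :: "('a, 'm) nvlat_scheme \<Rightarrow> ('a \<Rightarrow> real) set" where
  "dual_space L = {\<phi> \<in> extensional (vcarrier L). vlinear L type_vs \<phi> \<and>
     (\<exists>B. \<forall>x\<in>vcarrier L. \<bar>\<phi> x\<bar> \<le> B * vnorm L x)}"

definition dual_norm :: "('a, 'm) nvlat_scheme \<Rightarrow> ('a \<Rightarrow> real) \<Rightarrow> real" where
  "dual_norm L \<phi> = (SUP x\<in>{x \<in> vcarrier L. vnorm L x \<le> 1}. \<bar>\<phi> x\<bar>)"

definition pos_dual_ball :: "('a, 'm) nvlat_scheme \<Rightarrow> ('a \<Rightarrow> real) set" where
  "pos_dual_ball L = {\<phi> \<in> dual_space L. dual_norm L \<phi> \<le> 1 \<and>
     (\<forall>x\<in>vcarrier L. vle L (vzero L) x \<longrightarrow> 0 \<le> \<phi> x)}"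

text \<open>The weak* topology is the topology of pointwise convergence.\<close>

definition weak_star_pos_dual_ball :: "('a, 'm) nvlat_scheme \<Rightarrow> ('a \<Rightarrow> real) topology" where
  "weak_star_pos_dual_ball L =
     subtopology (product_topology (\<lambda>_. euclideanreal) (vcarrier L)) (pos_dual_ball L)"

definition regular_borel_prob :: "'k topology \<Rightarrow> 'k measure \<Rightarrow> bool" where
  "regular_borel_prob K \<nu> \<longleftrightarrow> prob_space \<nu> \<and> space \<nu> = topspace K \<and>
     sets \<nu> = sigma_sets (topspace K) {U. openin K U} \<and>
     (\<forall>A\<in>sets \<nu>. emeasure \<nu> A = (INF U\<in>{U. openin K U \<and> A \<subseteq> U}. emeasure \<nu> U) \<and>
        emeasure \<nu> A = (SUP C\<in>{C. compactin K C \<and> closedin K C \<and> C \<subseteq> A}. emeasure \<nu> C))"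


section \<open>The unit ball of \<open>\<ell>\<^sub>r\<^sup>n\<close>\<close>

definition lr_norm :: "ennreal \<Rightarrow> nat \<Rightarrow> (nat \<Rightarrow> real) \<Rightarrow> real" where
  "lr_norm r n \<beta> = (if r = \<infinity> then Max (insert 0 ((\<lambda>i. \<bar>\<beta> i\<bar>) ` {..<n}))
     else (\<Sum>i<n. \<bar>\<beta> i\<bar> powr enn2real r) powr (1 / enn2real r))"

definition lr_ball :: "ennreal \<Rightarrow> nat \<Rightarrow> (nat \<Rightarrow> real) set" where
  "lr_ball r n = {\<beta>. lr_norm r n \<beta> \<le> 1}"

end

(*
  The functions phi |-> <|x_1 (x) ... (x) x_m|^p, phi>^(q/p) are continuous on the weak* compact
  positive ball K of (E_p)^*. A functional phi in K turns the p-sum in (i) into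
  sum |beta_i|^p <|x_i|^p, phi>, so by the duality of l_(q/p) and l_(r/p) the supremum in (i)
  is the supremum over K of (sum <|x_i|^p, phi>^(q/p))^(1/q): one inequality uses that phi has norm
  at most 1, the other that the Hahn-Banach theorem on E_p supplies norming positive functionals.
  Then (i) says that no finite sum of the functions above stays below the corresponding sum of
  |T|^q / C^q on all of K, which is Pietsch's criterion for a dominating probability measure.

  Identities in E are checked by applying real lattice homomorphisms of a principal ideal. These
  exist in abundance because a minimal element among the sublinear functionals that preserve
  binary suprema is linear; the same Zorn argument without the condition on suprema is the
  Hahn-Banach theorem.
*)
theory Submission
  imports Defs
begin

section \<open>Linear functionals below sublinear functionals\<close>

text \<open>Extending a functional one dimension at a time gives no control over suprema, so linear
  functionals are reached from above. With t = 1/s the expression in \<open>directional\<close> is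
  (f(y + s x) - f(y)) / s: its infimum is the one-sided derivative of f at y in the direction x. It
  lies below f and inherits sublinearity and maxima, so a minimal functional equals all its
  directional derivatives, which forces additivity.

  Addition in E_p is only given through Krivine's calculus. For a lattice homomorphism \<omega>,
  however, x \<mapsto> spow p (\<omega> x) is linear for the operations of E_p, so the laws of E_p
  turn into laws of real numbers.

  No weights occur in (i), yet Pietsch's separation argument needs a convex cone. After passing to
  q-th powers both sides are homogeneous of degree q in each coordinate of (x_1, ..., x_m), so one
  coordinate absorbs a positive weight and the finite sums already form a cone. The separating
  functional on C(K) is turned into a measure by Riesz's construction; the inequality \<Lambda> f
  \<le> \<integral> f for f \<ge> 0 is the direction that domination calls for. Both implications
  keep the constant C.\<close>

definition (in real_vs) sublinear :: "('a \<Rightarrow> real) \<Rightarrow> bool" where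
  "sublinear f \<longleftrightarrow> (\<forall>x\<in>vcarrier V. \<forall>y\<in>vcarrier V. f (vadd V x y) \<le> f x + f y) \<and>
     (\<forall>c\<ge>0. \<forall>x\<in>vcarrier V. f (vscale V c x) \<le> c * f x)"

text \<open>In a triple \<open>(a, b, c) \<in> R\<close>, \<open>c\<close> plays the role of the supremum of \<open>a\<close> and \<open>b\<close>. With \<open>R = {}\<close> the
  condition is void.\<close>

definition max_on :: "('a \<times> 'a \<times> 'a) set \<Rightarrow> ('a \<Rightarrow> real) \<Rightarrow> bool" where
  "max_on R f \<longleftrightarrow> (\<forall>(a, b, c)\<in>R. f c = max (f a) (f b))"

text \<open>A functional with maxima on such an \<open>R\<close> satisfies f(c + t y) = max (f(a + t
  y)) (f(b + t y)) for every t; this is what lets directional derivatives keep the maxima.\<close>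

definition (in real_vs) translation_invariant :: "('a \<times> 'a \<times> 'a) set \<Rightarrow> bool" where
  "translation_invariant R \<longleftrightarrow> R \<subseteq> vcarrier V \<times> vcarrier V \<times> vcarrier V \<and>
     (\<forall>(a, b, c)\<in>R. \<forall>y\<in>vcarrier V. (vadd V a y, vadd V b y, vadd V c y) \<in> R)"

context real_vs
begin

lemma add_left_commute:
  assumes "x \<in> vcarrier V" "y \<in> vcarrier V" "z \<in> vcarrier V"
  shows "vadd V x (vadd V y z) = vadd V y (vadd V x z)"
  using assms by (metis add_assoc add_commute)

lemmas add_ac' = add_assoc add_commute add_left_commute

lemma add_neg: "x \<in> vcarrier V \<Longrightarrow> vadd V x (vscale V (-1) x) = vzero V"
  using scale_add_left[of x 1 "-1"] scale_one scale_zero_left by simp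

lemma neg_add: "x \<in> vcarrier V \<Longrightarrow> vadd V (vscale V (-1) x) x = vzero V"
  using add_neg add_commute scale_closed by metis

lemma zero_add: "x \<in> vcarrier V \<Longrightarrow> vadd V (vzero V) x = x"
  using add_zero add_commute zero_closed by metis

lemma neg_add_cancel:
  "x \<in> vcarrier V \<Longrightarrow> y \<in> vcarrier V \<Longrightarrow> vadd V (vscale V (-1) x) (vadd V x y) = y"
  by (metis add_assoc neg_add zero_add scale_closed)

lemma sublinearD:
  assumes "sublinear f"
  shows "x \<in> vcarrier V \<Longrightarrow> y \<in> vcarrier V \<Longrightarrow> f (vadd V x y) \<le> f x + f y"
    and "0 \<le> c \<Longrightarrow> x \<in> vcarrier V \<Longrightarrow> f (vscale V c x) \<le> c * f x"
  using assms unfolding sublinear_def by auto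

lemma sublinear_zero:
  assumes "sublinear f" shows "f (vzero V) = 0"
proof -
  have "f (vzero V) \<le> 0" using sublinearD(2)[OF assms, of 0 "vzero V"] zero_closed
    by (simp add: scale_zero_left)
  moreover have "f (vzero V) \<le> f (vzero V) + f (vzero V)"
    using sublinearD(1)[OF assms zero_closed zero_closed] add_zero[OF zero_closed] by simp
  ultimately show ?thesis by simp
qed

text \<open>Equality follows from the inequality for the factor 1/c applied to c x.\<close>

lemma sublinear_scale:
  assumes "sublinear f" "0 \<le> c" "x \<in> vcarrier V" shows "f (vscale V c x) = c * f x"
proof (cases "c = 0")
  case True then show ?thesis using assms sublinear_zero by (simp add: scale_zero_left)
next
  case False
  then have c: "c > 0" using assms by simp
  have "f x \<le> 1 / c * f (vscale V c x)"
    using sublinearD(2)[OF assms(1), of "1/c" "vscale V c x"] scale_closed assms c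
    by (simp add: scale_scale scale_one)
  then have "c * f x \<le> f (vscale V c x)" using c by (simp add: field_simps)
  then show ?thesis using sublinearD(2)[OF assms] by simp
qed

lemma sublinear_ge_neg:
  assumes "sublinear f" "x \<in> vcarrier V" shows "- f (vscale V (-1) x) \<le> f x"
  using sublinearD(1)[OF assms(1,2) scale_closed[OF assms(2), of "-1"]] sublinear_zero[OF assms(1)]
  by (simp add: add_neg assms)

text \<open>The expression is decreasing in \<open>t\<close>, so the infimum is a limit as \<open>t \<rightarrow> \<infinity>\<close>; hence maxima of \<open>f\<close>
  are preserved.\<close>

definition directional :: "('a \<Rightarrow> real) \<Rightarrow> 'a \<Rightarrow> 'a \<Rightarrow> real" where
  "directional f y x = (INF t\<in>{0..}. f (vadd V x (vscale V t y)) - t * f y)"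

section \<open>Directional derivatives of sublinear functionals\<close>

context
  fixes f y
  assumes f: "sublinear f" and y: "y \<in> vcarrier V"
begin

text \<open>Writing t y as -x + (x + t y), subadditivity bounds the values below uniformly in t, so
  the infimum in \<open>directional\<close> is a genuine one rather than an unspecified
  real.\<close>

lemma directional_bound:
  assumes x: "x \<in> vcarrier V" and t: "0 \<le> t"
  shows "- f (vscale V (-1) x) \<le> f (vadd V x (vscale V t y)) - t * f y"
proof -
  have "f (vadd V (vscale V (-1) x) (vadd V x (vscale V t y)))
      \<le> f (vscale V (-1) x) + f (vadd V x (vscale V t y))"
    by (intro sublinearD(1)[OF f] scale_closed add_closed x y)
  then show ?thesis using sublinear_scale[OF f t y] by (simp add: neg_add_cancel x y scale_closed)
qed

lemma directional_bdd:
  assumes x: "x \<in> vcarrier V"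
  shows "bdd_below ((\<lambda>t. f (vadd V x (vscale V t y)) - t * f y) ` {0..})"
  using directional_bound[OF x] by (auto intro!: bdd_belowI2)

lemma directional_le:
  assumes x: "x \<in> vcarrier V" and t: "0 \<le> t"
  shows "directional f y x \<le> f (vadd V x (vscale V t y)) - t * f y"
  unfolding directional_def by (rule cINF_lower[OF directional_bdd[OF x]]) (use t in simp)

lemma directional_ge:
  assumes "\<And>t. 0 \<le> t \<Longrightarrow> M \<le> f (vadd V x (vscale V t y)) - t * f y"
  shows "M \<le> directional f y x"
  unfolding directional_def by (rule cINF_greatest) (use assms in auto)

lemma directional_less:
  assumes "directional f y x < M"
  obtains t where "0 \<le> t" "f (vadd V x (vscale V t y)) - t * f y < M"
  using assms directional_ge[of M x] by (meson not_le)

text \<open>Moving on by s y costs at most s f(y). Parameters found for different vectors can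
  therefore be replaced by their sum.\<close>

lemma directional_antimono:
  assumes x: "x \<in> vcarrier V" and t: "0 \<le> t" and s: "0 \<le> s"
  shows "f (vadd V x (vscale V (t + s) y)) - (t + s) * f y \<le> f (vadd V x (vscale V t y)) - t * f y"
proof -
  have "vadd V x (vscale V (t + s) y) = vadd V (vadd V x (vscale V t y)) (vscale V s y)"
    by (simp add: scale_add_left add_assoc x y scale_closed)
  then have "f (vadd V x (vscale V (t + s) y)) \<le> f (vadd V x (vscale V t y)) + s * f y"
    using sublinearD(1)[OF f, of "vadd V x (vscale V t y)" "vscale V s y"] sublinear_scale[OF f s y]
    by (simp add: x y scale_closed add_closed)
  then show ?thesis by (simp add: algebra_simps)
qed

lemma directional_le_self: "x \<in> vcarrier V \<Longrightarrow> directional f y x \<le> f x"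
  using directional_le[of x 0] by (simp add: scale_zero_left y add_zero)

lemma directional_le_diff: "x \<in> vcarrier V \<Longrightarrow> directional f y x \<le> f (vadd V x y) - f y"
  using directional_le[of x 1] by (simp add: scale_one y)

lemma sublinear_directional: "sublinear (directional f y)"
  unfolding sublinear_def
proof (intro conjI ballI allI impI)
  fix a b assume ab: "a \<in> vcarrier V" "b \<in> vcarrier V"
  \<comment> \<open>Parameters add: t for a and s for b give the candidate t + s for a + b.\<close>
  have *: "directional f y (vadd V a b) \<le>
      (f (vadd V a (vscale V t y)) - t * f y) + (f (vadd V b (vscale V s y)) - s * f y)"
    if t: "0 \<le> t" and s: "0 \<le> s" for t s
  proof -
    have "vadd V (vadd V a b) (vscale V (t + s) y) =
        vadd V (vadd V a (vscale V t y)) (vadd V b (vscale V s y))"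
      using ab y by (simp add: scale_add_left add_ac' scale_closed add_closed)
    then have "f (vadd V (vadd V a b) (vscale V (t + s) y))
        \<le> f (vadd V a (vscale V t y)) + f (vadd V b (vscale V s y))"
      using sublinearD(1)[OF f] ab y by (simp add: scale_closed add_closed)
    moreover have "directional f y (vadd V a b) \<le>
        f (vadd V (vadd V a b) (vscale V (t + s) y)) - (t + s) * f y"
      by (rule directional_le) (use ab t s in \<open>auto intro: add_closed\<close>)
    ultimately show ?thesis by (simp add: algebra_simps)
  qed
  have "directional f y (vadd V a b) - directional f y b \<le> directional f y a"
  proof (rule directional_ge)
    fix t :: real assume t: "0 \<le> t"
    have "directional f y (vadd V a b) - (f (vadd V a (vscale V t y)) - t * f y) \<le> directional f y b"
      by (rule directional_ge) (use *[OF t] in \<open>simp add: algebra_simps\<close>)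
    then show "directional f y (vadd V a b) - directional f y b \<le> f (vadd V a (vscale V t y)) - t * f y"
      by simp
  qed
  then show "directional f y (vadd V a b) \<le> directional f y a + directional f y b" by simp
next
  fix c :: real and x assume c: "0 \<le> c" and x: "x \<in> vcarrier V"
  show "directional f y (vscale V c x) \<le> c * directional f y x"
  proof (cases "c = 0")
    case True
    then show ?thesis
      using directional_le_self[OF zero_closed] sublinear_zero[OF f] by (simp add: scale_zero_left x)
  next
    case False
    then have c: "c > 0" using c by simp
    have "directional f y (vscale V c x) / c \<le> directional f y x"
    proof (rule directional_ge)
      fix t :: real assume t: "0 \<le> t"
      have "directional f y (vscale V c x)
          \<le> f (vadd V (vscale V c x) (vscale V (c * t) y)) - (c * t) * f y"
        by (rule directional_le) (use x t c in \<open>auto intro: scale_closed\<close>)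
      also have "vadd V (vscale V c x) (vscale V (c * t) y) = vscale V c (vadd V x (vscale V t y))"
        by (simp add: scale_add_right scale_scale x y scale_closed)
      also have "f \<dots> = c * f (vadd V x (vscale V t y))"
        by (rule sublinear_scale[OF f]) (use x y c in \<open>auto intro: scale_closed add_closed\<close>)
      finally show "directional f y (vscale V c x) / c \<le> f (vadd V x (vscale V t y)) - t * f y"
        using c by (simp add: field_simps)
    qed
    then show ?thesis using c by (simp add: field_simps)
  qed
qed

lemma max_on_directional:
  assumes R: "translation_invariant R" and m: "max_on R f"
  shows "max_on R (directional f y)"
  unfolding max_on_def
proof clarify
  fix a b c assume abc: "(a, b, c) \<in> R"
  then have V: "a \<in> vcarrier V" "b \<in> vcarrier V" "c \<in> vcarrier V"
    using R unfolding translation_invariant_def by auto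
  have eq: "f (vadd V c (vscale V t y)) =
      max (f (vadd V a (vscale V t y))) (f (vadd V b (vscale V t y)))" for t
    using R m abc scale_closed[OF y, of t] unfolding translation_invariant_def max_on_def by blast
  show "directional f y c = max (directional f y a) (directional f y b)"
  proof (rule antisym)
    show "max (directional f y a) (directional f y b) \<le> directional f y c"
    proof (rule directional_ge)
      fix t :: real assume "0 \<le> t"
      then show "max (directional f y a) (directional f y b) \<le> f (vadd V c (vscale V t y)) - t * f y"
          using directional_le[of a t] directional_le[of b t] V by (auto simp: eq max_def)
    qed
    show "directional f y c \<le> max (directional f y a) (directional f y b)"
    proof (rule ccontr)
      assume "\<not> ?thesis"
      then have "directional f y a < directional f y c" "directional f y b < directional f y c" by auto
      then obtain t s where t: "0 \<le> t" "f (vadd V a (vscale V t y)) - t * f y < directional f y c"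
        and s: "0 \<le> s" "f (vadd V b (vscale V s y)) - s * f y < directional f y c"
        using directional_less by metis
      \<comment> \<open>The common parameter t + s serves both a and b, so the value for c, being
        one of the two, also falls below its own infimum.\<close>
      have "f (vadd V a (vscale V (t + s) y)) - (t + s) * f y < directional f y c"
        using directional_antimono[OF V(1) t(1) s(1)] t(2) by simp
      moreover have "f (vadd V b (vscale V (t + s) y)) - (t + s) * f y < directional f y c"
        using directional_antimono[OF V(2) s(1) t(1)] s(2) by (simp add: Groups.add.commute)
      ultimately have "f (vadd V c (vscale V (t + s) y)) - (t + s) * f y < directional f y c"
        by (simp add: eq max_def)
      then show False using directional_le[OF V(3), of "t + s"] t s by simp
    qed
  qed
qed

end

section \<open>Minimal functionals by Zorn's lemma\<close>

definition below :: "('a \<times> 'a \<times> 'a) set \<Rightarrow> ('a \<Rightarrow> real) \<Rightarrow> ('a \<Rightarrow> real) set" where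
  "below R f = {g. sublinear g \<and> max_on R g \<and> (\<forall>x\<in>vcarrier V. g x \<le> f x) \<and> (\<forall>x. x \<notin> vcarrier V \<longrightarrow> g x = 0)}"

lemma sublinear_cong:
  assumes "\<And>x. x \<in> vcarrier V \<Longrightarrow> f x = g x" shows "sublinear f \<longleftrightarrow> sublinear g"
  unfolding sublinear_def using assms by (simp add: add_closed scale_closed)

lemma max_on_cong:
  assumes "translation_invariant R" "\<And>x. x \<in> vcarrier V \<Longrightarrow> f x = g x"
  shows "max_on R f \<longleftrightarrow> max_on R g"
proof -
  have "f c = max (f a) (f b) \<longleftrightarrow> g c = max (g a) (g b)" if "(a, b, c) \<in> R" for a b c
  proof -
    have "a \<in> vcarrier V" "b \<in> vcarrier V" "c \<in> vcarrier V"
      using that assms(1) unfolding translation_invariant_def by auto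
    then show ?thesis using assms(2) by simp
  qed
  then show ?thesis unfolding max_on_def by fast
qed

text \<open>Members of \<open>below\<close> vanish off the carrier. Order and equality of total
  functions then mean the same as on the carrier, as the Zorn argument requires.\<close>

lemma restrict_in_below:
  assumes "translation_invariant R" "sublinear g" "max_on R g" "\<And>x. x \<in> vcarrier V \<Longrightarrow> g x \<le> f x"
  shows "(\<lambda>x. if x \<in> vcarrier V then g x else 0) \<in> below R f"
  unfolding below_def
  using assms sublinear_cong[of g "\<lambda>x. if x \<in> vcarrier V then g x else 0"]
    max_on_cong[of R g "\<lambda>x. if x \<in> vcarrier V then g x else 0"] by auto

text \<open>The pointwise infimum works: -f(-x) is a lower bound independent of the member, and in a
  chain two near-optimal members can be replaced by the smaller one, which yields subadditivity and
  the maxima.\<close>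

lemma below_chain_bound:
  assumes R: "translation_invariant R" and f: "sublinear f" and "C \<noteq> {}" and C: "C \<subseteq> below R f"
    and chain: "\<And>g h. g \<in> C \<Longrightarrow> h \<in> C \<Longrightarrow> g \<le> h \<or> h \<le> g"
  shows "\<exists>u\<in>below R f. \<forall>g\<in>C. u \<le> g"
proof -
  define u where "u x = (INF g\<in>C. g x)" for x
  have sub: "sublinear g" "max_on R g" "x \<in> vcarrier V \<Longrightarrow> g x \<le> f x" "x \<notin> vcarrier V \<Longrightarrow> g x = 0"
    if "g \<in> C" for g x
    using that C unfolding below_def by auto
  have bdd: "bdd_below ((\<lambda>g. g x) ` C)" for x
  proof (cases "x \<in> vcarrier V")
    case True
    have "- f (vscale V (-1) x) \<le> g x" if g: "g \<in> C" for g
      using sublinear_ge_neg[OF sub(1)[OF g] True] sub(3)[OF g scale_closed[OF True, of "-1"]] by linarith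
    then show ?thesis by (rule bdd_belowI2)
  next
    case False
    then have "0 \<le> g x" if "g \<in> C" for g using sub(4)[OF that, of x] by simp
    then show ?thesis by (rule bdd_belowI2)
  qed
  have le: "u x \<le> g x" if "g \<in> C" for g x unfolding u_def by (rule cINF_lower[OF bdd that])
  have ge: "M \<le> u x" if "\<And>g. g \<in> C \<Longrightarrow> M \<le> g x" for M x
    unfolding u_def by (rule cINF_greatest) (use assms that in auto)
  have less: "\<exists>g\<in>C. g x < M" if "u x < M" for x M
    using that ge[of M x] by (meson not_le)
  have common: "\<exists>k\<in>C. k \<le> g \<and> k \<le> h" if "g \<in> C" "h \<in> C" for g h
    using chain[OF that] that by auto
  have "u \<in> below R f"
    unfolding below_def
  proof (intro CollectI conjI ballI allI impI)
    show "sublinear u"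
      unfolding sublinear_def
    proof (intro conjI ballI allI impI)
      fix a b assume ab: "a \<in> vcarrier V" "b \<in> vcarrier V"
      have "u (vadd V a b) - u b \<le> u a"
      proof (rule ge)
        fix g assume g: "g \<in> C"
        have "u (vadd V a b) - g a \<le> u b"
        proof (rule ge)
          fix h assume "h \<in> C"
          then obtain k where k: "k \<in> C" "k \<le> g" "k \<le> h" using common g by blast
          have "u (vadd V a b) \<le> k a + k b"
            using le[OF k(1)] sublinearD(1)[OF sub(1)[OF k(1)] ab] by (meson order_trans)
          then show "u (vadd V a b) - g a \<le> h b"
            using le_funD[OF k(2), of a] le_funD[OF k(3), of b] by linarith
        qed
        then show "u (vadd V a b) - u b \<le> g a" by simp
      qed
      then show "u (vadd V a b) \<le> u a + u b" by simp
    next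
      fix c :: real and x assume c: "0 \<le> c" and x: "x \<in> vcarrier V"
      have *: "u (vscale V c x) \<le> c * g x" if "g \<in> C" for g
        using le[OF that] sublinearD(2)[OF sub(1)[OF that] c x] by (meson order_trans)
      show "u (vscale V c x) \<le> c * u x"
      proof (cases "c = 0")
        case True then show ?thesis using * \<open>C \<noteq> {}\<close> by auto
      next
        case False
        then have "u (vscale V c x) / c \<le> u x" using * c by (intro ge) (auto simp: field_simps)
        then show ?thesis using False c by (simp add: field_simps)
      qed
    qed
    show "max_on R u"
      unfolding max_on_def
    proof clarify
      fix a b c assume abc: "(a, b, c) \<in> R"
      have eq: "g c = max (g a) (g b)" if "g \<in> C" for g
        using sub(2)[OF that] abc unfolding max_on_def by blast
      show "u c = max (u a) (u b)"
      proof (rule antisym)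
        show "max (u a) (u b) \<le> u c"
          using le eq by (intro ge) (smt (verit))
        show "u c \<le> max (u a) (u b)"
        proof (rule ccontr)
          assume "\<not> ?thesis"
          then have "u a < u c" "u b < u c" by auto
          then obtain g h where "g \<in> C" "g a < u c" "h \<in> C" "h b < u c" using less by meson
          then obtain k where "k \<in> C" "k a < u c" "k b < u c"
            using common by (metis le_funD le_less_trans)
          then show False using eq[of k] le[of k c] by auto
        qed
      qed
    qed
    show "u x \<le> f x" if "x \<in> vcarrier V" for x
      using \<open>C \<noteq> {}\<close> le sub(3) that by (meson all_not_in_conv order_trans)
    show "u x = 0" if "x \<notin> vcarrier V" for x
    proof -
      have "(INF g\<in>C. g x) = (INF g\<in>C. 0)" by (rule INF_cong) (use sub(4) that in auto)
      then show ?thesis using \<open>C \<noteq> {}\<close> by (simp add: u_def)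
    qed
  qed
  then show ?thesis using le by (auto simp: le_fun_def)
qed

text \<open>Zorn's lemma is applied below \<open>directional f y\<close> instead of below f: this
  functional is at most -f(y) at -y, so a linear functional below it is at least f(y) at y. The
  choice of y decides where the domination is sharp.\<close>

theorem ex_linear_le_sublinear:
  assumes R: "translation_invariant R" and f: "sublinear f" and "max_on R f" and y: "y \<in> vcarrier V"
  obtains g where "vlinear V type_vs g" "max_on R g" "\<And>x. x \<in> vcarrier V \<Longrightarrow> g x \<le> f x" "g y = f y"
proof -
  define D where "D = directional f y"
  have D: "sublinear D" "max_on R D"
    unfolding D_def using sublinear_directional[OF f y] max_on_directional[OF f y R] assms by auto
  have "\<exists>m\<in>below R D. \<forall>g\<in>below R D. m \<ge> g \<longrightarrow> g = m"
  proof (rule predicate_Zorn)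
    show "partial_order_on (below R D) (relation_of (\<lambda>g h. h \<le> g) (below R D))"
      by (rule partial_order_on_relation_ofI) auto
    fix C assume "C \<in> Chains (relation_of (\<lambda>g h. h \<le> g) (below R D))"
    then have C: "C \<subseteq> below R D" "g \<in> C \<Longrightarrow> h \<in> C \<Longrightarrow> g \<le> h \<or> h \<le> g" for g h
      unfolding Chains_def relation_of_def by auto
    show "\<exists>u\<in>below R D. \<forall>g\<in>C. u \<le> g"
    proof (cases "C = {}")
      case True then show ?thesis using restrict_in_below[OF R D, of D] by auto
    next
      case False then show ?thesis using below_chain_bound[OF R D(1) _ C] by blast
    qed
  qed
  then obtain m where m: "m \<in> below R D" and min: "\<And>g. g \<in> below R D \<Longrightarrow> g \<le> m \<Longrightarrow> g = m" by blast
  have sm: "sublinear m" and mm: "max_on R m" and mD: "x \<in> vcarrier V \<Longrightarrow> m x \<le> D x"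
    and m0: "x \<notin> vcarrier V \<Longrightarrow> m x = 0" for x
    using m unfolding below_def by auto
  \<comment> \<open>Minimality makes m equal to its directional derivative at b; the parameter 1 in
    that infimum gives m(a) \<le> m(a + b) - m(b), the converse of subadditivity.\<close>
  have add: "m (vadd V a b) = m a + m b" if ab: "a \<in> vcarrier V" "b \<in> vcarrier V" for a b
  proof -
    let ?g = "\<lambda>x. if x \<in> vcarrier V then directional m b x else 0"
    have "?g \<in> below R D"
    proof (rule restrict_in_below[OF R sublinear_directional[OF sm ab(2)] max_on_directional[OF sm ab(2) R mm]])
      show "directional m b x \<le> D x" if "x \<in> vcarrier V" for x
        using directional_le_self[OF sm ab(2) that] mD[OF that] by simp
    qed
    moreover have "?g \<le> m" using directional_le_self[OF sm ab(2)] m0 by (auto simp: le_fun_def)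
    ultimately have "?g = m" by (rule min)
    then have "m a = directional m b a" using ab(1) fun_cong[of ?g m a] by simp
    then have "m a \<le> m (vadd V a b) - m b" using directional_le_diff[OF sm ab(2,1)] by simp
    then show ?thesis using sublinearD(1)[OF sm ab] by simp
  qed
  have neg: "m (vscale V (-1) x) = - m x" if "x \<in> vcarrier V" for x
    using add[OF that scale_closed[OF that]] sublinear_zero[OF sm] that by (metis add_neg add_eq_0_iff)
  have "m (vscale V c x) = c * m x" if x: "x \<in> vcarrier V" for c x
  proof (cases "0 \<le> c")
    case True then show ?thesis using sublinear_scale[OF sm _ x] by simp
  next
    case False
    have "vscale V c x = vscale V (-1) (vscale V (-c) x)" using x by (simp add: scale_scale)
    then show ?thesis using neg scale_closed[OF x] sublinear_scale[OF sm _ x, of "-c"] False by simp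
  qed
  then have "vlinear V type_vs m" unfolding vlinear_def type_vs_def using add by simp
  moreover have Df: "D x \<le> f x" if "x \<in> vcarrier V" for x
    using directional_le_self[OF f y that] by (simp add: D_def)
  moreover have "f y \<le> m y"
    using directional_le_diff[OF f y scale_closed[OF y], of "-1"] mD[OF scale_closed[OF y], of "-1"]
      neg[OF y] sublinear_zero[OF f] by (simp add: D_def neg_add y)
  ultimately show thesis using that[of m] mm mD Df y by (meson order_trans antisym)
qed

end

section \<open>The Riesz measure of a positive functional\<close>

text \<open>A normalised positive functional on C(X). Continuous functions are total maps here, and
  \<open>mono\<close> compares them on \<open>topspace X\<close> only, so \<Lambda> sees nothing
  outside the space.\<close>

locale positive_functional =
  fixes X :: "'k topology" and \<Lambda> :: "('k \<Rightarrow> real) \<Rightarrow> real"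
  assumes compact: "compact_space X" and Hausdorff: "Hausdorff_space X"
    and add: "continuous_map X euclideanreal f \<Longrightarrow> continuous_map X euclideanreal g
      \<Longrightarrow> \<Lambda> (\<lambda>x. f x + g x) = \<Lambda> f + \<Lambda> g"
    and scale: "continuous_map X euclideanreal f \<Longrightarrow> \<Lambda> (\<lambda>x. c * f x) = c * \<Lambda> f"
    and mono: "continuous_map X euclideanreal f \<Longrightarrow> continuous_map X euclideanreal g
      \<Longrightarrow> (\<And>x. x \<in> topspace X \<Longrightarrow> f x \<le> g x) \<Longrightarrow> \<Lambda> f \<le> \<Lambda> g"
    and one: "\<Lambda> (\<lambda>x. 1) = 1"
begin

lemma normal: "normal_space X"
  using compact_Hausdorff_or_regular_imp_normal_space compact Hausdorff by blast

lemma const: "\<Lambda> (\<lambda>x. c) = c"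
  using scale[of "\<lambda>x. 1" c] one by simp

lemma sum:
  assumes "\<And>i. i \<in> I \<Longrightarrow> continuous_map X euclideanreal (f i)"
  shows "\<Lambda> (\<lambda>x. \<Sum>i\<in>I. f i x) = (\<Sum>i\<in>I. \<Lambda> (f i))"
  using assms
proof (induction I rule: infinite_finite_induct)
  case (insert i I)
  then show ?case using add[of "f i" "\<lambda>x. \<Sum>i\<in>I. f i x"] by (simp add: continuous_map_sum)
qed (simp_all add: const)

section \<open>The content of open sets\<close>

definition subordinate :: "'k set \<Rightarrow> ('k \<Rightarrow> real) set" where
  "subordinate U = {f. continuous_map X euclideanreal f \<and>
     (\<forall>x\<in>topspace X. 0 \<le> f x \<and> f x \<le> 1 \<and> (x \<notin> U \<longrightarrow> f x = 0))}"

text \<open>Riesz's formula for the measure of an open set. Subordinate functions merely vanish off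
  U; up to \<epsilon>, \<open>shrink\<close> makes them vanish off a closed subset of U.\<close>

definition inner_content :: "'k set \<Rightarrow> real" where
  "inner_content U = (SUP f\<in>subordinate U. \<Lambda> f)"

lemma zero_subordinate: "(\<lambda>x. 0) \<in> subordinate U"
  by (simp add: subordinate_def)

lemma subordinate_bounds:
  assumes "f \<in> subordinate U" shows "0 \<le> \<Lambda> f" "\<Lambda> f \<le> 1"
  using mono[of "\<lambda>x. 0" f] mono[of f "\<lambda>x. 1"] assms
  unfolding subordinate_def by (auto simp: const)

lemma le_inner_content: "f \<in> subordinate U \<Longrightarrow> \<Lambda> f \<le> inner_content U"
  unfolding inner_content_def
  by (rule cSUP_upper) (auto intro!: bdd_aboveI2 subordinate_bounds)

lemma inner_content_le: "(\<And>f. f \<in> subordinate U \<Longrightarrow> \<Lambda> f \<le> M) \<Longrightarrow> inner_content U \<le> M"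
  unfolding inner_content_def by (rule cSUP_least) (use zero_subordinate in auto)

lemma inner_content_nonneg: "0 \<le> inner_content U"
  using le_inner_content[OF zero_subordinate] by (simp add: const)

lemma inner_content_mono: "U \<subseteq> W \<Longrightarrow> inner_content U \<le> inner_content W"
  by (rule inner_content_le, rule le_inner_content) (auto simp: subordinate_def)

lemma inner_content_empty: "inner_content {} = 0"
proof (rule antisym[OF inner_content_le inner_content_nonneg])
  fix f assume "f \<in> subordinate {}"
  then show "\<Lambda> f \<le> 0" using mono[of f "\<lambda>x. 0"] unfolding subordinate_def by (simp add: const)
qed

lemma inner_content_topspace: "inner_content (topspace X) = 1"
proof (rule antisym)
  show "inner_content (topspace X) \<le> 1" by (rule inner_content_le) (rule subordinate_bounds)
  have "(\<lambda>x. 1) \<in> subordinate (topspace X)" by (simp add: subordinate_def)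
  then show "1 \<le> inner_content (topspace X)" using le_inner_content one by metis
qed

text \<open>Shrinking \<open>f\<close> by \<open>\<epsilon>\<close> moves its support into a closed, hence compact, subset of \<open>U\<close>.\<close>

lemma shrink:
  assumes f: "f \<in> subordinate U" and e: "0 < \<epsilon>"
  obtains g C where "continuous_map X euclideanreal g" "closedin X C" "C \<subseteq> U"
    "\<And>x. x \<in> topspace X \<Longrightarrow> 0 \<le> g x \<and> g x \<le> 1" "\<And>x. x \<in> topspace X \<Longrightarrow> x \<notin> C \<Longrightarrow> g x = 0"
    "\<Lambda> f \<le> \<Lambda> g + \<epsilon>"
proof -
  have cf: "continuous_map X euclideanreal f" using f unfolding subordinate_def by simp
  define g where "g x = max 0 (f x - \<epsilon>)" for x
  define C where "C = {x \<in> topspace X. f x \<in> {\<epsilon>..}}"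
  have cg: "continuous_map X euclideanreal g"
    unfolding g_def using cf by (intro continuous_intros) auto
  have C: "closedin X C"
    unfolding C_def by (rule closedin_continuous_map_preimage[OF cf]) simp
  have CU: "C \<subseteq> U" using f e unfolding C_def subordinate_def by force
  have b: "0 \<le> g x \<and> g x \<le> 1" if "x \<in> topspace X" for x
    using f e that unfolding subordinate_def g_def by (fastforce simp: max_def)
  have z: "g x = 0" if "x \<in> topspace X" "x \<notin> C" for x using that by (simp add: C_def g_def)
  have "\<Lambda> f \<le> \<Lambda> (\<lambda>x. g x + \<epsilon>)"
    by (rule mono[OF cf]) (auto simp: g_def intro!: continuous_intros cg[unfolded g_def])
  also have "\<dots> = \<Lambda> g + \<epsilon>" using add[OF cg, of "\<lambda>x. \<epsilon>"] by (simp add: const)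
  finally show thesis using that cg C CU b z by blast
qed

text \<open>A shrunken g vanishes off a closed C inside the union. A Urysohn function h with h = 0
  on C - U and h = 1 on C - W splits g into g h and g (1 - h), subordinate to U and W.\<close>

lemma inner_content_Un:
  assumes U: "openin X U" and W: "openin X W"
  shows "inner_content (U \<union> W) \<le> inner_content U + inner_content W"
proof (rule inner_content_le, rule field_le_epsilon)
  fix f \<epsilon> assume f: "f \<in> subordinate (U \<union> W)" and e: "(0::real) < \<epsilon>"
  obtain g C where g: "continuous_map X euclideanreal g" "closedin X C" "C \<subseteq> U \<union> W"
    "\<And>x. x \<in> topspace X \<Longrightarrow> 0 \<le> g x \<and> g x \<le> 1" "\<And>x. x \<in> topspace X \<Longrightarrow> x \<notin> C \<Longrightarrow> g x = 0"
    "\<Lambda> f \<le> \<Lambda> g + \<epsilon>"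
    using shrink[OF f e] by blast
  have "disjnt (C - U) (C - W)" using g(3) by (auto simp: disjnt_def)
  then obtain h where h: "continuous_map X (top_of_set {0..1::real}) h" "h ` (C - U) \<subseteq> {0}" "h ` (C - W) \<subseteq> {1}"
    using Urysohn_lemma[OF normal closedin_diff[OF g(2) U] closedin_diff[OF g(2) W], of 0 1] by auto
  then have ch: "continuous_map X euclideanreal h" and hb: "\<And>x. x \<in> topspace X \<Longrightarrow> h x \<in> {0..1}"
    by (auto simp: continuous_map_in_subtopology)
  have c1: "continuous_map X euclideanreal (\<lambda>x. g x * h x)" and c2: "continuous_map X euclideanreal (\<lambda>x. g x * (1 - h x))"
    by (intro continuous_intros g ch; simp)+
  have b: "0 \<le> g x * h x \<and> g x * h x \<le> 1" "0 \<le> g x * (1 - h x) \<and> g x * (1 - h x) \<le> 1" if "x \<in> topspace X" for x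
    using g(4)[OF that] hb[OF that] by (auto intro!: mult_le_one)
  have "g x * h x = 0" if "x \<in> topspace X" "x \<notin> U" for x
    using g(5)[OF that(1)] h(2) that(2) by (cases "x \<in> C") auto
  then have "(\<lambda>x. g x * h x) \<in> subordinate U" using c1 b by (simp add: subordinate_def)
  moreover have "g x * (1 - h x) = 0" if "x \<in> topspace X" "x \<notin> W" for x
    using g(5)[OF that(1)] h(3) that(2) by (cases "x \<in> C") auto
  then have "(\<lambda>x. g x * (1 - h x)) \<in> subordinate W" using c2 b by (simp add: subordinate_def)
  moreover have "\<Lambda> g = \<Lambda> (\<lambda>x. g x * h x) + \<Lambda> (\<lambda>x. g x * (1 - h x))"
    using add[OF c1 c2] by (simp add: algebra_simps)
  ultimately show "\<Lambda> f \<le> inner_content U + inner_content W + \<epsilon>"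
    using le_inner_content g(6) by (smt (verit))
qed

lemma inner_content_UN_finite:
  assumes "\<And>i. openin X (A i)"
  shows "inner_content (\<Union>i<n::nat. A i) \<le> (\<Sum>i<n. inner_content (A i))"
proof (induction n)
  case 0 then show ?case by (simp add: inner_content_empty)
next
  case (Suc n)
  have "inner_content (\<Union>i<Suc n. A i) = inner_content ((\<Union>i<n. A i) \<union> A n)"
    by (simp add: lessThan_Suc Un_commute)
  also have "\<dots> \<le> inner_content (\<Union>i<n. A i) + inner_content (A n)"
    by (rule inner_content_Un) (use assms in auto)
  finally show ?case using Suc by simp
qed

text \<open>After shrinking, a function vanishes off a compact C, and finitely many of the A i cover
  C; countable subadditivity thus reduces to the finite case.\<close>

lemma inner_content_UN:
  fixes A :: "nat \<Rightarrow> 'k set"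
  assumes A: "\<And>i. openin X (A i)"
  shows "ennreal (inner_content (\<Union>i. A i)) \<le> (\<Sum>i. ennreal (inner_content (A i)))"
proof (cases "(\<Sum>i. ennreal (inner_content (A i))) = top")
  case False
  define s where "s = enn2real (\<Sum>i. ennreal (inner_content (A i)))"
  have s: "(\<Sum>i. ennreal (inner_content (A i))) = ennreal s" "0 \<le> s"
    using False by (simp_all add: s_def less_top)
  have part: "(\<Sum>i<n. inner_content (A i)) \<le> s" for n
  proof -
    have "ennreal (\<Sum>i<n. inner_content (A i)) = (\<Sum>i<n. ennreal (inner_content (A i)))"
      by (simp add: inner_content_nonneg)
    also have "\<dots> \<le> ennreal s" unfolding s(1)[symmetric] by (rule sum_le_suminf) auto
    finally show ?thesis using s(2) by (simp add: inner_content_nonneg)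
  qed
  have "inner_content (\<Union>i. A i) \<le> s"
  proof (rule inner_content_le, rule field_le_epsilon)
    fix f \<epsilon> assume f: "f \<in> subordinate (\<Union>i. A i)" and e: "(0::real) < \<epsilon>"
    obtain g C where g: "continuous_map X euclideanreal g" "closedin X C" "C \<subseteq> (\<Union>i. A i)"
      "\<And>x. x \<in> topspace X \<Longrightarrow> 0 \<le> g x \<and> g x \<le> 1" "\<And>x. x \<in> topspace X \<Longrightarrow> x \<notin> C \<Longrightarrow> g x = 0"
      "\<Lambda> f \<le> \<Lambda> g + \<epsilon>"
      using shrink[OF f e] by blast
    have "compactin X C" by (rule closedin_compact_space[OF compact g(2)])
    then obtain F where F: "finite F" "F \<subseteq> range A" "C \<subseteq> \<Union>F"
      using compactinD[of X C "range A"] A g(3) by (metis imageE)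
    obtain I where I: "finite I" "F = A ` I" using finite_subset_image[OF F(1,2)] by blast
    obtain n where n: "I \<subseteq> {..<n}" using finite_nat_iff_bounded I(1) by blast
    have "C \<subseteq> (\<Union>i<n. A i)" using F(3) I(2) n by blast
    then have "g x = 0" if "x \<in> topspace X" "x \<notin> (\<Union>i<n. A i)" for x using g(5) that by blast
    then have "g \<in> subordinate (\<Union>i<n. A i)" using g(1,4) unfolding subordinate_def by blast
    then have "\<Lambda> g \<le> s"
      using le_inner_content inner_content_UN_finite[OF A] part by (meson order_trans)
    then show "\<Lambda> f \<le> s + \<epsilon>" using g(6) by simp
  qed
  then show ?thesis using s by simp
qed simp

text \<open>A function g that nearly exhausts the content of W \<inter> U vanishes off a closed C
  inside it. Anything subordinate to N = W - C can be added to g without exceeding 1, so N has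
  content at most that of W minus \<Lambda> g.\<close>

lemma inner_content_split:
  assumes U: "openin X U" and W: "openin X W" and \<epsilon>: "0 < \<epsilon>"
  obtains N where "openin X N" "W - U \<subseteq> N"
    "inner_content (W \<inter> U) + inner_content N \<le> inner_content W + \<epsilon>"
proof -
  obtain f where f: "f \<in> subordinate (W \<inter> U)" "inner_content (W \<inter> U) < \<Lambda> f + \<epsilon> / 2"
    using inner_content_le[of "W \<inter> U" "inner_content (W \<inter> U) - \<epsilon> / 2"] \<epsilon> by (smt (verit) field_sum_of_halves)
  obtain g C where g: "continuous_map X euclideanreal g" "closedin X C" "C \<subseteq> W \<inter> U"
      "\<And>x. x \<in> topspace X \<Longrightarrow> 0 \<le> g x \<and> g x \<le> 1" "\<And>x. x \<in> topspace X \<Longrightarrow> x \<notin> C \<Longrightarrow> g x = 0"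
      "\<Lambda> f \<le> \<Lambda> g + \<epsilon> / 2"
    using shrink[OF f(1), of "\<epsilon> / 2"] \<epsilon> by auto
  have "inner_content (W - C) \<le> inner_content W - \<Lambda> g"
  proof (rule inner_content_le)
    fix h assume h: "h \<in> subordinate (W - C)"
    then have ch: "continuous_map X euclideanreal h" by (simp add: subordinate_def)
    have "(\<lambda>x. g x + h x) \<in> subordinate W"
      unfolding subordinate_def
    proof (intro CollectI conjI ballI impI)
      show "continuous_map X euclideanreal (\<lambda>x. g x + h x)" by (intro continuous_intros g ch)
      fix x assume x: "x \<in> topspace X"
      then have hx: "0 \<le> h x" "h x \<le> 1" "x \<notin> W - C \<Longrightarrow> h x = 0" using h by (auto simp: subordinate_def)
      show "0 \<le> g x + h x" using g(4)[OF x] hx by simp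
      show "g x + h x \<le> 1" using g(4,5)[OF x] hx by (cases "x \<in> C") auto
      show "g x + h x = 0" if "x \<notin> W" using g(3,5) x hx that by auto
    qed
    then have "\<Lambda> g + \<Lambda> h \<le> inner_content W" using le_inner_content add[OF g(1) ch] by metis
    then show "\<Lambda> h \<le> inner_content W - \<Lambda> g" by simp
  qed
  moreover have "W - U \<subseteq> W - C" using g(3) by blast
  ultimately show thesis using that[of "W - C"] openin_diff[OF W g(2)] f(2) g(6) by simp
qed

section \<open>The outer measure and Caratheodory measurability\<close>

definition outer :: "'k set \<Rightarrow> ennreal" where
  "outer A = (INF U\<in>{U. openin X U \<and> A \<subseteq> U}. ennreal (inner_content U))"

lemma outer_le: "openin X U \<Longrightarrow> A \<subseteq> U \<Longrightarrow> outer A \<le> ennreal (inner_content U)"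
  unfolding outer_def by (rule INF_lower) simp

lemma outer_open: "openin X U \<Longrightarrow> outer U = ennreal (inner_content U)"
  by (rule antisym[OF outer_le]) (auto simp: outer_def intro!: INF_greatest ennreal_leI inner_content_mono)

lemma outer_mono: "A \<subseteq> B \<Longrightarrow> outer A \<le> outer B"
  unfolding outer_def by (rule INF_superset_mono) auto

lemma outer_finite: "A \<subseteq> topspace X \<Longrightarrow> outer A < top"
  using outer_le[OF openin_topspace] by (metis ennreal_less_top order_le_less_trans)

lemma outer_close:
  assumes "A \<subseteq> topspace X" and "0 < \<epsilon>"
  obtains U where "openin X U" "A \<subseteq> U" "ennreal (inner_content U) \<le> outer A + ennreal \<epsilon>"
proof -
  have "outer A < outer A + ennreal \<epsilon>" using outer_finite[OF assms(1)] assms(2) by simp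
  then obtain U where "openin X U" "A \<subseteq> U" "ennreal (inner_content U) < outer A + ennreal \<epsilon>"
    unfolding outer_def INF_less_iff by auto
  then show thesis using that by (simp add: less_imp_le)
qed

lemma outer_measure_space_outer: "outer_measure_space (Pow (topspace X)) outer"
  unfolding outer_measure_space_def
proof (intro conjI)
  show "positive (Pow (topspace X)) outer"
    by (simp add: positive_def outer_open inner_content_empty)
  show "increasing (Pow (topspace X)) outer" by (simp add: increasing_def outer_mono)
  show "countably_subadditive (Pow (topspace X)) outer"
    unfolding countably_subadditive_def
  proof (intro allI impI)
    fix A :: "nat \<Rightarrow> 'k set" assume A: "range A \<subseteq> Pow (topspace X)"
    show "outer (\<Union>i. A i) \<le> (\<Sum>i. outer (A i))"
    proof (rule ennreal_le_epsilon)
      fix e :: real assume e: "0 < e"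
      have "\<exists>U. openin X U \<and> A n \<subseteq> U \<and> ennreal (inner_content U) \<le> outer (A n) + ennreal (e * (1/2)^Suc n)" for n
        using outer_close[of "A n" "e * (1/2)^Suc n"] A e by (metis PowD mult_pos_pos range_subsetD zero_less_power zero_less_divide_1_iff zero_less_numeral)
      then obtain U where U: "\<And>n. openin X (U n)" "\<And>n. A n \<subseteq> U n"
        "\<And>n. ennreal (inner_content (U n)) \<le> outer (A n) + ennreal (e * (1/2)^Suc n)" by metis
      have "outer (\<Union>i. A i) \<le> ennreal (inner_content (\<Union>i. U i))"
        by (rule outer_le) (use U in blast)+
      also have "\<dots> \<le> (\<Sum>i. ennreal (inner_content (U i)))" by (rule inner_content_UN[OF U(1)])
      also have "\<dots> \<le> (\<Sum>n. outer (A n) + ennreal (e * (1/2)^Suc n))"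
        by (intro suminf_le U(3)) auto
      also have "\<dots> = (\<Sum>n. outer (A n)) + (\<Sum>n. ennreal (e * (1/2)^Suc n))"
        by (subst suminf_add[symmetric]) auto
      also have "(\<Sum>n. ennreal (e * (1/2)^Suc n)) = ennreal e"
        using sums_mult[OF power_half_series, of e] e by (intro suminf_ennreal_eq) auto
      finally show "outer (\<Union>i. A i) \<le> (\<Sum>n. outer (A n)) + ennreal e" .
    qed
  qed
qed

lemma outer_Un:
  assumes "A \<subseteq> topspace X" "B \<subseteq> topspace X" shows "outer (A \<union> B) \<le> outer A + outer B"
proof (rule ennreal_le_epsilon)
  fix e :: real assume e: "0 < e"
  obtain U where U: "openin X U" "A \<subseteq> U" "ennreal (inner_content U) \<le> outer A + ennreal (e / 2)"
    using outer_close[OF assms(1), of "e/2"] e by auto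
  obtain W where W: "openin X W" "B \<subseteq> W" "ennreal (inner_content W) \<le> outer B + ennreal (e / 2)"
    using outer_close[OF assms(2), of "e/2"] e by auto
  have "outer (A \<union> B) \<le> ennreal (inner_content (U \<union> W))"
    by (rule outer_le) (use U W in auto)
  also have "\<dots> \<le> ennreal (inner_content U) + ennreal (inner_content W)"
    using inner_content_Un[OF U(1) W(1)] by (metis ennreal_leI ennreal_plus inner_content_nonneg)
  also have "\<dots> \<le> (outer A + ennreal (e / 2)) + (outer B + ennreal (e / 2))"
    by (intro add_mono U W)
  also have "\<dots> = outer A + outer B + (ennreal (e / 2) + ennreal (e / 2))" by (simp add: ac_simps)
  also have "ennreal (e / 2) + ennreal (e / 2) = ennreal e"
    using e by (subst ennreal_plus[symmetric]) auto
  finally show "outer (A \<union> B) \<le> outer A + outer B + ennreal e" .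
qed

text \<open>Cover A almost optimally by an open W and split W along U with
  \<open>inner_content_split\<close>; this is the half of Caratheodory's condition that
  subadditivity does not give.\<close>

lemma open_lambda_system:
  assumes U: "openin X U"
  shows "U \<in> lambda_system (topspace X) (Pow (topspace X)) outer"
  unfolding lambda_system_def
proof (intro CollectI conjI ballI)
  show "U \<in> Pow (topspace X)" using openin_subset[OF U] by simp
  fix A assume "A \<in> Pow (topspace X)"
  then have A: "A \<subseteq> topspace X" by simp
  have eq: "(topspace X - U) \<inter> A = A - U" "U \<inter> A = A \<inter> U" using A by auto
  show "outer (U \<inter> A) + outer ((topspace X - U) \<inter> A) = outer A"
    unfolding eq
  proof (rule antisym)
    have "A = (A \<inter> U) \<union> (A - U)" by auto
    then show "outer A \<le> outer (A \<inter> U) + outer (A - U)"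
      using outer_Un[of "A \<inter> U" "A - U"] A by (metis Diff_subset Int_lower1 subset_trans)
    show "outer (A \<inter> U) + outer (A - U) \<le> outer A"
    proof (rule ennreal_le_epsilon)
      fix e :: real assume e: "0 < e"
      obtain W where W: "openin X W" "A \<subseteq> W" "ennreal (inner_content W) \<le> outer A + ennreal (e / 2)"
        using outer_close[OF A, of "e/2"] e by auto
      obtain N where N: "openin X N" "W - U \<subseteq> N"
        "inner_content (W \<inter> U) + inner_content N \<le> inner_content W + e / 2"
        using inner_content_split[OF U W(1), of "e/2"] e by auto
      have "outer (A \<inter> U) + outer (A - U) \<le> ennreal (inner_content (W \<inter> U)) + ennreal (inner_content N)"
        by (intro add_mono outer_le) (use U W N in auto)
      also have "\<dots> \<le> ennreal (inner_content W) + ennreal (e / 2)"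
        using N(3) e by (metis ennreal_leI ennreal_plus inner_content_nonneg half_gt_zero less_imp_le)
      also have "\<dots> \<le> outer A + ennreal (e / 2) + ennreal (e / 2)" by (intro add_right_mono W)
      also have "\<dots> = outer A + (ennreal (e / 2) + ennreal (e / 2))" by (simp add: ac_simps)
      also have "ennreal (e / 2) + ennreal (e / 2) = ennreal e"
        using e by (subst ennreal_plus[symmetric]) auto
      finally show "outer (A \<inter> U) + outer (A - U) \<le> outer A + ennreal e" .
    qed
  qed
qed

definition riesz_measure :: "'k measure" where
  "riesz_measure = measure_of (topspace X) {U. openin X U} outer"

lemma opens_Pow: "{U. openin X U} \<subseteq> Pow (topspace X)"
  using openin_subset by auto

lemma space_riesz: "space riesz_measure = topspace X"
  unfolding riesz_measure_def by (rule space_measure_of[OF opens_Pow])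

lemma sets_riesz: "sets riesz_measure = sigma_sets (topspace X) {U. openin X U}"
  unfolding riesz_measure_def by (rule sets_measure_of[OF opens_Pow])

text \<open>Open sets satisfy Caratheodory's condition, so the Borel sets form a sub-sigma-algebra
  of the \<open>lambda_system\<close>, on which \<open>outer\<close> is countably additive.\<close>

lemma emeasure_riesz:
  assumes "A \<in> sets riesz_measure" shows "emeasure riesz_measure A = outer A"
proof -
  interpret P: sigma_algebra "topspace X" "Pow (topspace X)" by (rule sigma_algebra_Pow)
  let ?L = "lambda_system (topspace X) (Pow (topspace X)) outer"
  let ?S = "sigma_sets (topspace X) {U. openin X U}"
  have L: "measure_space (topspace X) ?L outer"
    by (rule P.caratheodory_lemma[OF outer_measure_space_outer])
  then have SL: "?S \<subseteq> ?L"
    using open_lambda_system unfolding measure_space_def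
    by (intro sigma_algebra.sigma_sets_subset) auto
  have "sigma_algebra (topspace X) ?S" by (rule sigma_algebra_sigma_sets[OF opens_Pow])
  moreover have "positive ?S outer" "countably_additive ?S outer"
    using L SL unfolding measure_space_def countably_additive_def positive_def
    by (blast intro: order_trans[OF _ SL])+
  ultimately have "measure_space (topspace X) ?S outer" unfolding measure_space_def by simp
  then show ?thesis
    using emeasure_measure_of[OF riesz_measure_def opens_Pow] assms
    unfolding sets_riesz measure_space_def by simp
qed

lemma open_sets: "openin X U \<Longrightarrow> U \<in> sets riesz_measure"
  by (simp add: sets_riesz sigma_sets.Basic)

lemma prob_space_riesz: "prob_space riesz_measure"
  by (rule prob_spaceI) (simp add: space_riesz emeasure_riesz open_sets outer_open inner_content_topspace)

text \<open>Outer regularity is built into \<open>outer\<close>. Inner regularity follows by taking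
  complements, since closed subsets of a compact space are compact and the total mass is 1.\<close>

lemma regular_riesz: "regular_borel_prob X riesz_measure"
  unfolding regular_borel_prob_def
proof (intro conjI ballI)
  interpret prob_space riesz_measure by (rule prob_space_riesz)
  let ?\<nu> = "emeasure riesz_measure"
  have outer_reg: "?\<nu> A = (INF U\<in>{U. openin X U \<and> A \<subseteq> U}. ?\<nu> U)" if "A \<in> sets riesz_measure" for A
    unfolding emeasure_riesz[OF that] outer_def[of A]
    by (rule INF_cong) (auto simp: emeasure_riesz open_sets outer_open)
  fix A assume A: "A \<in> sets riesz_measure"
  show "?\<nu> A = (INF U\<in>{U. openin X U \<and> A \<subseteq> U}. ?\<nu> U)" by (rule outer_reg[OF A])
  let ?Ac = "topspace X - A"
  have Ac: "?Ac \<in> sets riesz_measure" using A sets.compl_sets space_riesz by metis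
  show "?\<nu> A = (SUP C\<in>{C. compactin X C \<and> closedin X C \<and> C \<subseteq> A}. ?\<nu> C)"
  proof (rule antisym)
    have compl: "?\<nu> (topspace X - B) = 1 - ?\<nu> B" if "B \<in> sets riesz_measure" for B
      using emeasure_compl[OF that] emeasure_space_1 by (simp add: space_riesz)
    have "A = topspace X - ?Ac" using sets.sets_into_space[OF A] by (auto simp: space_riesz)
    then have "?\<nu> A = 1 - ?\<nu> ?Ac" using compl[OF Ac] by simp
    also have "\<dots> = (SUP U\<in>{U. openin X U \<and> ?Ac \<subseteq> U}. 1 - ?\<nu> U)"
      unfolding outer_reg[OF Ac] by (rule ennreal_INF_const_minus[symmetric]) (auto intro: exI[of _ "topspace X"])
    also have "\<dots> \<le> (SUP C\<in>{C. compactin X C \<and> closedin X C \<and> C \<subseteq> A}. ?\<nu> C)"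
    proof (rule SUP_mono)
      fix U assume "U \<in> {U. openin X U \<and> ?Ac \<subseteq> U}"
      then have U: "openin X U" "?Ac \<subseteq> U" by auto
      have "closedin X (topspace X - U)" using U(1) by blast
      moreover have "compactin X (topspace X - U)" using calculation closedin_compact_space[OF compact] by simp
      moreover have "topspace X - U \<subseteq> A" using U(2) by auto
      ultimately show "\<exists>C\<in>{C. compactin X C \<and> closedin X C \<and> C \<subseteq> A}. 1 - ?\<nu> U \<le> ?\<nu> C"
        using compl[OF open_sets[OF U(1)]] by (intro bexI[of _ "topspace X - U"]) auto
    qed
    finally show "?\<nu> A \<le> (SUP C\<in>{C. compactin X C \<and> closedin X C \<and> C \<subseteq> A}. ?\<nu> C)" .
    show "(SUP C\<in>{C. compactin X C \<and> closedin X C \<and> C \<subseteq> A}. ?\<nu> C) \<le> ?\<nu> A"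
      by (rule SUP_least) (auto intro: emeasure_mono A)
  qed
qed (use prob_space_riesz space_riesz sets_riesz in auto)

end

lemma continuous_map_bounded:
  assumes "compact_space X" "continuous_map X euclideanreal f"
  obtains M where "0 < M" "\<And>x. x \<in> topspace X \<Longrightarrow> \<bar>f x\<bar> \<le> M"
proof -
  have "compact (f ` topspace X)"
    using image_compactin[of X "topspace X" euclideanreal f] assms by (simp add: compact_space_def)
  then obtain M where "0 < M" "\<And>y. y \<in> f ` topspace X \<Longrightarrow> norm y \<le> M"
    using compact_imp_bounded bounded_pos by metis
  then show thesis using that by auto
qed

lemma continuous_map_measurable:
  assumes "regular_borel_prob X \<nu>" "continuous_map X euclideanreal f"
  shows "f \<in> borel_measurable \<nu>"
proof (rule borel_measurableI)
  fix S :: "real set" assume "open S"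
  then have "openin X {x \<in> topspace X. f x \<in> S}"
    using openin_continuous_map_preimage[OF assms(2)] by simp
  moreover have "f -` S \<inter> space \<nu> = {x \<in> topspace X. f x \<in> S}"
    using assms(1) by (auto simp: regular_borel_prob_def)
  ultimately show "f -` S \<inter> space \<nu> \<in> sets \<nu>"
    using assms(1) by (simp add: regular_borel_prob_def sigma_sets.Basic)
qed

lemma continuous_map_integrable:
  assumes "regular_borel_prob X \<nu>" "compact_space X" "continuous_map X euclideanreal f"
  shows "integrable \<nu> f"
proof -
  interpret prob_space \<nu> using assms(1) by (simp add: regular_borel_prob_def)
  obtain M where "\<And>x. x \<in> topspace X \<Longrightarrow> \<bar>f x\<bar> \<le> M" using continuous_map_bounded[OF assms(2,3)] by blast
  then show ?thesis
    using assms(1) continuous_map_measurable[OF assms(1,3)]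
    by (intro integrable_const_bound[of _ M]) (auto simp: regular_borel_prob_def)
qed

context positive_functional
begin

text \<open>The horizontal slices of \<open>f\<close> of height \<open>\<epsilon>\<close> are \<open>\<epsilon>\<close> times subordinate functions.\<close>

theorem le_integral_riesz:
  assumes f: "continuous_map X euclideanreal f" and nn: "\<And>x. x \<in> topspace X \<Longrightarrow> 0 \<le> f x"
  shows "\<Lambda> f \<le> (\<integral>x. f x \<partial>riesz_measure)"
proof (rule field_le_epsilon)
  interpret prob_space riesz_measure by (rule prob_space_riesz)
  fix \<epsilon> :: real assume e: "0 < \<epsilon>"
  obtain M where M: "\<And>x. x \<in> topspace X \<Longrightarrow> \<bar>f x\<bar> \<le> M" using continuous_map_bounded[OF compact f] by blast
  \<comment> \<open>N slices of height \<epsilon> exhaust the range of f.\<close>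
  obtain N :: nat where N: "M \<le> N * \<epsilon>" using reals_Archimedean3[OF e] by (meson less_imp_le)
  define U where "U k = {x \<in> topspace X. f x \<in> {real k * \<epsilon><..}}" for k
  define s where "s k x = min (f x) (real (Suc k) * \<epsilon>) - min (f x) (real k * \<epsilon>)" for k x
  have U: "openin X (U k)" for k
    unfolding U_def by (rule openin_continuous_map_preimage[OF f]) simp
  have cs: "continuous_map X euclideanreal (s k)" for k
    unfolding s_def by (intro continuous_intros f) auto
  have slice: "\<Lambda> (s k) \<le> \<epsilon> * measure riesz_measure (U k)" for k
  proof -
    have "0 \<le> s k x / \<epsilon> \<and> s k x / \<epsilon> \<le> 1 \<and> (x \<notin> U k \<longrightarrow> s k x / \<epsilon> = 0)" if "x \<in> topspace X" for x
      using that e by (auto simp: s_def U_def min_def field_simps)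
    moreover have "continuous_map X euclideanreal (\<lambda>x. (1 / \<epsilon>) * s k x)"
      by (intro continuous_intros cs) auto
    ultimately have "(\<lambda>x. (1 / \<epsilon>) * s k x) \<in> subordinate (U k)"
      unfolding subordinate_def by simp
    then have "1 / \<epsilon> * \<Lambda> (s k) \<le> inner_content (U k)" using le_inner_content scale[OF cs] by metis
    moreover have "measure riesz_measure (U k) = inner_content (U k)"
      by (simp add: measure_def emeasure_riesz open_sets U outer_open inner_content_nonneg)
    ultimately show ?thesis using e by (simp add: field_simps)
  qed
  have tele: "(\<Sum>k<N. s k x) = f x" if "x \<in> topspace X" for x
  proof -
    have "(\<Sum>k<N. s k x) = min (f x) (N * \<epsilon>) - min (f x) (0 * \<epsilon>)"
      unfolding s_def using sum_lessThan_telescope[of "\<lambda>k. min (f x) (real k * \<epsilon>)" N] by simp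
    then show ?thesis using M[OF that] nn[OF that] N by simp
  qed
  \<comment> \<open>On \<open>U k\<close> the value f x + \<epsilon> exceeds (k + 1) \<epsilon>, so
    the k-th slice of f + \<epsilon> is full there, and the slices telescope. This shift by
    \<epsilon> is the whole error of the estimate.\<close>
  have step: "(\<Sum>k<N. \<epsilon> * indicator (U k) x) \<le> f x + \<epsilon>" if "x \<in> topspace X" for x
  proof -
    have "(\<Sum>k<N. \<epsilon> * indicator (U k) x)
        \<le> (\<Sum>k<N. min (f x + \<epsilon>) (real (Suc k) * \<epsilon>) - min (f x + \<epsilon>) (real k * \<epsilon>))"
      by (rule sum_mono) (use that e in \<open>auto simp: U_def indicator_def min_def field_simps\<close>)
    also have "\<dots> = min (f x + \<epsilon>) (N * \<epsilon>) - min (f x + \<epsilon>) (0 * \<epsilon>)"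
      using sum_lessThan_telescope[of "\<lambda>k. min (f x + \<epsilon>) (real k * \<epsilon>)" N] by simp
    also have "\<dots> \<le> f x + \<epsilon>" using nn[OF that] e by simp
    finally show ?thesis .
  qed
  have ind: "integrable riesz_measure (\<lambda>x. \<epsilon> * indicator (U k) x)" for k
    by (intro integrable_mult_right integrable_real_indicator) (simp_all add: open_sets U less_top[symmetric])
  have "\<Lambda> f \<le> \<Lambda> (\<lambda>x. \<Sum>k<N. s k x)"
    by (rule mono[OF f]) (auto simp: tele intro!: continuous_map_sum cs)
  also have "\<dots> = (\<Sum>k<N. \<Lambda> (s k))" by (rule sum[OF cs])
  also have "\<dots> \<le> (\<Sum>k<N. \<epsilon> * measure riesz_measure (U k))" by (rule sum_mono[OF slice])
  also have "\<dots> = (\<integral>x. (\<Sum>k<N. \<epsilon> * indicator (U k) x) \<partial>riesz_measure)"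
    using open_sets[OF U] by (subst Bochner_Integration.integral_sum[OF ind]) (simp add: Int_absorb2 sets.sets_into_space)
  also have "\<dots> \<le> (\<integral>x. f x + \<epsilon> \<partial>riesz_measure)"
  proof (rule integral_mono)
    show "integrable riesz_measure (\<lambda>x. \<Sum>k<N. \<epsilon> * indicator (U k) x)"
      by (rule Bochner_Integration.integrable_sum[OF ind])
    show "integrable riesz_measure (\<lambda>x. f x + \<epsilon>)"
      using continuous_map_integrable[OF regular_riesz compact f] by simp
  qed (use step space_riesz in auto)
  also have "\<dots> = (\<integral>x. f x \<partial>riesz_measure) + \<epsilon>"
    using continuous_map_integrable[OF regular_riesz compact f] by (simp add: prob_space)
  finally show "\<Lambda> f \<le> (\<integral>x. f x \<partial>riesz_measure) + \<epsilon>" .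
qed

end

section \<open>Pietsch domination\<close>

definition continuous_vs :: "'k topology \<Rightarrow> ('k \<Rightarrow> real) vs" where
  "continuous_vs X = \<lparr>vcarrier = {f. continuous_map X euclideanreal f}, vzero = (\<lambda>x. 0),
     vadd = (\<lambda>f g x. f x + g x), vscale = (\<lambda>c f x. c * f x)\<rparr>"

lemma real_vs_continuous: "real_vs (continuous_vs X)"
  by standard (auto simp: continuous_vs_def algebra_simps intro!: continuous_intros)

text \<open>A minimax argument by Hahn-Banach. \<open>dom\<close> says that no finite sum of the
  functions F a - b a has a negative supremum, and \<open>cone\<close> makes these sums a convex
  cone. The functional obtained is positive and normalised with L (F a) \<ge> b a, and \<nu> is its
  Riesz measure.\<close>

theorem pietsch_domination:
  fixes F :: "'a \<Rightarrow> 'k \<Rightarrow> real" and b :: "'a \<Rightarrow> real"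
  assumes X: "compact_space X" "Hausdorff_space X" "topspace X \<noteq> {}"
    and F: "\<And>a. a \<in> A \<Longrightarrow> continuous_map X euclideanreal (F a)"
    and nonneg: "\<And>a x. a \<in> A \<Longrightarrow> x \<in> topspace X \<Longrightarrow> 0 \<le> F a x"
    and cone: "\<And>a c. a \<in> A \<Longrightarrow> 0 < c \<Longrightarrow>
      \<exists>a'\<in>A. (\<forall>x\<in>topspace X. F a' x = c * F a x) \<and> b a' = c * b a"
    and dom: "\<And>(n::nat) a M. (\<And>i. i < n \<Longrightarrow> a i \<in> A) \<Longrightarrow>
      (\<And>x. x \<in> topspace X \<Longrightarrow> (\<Sum>i<n. F (a i) x) \<le> M) \<Longrightarrow> (\<Sum>i<n. b (a i)) \<le> M"
  shows "\<exists>\<nu>. regular_borel_prob X \<nu> \<and> (\<forall>a\<in>A. b a \<le> (\<integral>x. F a x \<partial>\<nu>))"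
proof -
  let ?C = "\<lambda>f. continuous_map X euclideanreal f"
  interpret V: real_vs "continuous_vs X" by (rule real_vs_continuous)
  have V: "vcarrier (continuous_vs X) = {f. ?C f}" "vadd (continuous_vs X) f g = (\<lambda>x. f x + g x)"
    "vscale (continuous_vs X) c f = (\<lambda>x. c * f x)" for f g c
    by (simp_all add: continuous_vs_def)
  \<comment> \<open>Lists allow repetition and make appending correspond to addition; positive
    multiples are supplied by \<open>cone\<close>, so coefficients do not appear.\<close>
  define G where "G as x = (\<Sum>a\<leftarrow>as. F a x) - (\<Sum>a\<leftarrow>as. b a)" for as x
  have G_append: "G (as @ bs) x = G as x + G bs x" for as bs x by (simp add: G_def)
  have G_nonneg: "0 \<le> M" if "set as \<subseteq> A" "\<And>x. x \<in> topspace X \<Longrightarrow> G as x \<le> M" for as M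
  proof -
    have *: "(\<Sum>a\<leftarrow>as. h a) = (\<Sum>i<length as. h (as ! i))" for h :: "'a \<Rightarrow> real"
      by (simp add: sum_list_sum_nth atLeast0LessThan)
    have "(\<Sum>i<length as. b (as ! i)) \<le> M + (\<Sum>a\<leftarrow>as. b a)"
      by (rule dom) (use that in \<open>auto simp: G_def * algebra_simps\<close>)
    then show ?thesis by (simp add: *)
  qed
  have G_scale: "\<exists>bs. set bs \<subseteq> A \<and> (\<forall>x\<in>topspace X. G bs x = c * G as x)"
    if "set as \<subseteq> A" "0 < c" for as c
    using that
  proof (induction as)
    case Nil then show ?case by (intro exI[of _ "[]"]) (simp add: G_def)
  next
    case (Cons a as)
    then obtain bs where bs: "set bs \<subseteq> A" "\<forall>x\<in>topspace X. G bs x = c * G as x" by auto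
    obtain a' where "a' \<in> A" "\<forall>x\<in>topspace X. F a' x = c * F a x" "b a' = c * b a"
      using cone[of a c] Cons.prems by auto
    then show ?case using bs by (intro exI[of _ "a' # bs"]) (auto simp: G_def algebra_simps)
  qed
  \<comment> \<open>The infimum of sup (f + G as) over all lists. The empty list gives S f \<le> sup
    f, which makes a dominated functional positive and normalised; for f = -F a the list [a] gives S
    f \<le> -b a.\<close>
  define S where "S f = Inf {M. \<exists>as. set as \<subseteq> A \<and> (\<forall>x\<in>topspace X. f x + G as x \<le> M)}" for f
  have bdd: "bdd_below {M. \<exists>as. set as \<subseteq> A \<and> (\<forall>x\<in>topspace X. f x + G as x \<le> M)}"
    if f: "?C f" for f
  proof -
    obtain K where K: "\<And>x. x \<in> topspace X \<Longrightarrow> \<bar>f x\<bar> \<le> K"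
      using continuous_map_bounded[OF X(1) f] by blast
    have "- K \<le> M" if as: "set as \<subseteq> A" "\<And>x. x \<in> topspace X \<Longrightarrow> f x + G as x \<le> M" for M as
      using G_nonneg[OF as(1), of "M + K"] as(2) K by (force simp: abs_le_iff)
    then show ?thesis by (intro bdd_belowI[of _ "- K"]) blast
  qed
  have S_le: "S f \<le> M" if "?C f" "set as \<subseteq> A" "\<And>x. x \<in> topspace X \<Longrightarrow> f x + G as x \<le> M" for f M as
    unfolding S_def by (rule cInf_lower[OF _ bdd[OF that(1)]]) (use that in blast)
  have S_ge: "M \<le> S f" if f: "?C f" and M: "\<And>as N. set as \<subseteq> A
      \<Longrightarrow> (\<And>x. x \<in> topspace X \<Longrightarrow> f x + G as x \<le> N) \<Longrightarrow> M \<le> N" for f M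
    unfolding S_def
  proof (rule cInf_greatest)
    obtain K where "\<And>x. x \<in> topspace X \<Longrightarrow> \<bar>f x\<bar> \<le> K"
      using continuous_map_bounded[OF X(1) f] by blast
    then have "\<forall>x\<in>topspace X. f x + G [] x \<le> K" by (auto simp: G_def abs_le_iff)
    then have "K \<in> {N. \<exists>as. set as \<subseteq> A \<and> (\<forall>x\<in>topspace X. f x + G as x \<le> N)}"
      by (intro CollectI exI[of _ "[]"]) simp
    then show "{N. \<exists>as. set as \<subseteq> A \<and> (\<forall>x\<in>topspace X. f x + G as x \<le> N)} \<noteq> {}" by blast
  qed (use M in blast)
  have sub: "V.sublinear S"
    unfolding V.sublinear_def V
  proof (intro conjI ballI allI impI; clarsimp)
    fix f g assume f: "?C f" and g: "?C g"
    have "S (\<lambda>x. f x + g x) - S g \<le> S f"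
    proof (rule S_ge[OF f])
      fix as N assume as: "set as \<subseteq> A" "\<And>x. x \<in> topspace X \<Longrightarrow> f x + G as x \<le> N"
      have "S (\<lambda>x. f x + g x) - N \<le> S g"
      proof (rule S_ge[OF g])
        fix bs M assume bs: "set bs \<subseteq> A" "\<And>x. x \<in> topspace X \<Longrightarrow> g x + G bs x \<le> M"
        have "S (\<lambda>x. f x + g x) \<le> N + M"
          by (rule S_le[of _ "as @ bs"])
            (use f g as bs in \<open>fastforce simp: G_append intro!: continuous_intros\<close>)+
        then show "S (\<lambda>x. f x + g x) - N \<le> M" by simp
      qed
      then show "S (\<lambda>x. f x + g x) - S g \<le> N" by simp
    qed
    then show "S (\<lambda>x. f x + g x) \<le> S f + S g" by simp
  next
    fix c :: real and f assume c: "0 \<le> c" and f: "?C f"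
    have cf: "?C (\<lambda>x. c * f x)" by (intro continuous_intros f)
    show "S (\<lambda>x. c * f x) \<le> c * S f"
    proof (cases "c = 0")
      case True
      then show ?thesis using S_le[OF cf, of "[]" 0] by (simp add: G_def)
    next
      case False
      then have c: "0 < c" using c by simp
      have "S (\<lambda>x. c * f x) / c \<le> S f"
      proof (rule S_ge[OF f])
        fix as N assume as: "set as \<subseteq> A" "\<And>x. x \<in> topspace X \<Longrightarrow> f x + G as x \<le> N"
        obtain bs where bs: "set bs \<subseteq> A" "\<forall>x\<in>topspace X. G bs x = c * G as x"
          using G_scale[OF as(1) c] by blast
        have "S (\<lambda>x. c * f x) \<le> c * N"
        proof (rule S_le[OF cf bs(1)])
          fix x assume x: "x \<in> topspace X"
          have "c * (f x + G as x) \<le> c * N" using as(2)[OF x] c by (intro mult_left_mono) auto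
          then show "c * f x + G bs x \<le> c * N" using bs(2) x by (simp add: algebra_simps)
        qed
        then show "S (\<lambda>x. c * f x) / c \<le> N" using c by (simp add: field_simps)
      qed
      then show ?thesis using c by (simp add: field_simps)
    qed
  qed
  \<comment> \<open>The empty relation leaves plain domination; the base point 0 carries no
    information.\<close>
  obtain L where L: "vlinear (continuous_vs X) type_vs L" "\<And>f. ?C f \<Longrightarrow> L f \<le> S f"
    using V.ex_linear_le_sublinear[of "{}" S "\<lambda>x. 0"] sub
    by (auto simp: V.translation_invariant_def max_on_def V)
  have L_add: "L (\<lambda>x. f x + g x) = L f + L g" if "?C f" "?C g" for f g
    using L(1) that by (auto simp: vlinear_def V type_vs_def)
  have L_scale: "L (\<lambda>x. c * f x) = c * L f" if "?C f" for f c
    using L(1) that by (auto simp: vlinear_def V type_vs_def)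
  have L_le: "L f \<le> M" if f: "?C f" and "set as \<subseteq> A" "\<And>x. x \<in> topspace X \<Longrightarrow> f x + G as x \<le> M" for f M as
    using L(2)[OF f] S_le[OF that] by simp
  have one: "L (\<lambda>x. 1) = 1"
  proof (rule antisym)
    show "L (\<lambda>x. 1) \<le> 1" by (rule L_le[of _ "[]"]) (auto simp: G_def)
    have "L (\<lambda>x. -1) \<le> -1" by (rule L_le[of _ "[]"]) (auto simp: G_def)
    then show "1 \<le> L (\<lambda>x. 1)" using L_scale[of "\<lambda>x. 1" "-1"] by simp
  qed
  interpret positive_functional X L
  proof
    fix f g assume fg: "?C f" "?C g" "\<And>x. x \<in> topspace X \<Longrightarrow> f x \<le> g x"
    have cg: "?C (\<lambda>x. (-1) * g x)" using fg by (intro continuous_intros) auto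
    have "L (\<lambda>x. f x + (-1) * g x) \<le> 0"
      by (rule L_le[of _ "[]"]) (use fg cg in \<open>auto simp: G_def intro!: continuous_intros\<close>)
    then show "L f \<le> L g" using L_add[OF fg(1) cg] L_scale[OF fg(2), of "-1"] by simp
  qed (use X L_add L_scale one in auto)
  have "b a \<le> (\<integral>x. F a x \<partial>riesz_measure)" if a: "a \<in> A" for a
  proof -
    have c: "?C (\<lambda>x. (-1) * F a x)" using F[OF a] by (intro continuous_intros) auto
    have "L (\<lambda>x. (-1) * F a x) \<le> - b a" by (rule L_le[OF c, of "[a]"]) (use a in \<open>auto simp: G_def\<close>)
    then have "b a \<le> L (F a)" using L_scale[OF F[OF a], of "-1"] by simp
    also have "\<dots> \<le> (\<integral>x. F a x \<partial>riesz_measure)" by (rule le_integral_riesz[OF F[OF a] nonneg[OF a]])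
    finally show ?thesis .
  qed
  then show ?thesis using regular_riesz by blast
qed

section \<open>Lattice homomorphisms on principal ideals\<close>

lemma scaleR_sup:
  fixes x y :: "'e::banach_lattice"
  assumes "0 \<le> c" shows "c *\<^sub>R sup x y = sup (c *\<^sub>R x) (c *\<^sub>R y)"
proof (cases "c = 0")
  case False
  then have c: "0 < c" using assms by simp
  show ?thesis
  proof (rule antisym)
    have "x \<le> (1 / c) *\<^sub>R sup (c *\<^sub>R x) (c *\<^sub>R y)" "y \<le> (1 / c) *\<^sub>R sup (c *\<^sub>R x) (c *\<^sub>R y)"
      using scaleR_left_mono[OF sup_ge1, of "1/c" "c *\<^sub>R x" "c *\<^sub>R y"]
        scaleR_left_mono[OF sup_ge2, of "1/c" "c *\<^sub>R y" "c *\<^sub>R x"] c by simp_all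
    then have "c *\<^sub>R sup x y \<le> c *\<^sub>R ((1 / c) *\<^sub>R sup (c *\<^sub>R x) (c *\<^sub>R y))"
      by (intro scaleR_left_mono le_supI assms)
    then show "c *\<^sub>R sup x y \<le> sup (c *\<^sub>R x) (c *\<^sub>R y)" using c by simp
  qed (simp add: scaleR_left_mono assms)
qed simp

lemma abs_scaleR_lattice: "\<bar>c *\<^sub>R (x :: 'e::banach_lattice)\<bar> = \<bar>c\<bar> *\<^sub>R \<bar>x\<bar>"
proof (cases "0 \<le> c")
  case True
  then show ?thesis using scaleR_sup[of c x "-x"] by (simp add: abs_lattice[of x] abs_lattice[of "c *\<^sub>R x"])
next
  case False
  then show ?thesis using scaleR_sup[of "-c" x "-x"]
    by (simp add: abs_lattice[of x] abs_lattice[of "c *\<^sub>R x"] sup_commute[of "c *\<^sub>R x"])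
qed

lemma norm_abs_lattice [simp]: "norm \<bar>x :: 'e::banach_lattice\<bar> = norm x"
  by (intro antisym norm_abs_mono) simp_all

lemma norm_mono_pos: "0 \<le> (x :: 'e::banach_lattice) \<Longrightarrow> x \<le> y \<Longrightarrow> norm x \<le> norm y"
  by (rule norm_abs_mono) (simp add: order_trans)

text \<open>Closedness of the negative cone in a form without limits: x \<le> d puts the positive
  part of x below \<bar>d\<bar>, so its norm is arbitrarily small.\<close>

lemma le_zero_if_le_small:
  fixes x :: "'e::banach_lattice"
  assumes "\<And>e. 0 < e \<Longrightarrow> \<exists>d. x \<le> d \<and> norm d < e" shows "x \<le> 0"
proof -
  have "norm (sup x 0) \<le> 0"
  proof (rule field_le_epsilon)
    fix e :: real assume "0 < e"
    then obtain d where d: "x \<le> d" "norm d < e" using assms by blast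
    have "sup x 0 \<le> \<bar>d\<bar>" using d(1) by (meson abs_ge_self abs_ge_zero le_supI order_trans)
    then have "norm (sup x 0) \<le> norm d" using norm_mono_pos[of "sup x 0" "\<bar>d\<bar>"] by simp
    then show "norm (sup x 0) \<le> 0 + e" using d(2) by simp
  qed
  then have "sup x 0 = 0" by simp
  then show ?thesis by (metis sup_ge1)
qed

text \<open>The Archimedean property; e u is small in norm for small e, whatever the sign of
  u.\<close>

lemma le_if_le_add_scaleR:
  fixes x y u :: "'e::banach_lattice"
  assumes "\<And>e. 0 < e \<Longrightarrow> x \<le> y + e *\<^sub>R u" shows "x \<le> y"
proof -
  have "x - y \<le> 0"
  proof (rule le_zero_if_le_small)
    fix e :: real assume e: "0 < e"
    define d where "d = e / (norm u + 1)"
    have "0 < norm u + 1" using norm_ge_zero[of u] by linarith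
    then have d: "0 < d" "d * (norm u + 1) = e" using e by (simp_all add: d_def)
    then have "norm (d *\<^sub>R u) < e" by (simp add: algebra_simps)
    moreover have "x - y \<le> d *\<^sub>R u" using assms[OF d(1)] by (simp add: algebra_simps)
    ultimately show "\<exists>d. x - y \<le> d \<and> norm d < e" by blast
  qed
  then show ?thesis by simp
qed

section \<open>Principal ideals and their real lattice homomorphisms\<close>

definition principal_ideal :: "'e::banach_lattice \<Rightarrow> 'e set" where
  "principal_ideal u = {x. \<exists>c. \<bar>x\<bar> \<le> c *\<^sub>R u}"

text \<open>Nothing is prescribed off the ideal or at \<open>u\<close>, so a homomorphism for a
  larger ideal also serves a smaller one. Norm continuity is not part of the notion; limits are
  handled through order bounds.\<close>

definition lattice_homs :: "'e::banach_lattice \<Rightarrow> ('e \<Rightarrow> real) set" where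
  "lattice_homs u = {\<omega>. \<forall>x\<in>principal_ideal u. (\<forall>c. \<omega> (c *\<^sub>R x) = c * \<omega> x) \<and>
     (\<forall>y\<in>principal_ideal u. \<omega> (x + y) = \<omega> x + \<omega> y \<and> \<omega> (sup x y) = max (\<omega> x) (\<omega> y))}"

lemma ideal_solid:
  assumes "y \<in> principal_ideal u" "\<bar>x\<bar> \<le> \<bar>y\<bar>" shows "x \<in> principal_ideal u"
  using assms unfolding principal_ideal_def by (auto intro: order_trans)

lemma ideal_add:
  assumes "x \<in> principal_ideal u" "y \<in> principal_ideal u" shows "x + y \<in> principal_ideal u"
proof -
  obtain c d where "\<bar>x\<bar> \<le> c *\<^sub>R u" "\<bar>y\<bar> \<le> d *\<^sub>R u" using assms unfolding principal_ideal_def by auto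
  then have "\<bar>x + y\<bar> \<le> (c + d) *\<^sub>R u"
    using order_trans[OF abs_triangle_ineq add_mono[of "\<bar>x\<bar>" "c *\<^sub>R u" "\<bar>y\<bar>" "d *\<^sub>R u"]]
    by (simp add: scaleR_left_distrib)
  then show ?thesis unfolding principal_ideal_def by auto
qed

lemma ideal_scale:
  assumes "x \<in> principal_ideal u" shows "c *\<^sub>R x \<in> principal_ideal u"
proof -
  obtain d where "\<bar>x\<bar> \<le> d *\<^sub>R u" using assms unfolding principal_ideal_def by auto
  then have "\<bar>c *\<^sub>R x\<bar> \<le> (\<bar>c\<bar> * d) *\<^sub>R u"
    using scaleR_left_mono[of "\<bar>x\<bar>" "d *\<^sub>R u" "\<bar>c\<bar>"] by (simp add: abs_scaleR_lattice)
  then show ?thesis unfolding principal_ideal_def by auto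
qed

lemma ideal_zero: "0 \<in> principal_ideal u"
  unfolding principal_ideal_def by (auto intro!: exI[of _ 0])

lemma ideal_minus: "x \<in> principal_ideal u \<Longrightarrow> - x \<in> principal_ideal u"
  by (rule ideal_solid[of x]) simp_all

lemma ideal_diff: "x \<in> principal_ideal u \<Longrightarrow> y \<in> principal_ideal u \<Longrightarrow> x - y \<in> principal_ideal u"
  using ideal_add[of x u "- y"] ideal_minus[of y u] by simp

lemma ideal_abs: "x \<in> principal_ideal u \<Longrightarrow> \<bar>x\<bar> \<in> principal_ideal u"
  by (rule ideal_solid[of x]) simp_all

lemma ideal_sup:
  assumes "x \<in> principal_ideal u" "y \<in> principal_ideal u" shows "sup x y \<in> principal_ideal u"
proof (rule ideal_solid[of "\<bar>x\<bar> + \<bar>y\<bar>"])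
  show "\<bar>x\<bar> + \<bar>y\<bar> \<in> principal_ideal u" by (intro ideal_add ideal_abs assms)
  have 1: "x \<le> \<bar>x\<bar> + \<bar>y\<bar>" "y \<le> \<bar>x\<bar> + \<bar>y\<bar>" "- x \<le> \<bar>x\<bar> + \<bar>y\<bar>"
    by (meson abs_ge_self abs_ge_minus_self abs_ge_zero add_increasing add_increasing2)+
  have "- sup x y \<le> - x" by simp
  then have "- sup x y \<le> \<bar>x\<bar> + \<bar>y\<bar>" using 1(3) order_trans by blast
  then have "\<bar>sup x y\<bar> \<le> \<bar>x\<bar> + \<bar>y\<bar>" using 1 by (intro abs_leI le_supI)
  then show "\<bar>sup x y\<bar> \<le> \<bar>\<bar>x\<bar> + \<bar>y\<bar>\<bar>" by simp
qed

lemma ideal_sum: "(\<And>k. k \<in> K \<Longrightarrow> x k \<in> principal_ideal u) \<Longrightarrow> (\<Sum>k\<in>K. x k) \<in> principal_ideal u"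
  by (induction K rule: infinite_finite_induct) (auto intro: ideal_zero ideal_add)

lemma ideal_self: "0 \<le> u \<Longrightarrow> u \<in> principal_ideal u"
  unfolding principal_ideal_def by (auto intro!: exI[of _ 1])

lemma ideal_mono:
  assumes "v \<in> principal_ideal u" "0 \<le> v" shows "principal_ideal v \<subseteq> principal_ideal u"
proof
  fix x assume "x \<in> principal_ideal v"
  then obtain c where "\<bar>x\<bar> \<le> c *\<^sub>R v" unfolding principal_ideal_def by auto
  then have "\<bar>x\<bar> \<le> \<bar>c *\<^sub>R v\<bar>" by (meson abs_ge_self order_trans)
  then show "x \<in> principal_ideal u" by (rule ideal_solid[OF ideal_scale[OF assms(1)]])
qed

lemma lattice_homs_antimono:
  assumes "v \<in> principal_ideal u" "0 \<le> v" shows "lattice_homs u \<subseteq> lattice_homs v"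
  unfolding lattice_homs_def using ideal_mono[OF assms] by (auto simp: subset_iff)

lemma lattice_homsD:
  assumes "\<omega> \<in> lattice_homs u" "x \<in> principal_ideal u"
  shows "\<omega> (c *\<^sub>R x) = c * \<omega> x" "\<omega> (- x) = - \<omega> x"
    and "y \<in> principal_ideal u \<Longrightarrow> \<omega> (x + y) = \<omega> x + \<omega> y"
    and "y \<in> principal_ideal u \<Longrightarrow> \<omega> (x - y) = \<omega> x - \<omega> y"
    and "y \<in> principal_ideal u \<Longrightarrow> \<omega> (sup x y) = max (\<omega> x) (\<omega> y)"
    and "\<omega> \<bar>x\<bar> = \<bar>\<omega> x\<bar>"
    and "y \<in> principal_ideal u \<Longrightarrow> x \<le> y \<Longrightarrow> \<omega> x \<le> \<omega> y"
proof -
  have s: "\<omega> (c *\<^sub>R z) = c * \<omega> z" and a: "z' \<in> principal_ideal u \<Longrightarrow> \<omega> (z + z') = \<omega> z + \<omega> z'"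
    and m: "z' \<in> principal_ideal u \<Longrightarrow> \<omega> (sup z z') = max (\<omega> z) (\<omega> z')"
    if "z \<in> principal_ideal u" for c z z'
    using that assms(1) unfolding lattice_homs_def by blast+
  show "\<omega> (c *\<^sub>R x) = c * \<omega> x" by (rule s[OF assms(2)])
  have n: "\<omega> (- z) = - \<omega> z" if "z \<in> principal_ideal u" for z using s[OF that, of "-1"] by simp
  show "\<omega> (- x) = - \<omega> x" by (rule n[OF assms(2)])
  show "y \<in> principal_ideal u \<Longrightarrow> \<omega> (x + y) = \<omega> x + \<omega> y" by (rule a[OF assms(2)])
  show "y \<in> principal_ideal u \<Longrightarrow> \<omega> (x - y) = \<omega> x - \<omega> y"
    using a[OF assms(2) ideal_minus[of y]] n by simp
  show "y \<in> principal_ideal u \<Longrightarrow> \<omega> (sup x y) = max (\<omega> x) (\<omega> y)" by (rule m[OF assms(2)])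
  show "\<omega> \<bar>x\<bar> = \<bar>\<omega> x\<bar>"
    using m[OF assms(2) ideal_minus[OF assms(2)]] n[OF assms(2)] by (simp add: abs_lattice[of x] abs_real_def max_def)
  show "\<omega> x \<le> \<omega> y" if "y \<in> principal_ideal u" "x \<le> y"
    using m[OF assms(2) that(1)] that(2) by (simp add: sup.absorb2)
qed

definition ideal_vs :: "'e::banach_lattice \<Rightarrow> 'e vs" where
  "ideal_vs u = \<lparr>vcarrier = principal_ideal u, vzero = 0, vadd = (+), vscale = scaleR\<rparr>"

lemma real_vs_ideal: "real_vs (ideal_vs u)"
  by standard (auto simp: ideal_vs_def ideal_zero ideal_add ideal_scale algebra_simps)

text \<open>S x = inf {c \<ge> 0. x \<le> c u} is the order-unit norm of the positive part of x;
  like the maximum of a nonnegative function it turns \<open>sup\<close> into \<open>max\<close>. A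
  linear functional below S that keeps these maxima and equals S at z is the homomorphism
  sought.\<close>

theorem lattice_homs_separate:
  fixes u z :: "'e::banach_lattice"
  assumes u: "0 \<le> u" and z: "z \<in> principal_ideal u" and "\<not> z \<le> 0"
  shows "\<exists>\<omega>\<in>lattice_homs u. 0 < \<omega> z"
proof -
  interpret V: real_vs "ideal_vs u" by (rule real_vs_ideal)
  have V: "vcarrier (ideal_vs u) = principal_ideal u" "vadd (ideal_vs u) = (+)" "vscale (ideal_vs u) = scaleR"
    by (simp_all add: ideal_vs_def)
  define S where "S x = Inf {c. 0 \<le> c \<and> x \<le> c *\<^sub>R u}" for x
  have bdd: "bdd_below {c. 0 \<le> c \<and> x \<le> c *\<^sub>R u}" for x by (rule bdd_belowI[of _ 0]) auto
  have S_le: "S x \<le> c" if "0 \<le> c" "x \<le> c *\<^sub>R u" for x c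
    unfolding S_def by (rule cInf_lower[OF _ bdd]) (use that in simp)
  have S_ge: "M \<le> S x" if "x \<in> principal_ideal u" "\<And>c. 0 \<le> c \<Longrightarrow> x \<le> c *\<^sub>R u \<Longrightarrow> M \<le> c" for M x
    unfolding S_def
  proof (rule cInf_greatest)
    obtain c where "\<bar>x\<bar> \<le> c *\<^sub>R u" using \<open>x \<in> principal_ideal u\<close> unfolding principal_ideal_def by auto
    then have "x \<le> c *\<^sub>R u" using abs_le_D1 by blast
    also have "c *\<^sub>R u \<le> \<bar>c\<bar> *\<^sub>R u" by (rule scaleR_right_mono) (use u in auto)
    finally have "\<bar>c\<bar> \<in> {c. 0 \<le> c \<and> x \<le> c *\<^sub>R u}" by simp
    then show "{c. 0 \<le> c \<and> x \<le> c *\<^sub>R u} \<noteq> {}" by blast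
  qed (use that(2) in auto)
  have S_nonneg: "0 \<le> S x" if "x \<in> principal_ideal u" for x by (rule S_ge[OF that])
  have S_close: "x \<le> (S x + e) *\<^sub>R u" if x: "x \<in> principal_ideal u" and e: "0 < e" for x e
  proof -
    obtain c where c: "0 \<le> c" "x \<le> c *\<^sub>R u" "c < S x + e"
    proof -
      have "\<not> S x + e \<le> S x" using e by simp
      then show thesis using S_ge[OF x, of "S x + e"] that by force
    qed
    have "c *\<^sub>R u \<le> (S x + e) *\<^sub>R u" by (rule scaleR_right_mono) (use c u in auto)
    then show ?thesis using c(2) order_trans by blast
  qed
  have S_mono: "S x \<le> S y" if "x \<in> principal_ideal u" "y \<in> principal_ideal u" "x \<le> y" for x y
    by (rule S_ge[OF that(2)], rule S_le) (use that(3) in \<open>simp_all add: order_trans[OF that(3)]\<close>)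
  let ?R = "{(x, y, sup x y) | x y. x \<in> principal_ideal u \<and> y \<in> principal_ideal u}"
  have R: "V.translation_invariant ?R"
    unfolding V.translation_invariant_def V
  proof (intro conjI)
    show "?R \<subseteq> principal_ideal u \<times> principal_ideal u \<times> principal_ideal u"
      by (clarsimp simp: ideal_sup)
    have "(x + w, y + w, sup x y + w) \<in> ?R"
      if "x \<in> principal_ideal u" "y \<in> principal_ideal u" "w \<in> principal_ideal u" for x y w
      by (intro CollectI exI[of _ "x + w"] exI[of _ "y + w"]) (simp add: that ideal_add add_sup_distrib_right)
    then show "\<forall>(a, b, c)\<in>?R. \<forall>w\<in>principal_ideal u. (a + w, b + w, c + w) \<in> ?R" by blast
  qed
  have sub: "V.sublinear S"
    unfolding V.sublinear_def V
  proof (intro conjI ballI allI impI)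
    fix x y assume xy: "x \<in> principal_ideal u" "y \<in> principal_ideal u"
    show "S (x + y) \<le> S x + S y"
    proof (rule field_le_epsilon)
      fix e :: real assume e: "0 < e"
      have "x + y \<le> (S x + e/2) *\<^sub>R u + (S y + e/2) *\<^sub>R u"
        by (intro add_mono S_close xy) (use e in auto)
      also have "\<dots> = (S x + S y + e) *\<^sub>R u"
        unfolding scaleR_left_distrib[symmetric] by simp
      finally show "S (x + y) \<le> S x + S y + e"
        by (intro S_le) (use S_nonneg xy e in \<open>auto intro!: add_nonneg_nonneg\<close>)
    qed
  next
    fix c :: real and x assume c: "0 \<le> c" and x: "x \<in> principal_ideal u"
    show "S (c *\<^sub>R x) \<le> c * S x"
    proof (cases "c = 0")
      case True then show ?thesis using S_le[of 0 0] by simp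
    next
      case False
      have "S (c *\<^sub>R x) / c \<le> S x"
      proof (rule S_ge[OF x])
        fix d assume d: "0 \<le> d" "x \<le> d *\<^sub>R u"
        have "S (c *\<^sub>R x) \<le> c * d"
          using scaleR_left_mono[OF d(2) c] c d by (intro S_le) auto
        then show "S (c *\<^sub>R x) / c \<le> d" using False c by (simp add: field_simps)
      qed
      then show ?thesis using False c by (simp add: field_simps)
    qed
  qed
  have mx: "max_on ?R S"
    unfolding max_on_def
  proof clarify
    fix x y assume xy: "x \<in> principal_ideal u" "y \<in> principal_ideal u"
    show "S (sup x y) = max (S x) (S y)"
    proof (rule antisym)
      show "S (sup x y) \<le> max (S x) (S y)"
      proof (rule field_le_epsilon)
        fix e :: real assume e: "0 < e"
        have *: "(S w + e) *\<^sub>R u \<le> (max (S x) (S y) + e) *\<^sub>R u" if "w = x \<or> w = y" for w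
          by (rule scaleR_right_mono) (use that u in auto)
        have "sup x y \<le> (max (S x) (S y) + e) *\<^sub>R u"
          using order_trans[OF S_close[OF xy(1) e] *] order_trans[OF S_close[OF xy(2) e] *] by simp
        then show "S (sup x y) \<le> max (S x) (S y) + e"
          by (intro S_le) (use S_nonneg[OF xy(1)] e in auto)
      qed
      show "max (S x) (S y) \<le> S (sup x y)"
        by (intro max.boundedI S_mono xy ideal_sup sup_ge1 sup_ge2)
    qed
  qed
  obtain \<omega> where \<omega>: "vlinear (ideal_vs u) type_vs \<omega>" "max_on ?R \<omega>" "\<omega> z = S z"
    by (rule V.ex_linear_le_sublinear[OF R sub mx, of z]) (use z V in auto)
  have "\<omega> (sup x y) = max (\<omega> x) (\<omega> y)" if "x \<in> principal_ideal u" "y \<in> principal_ideal u" for x y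
    using \<omega>(2) that unfolding max_on_def by blast
  then have "\<omega> \<in> lattice_homs u"
    using \<omega>(1) unfolding lattice_homs_def vlinear_def V type_vs_def by simp
  \<comment> \<open>Otherwise z would lie below every e u, hence below 0 by the Archimedean
    property.\<close>
  moreover have "S z \<noteq> 0"
  proof
    assume "S z = 0"
    then have "z \<le> 0 + e *\<^sub>R u" if "0 < e" for e using S_close[OF z that] by simp
    then have "z \<le> 0" by (rule le_if_le_add_scaleR)
    then show False using assms by simp
  qed
  ultimately show ?thesis using \<omega>(3) S_nonneg[OF z] by (intro bexI[of _ \<omega>]) auto
qed

lemma le_by_lattice_homs:
  fixes u :: "'e::banach_lattice"
  assumes "0 \<le> u" "x \<in> principal_ideal u" "y \<in> principal_ideal u"
    and "\<And>\<omega>. \<omega> \<in> lattice_homs u \<Longrightarrow> \<omega> x \<le> \<omega> y"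
  shows "x \<le> y"
proof (rule ccontr)
  assume "\<not> x \<le> y"
  then have "\<not> x - y \<le> 0" by simp
  then obtain \<omega> where "\<omega> \<in> lattice_homs u" "0 < \<omega> (x - y)"
    using lattice_homs_separate[OF assms(1) ideal_diff[OF assms(2,3)]] by blast
  then show False using assms(4)[of \<omega>] lattice_homsD(4)[of \<omega> u x y] assms(2,3) by simp
qed

lemma eq_by_lattice_homs:
  fixes u :: "'e::banach_lattice"
  assumes "0 \<le> u" "x \<in> principal_ideal u" "y \<in> principal_ideal u"
    and "\<And>\<omega>. \<omega> \<in> lattice_homs u \<Longrightarrow> \<omega> x = \<omega> y"
  shows "x = y"
  by (rule antisym; rule le_by_lattice_homs[of u]) (simp_all add: assms)

section \<open>Density of lattice-linear functions\<close>

text \<open>This norm is itself a lattice-linear expression in the coordinates. Error bounds stated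
  with it have a counterpart in E, where it becomes the sum of the \<bar>x k\<bar>.\<close>

abbreviation l1_norm :: "nat \<Rightarrow> (nat \<Rightarrow> real) \<Rightarrow> real" where
  "l1_norm n t \<equiv> (\<Sum>k<n. \<bar>t k\<bar>)"

lemma pos_homogeneousD:
  assumes "f \<in> pos_homogeneous n"
  shows "continuous_on UNIV f" "0 \<le> c \<Longrightarrow> f (\<lambda>k. c * t k) = c * f t"
    "(\<And>k. k < n \<Longrightarrow> s k = t k) \<Longrightarrow> f s = f t" "f (\<lambda>k. 0) = 0"
proof -
  show h: "0 \<le> c \<Longrightarrow> f (\<lambda>k. c * t k) = c * f t" for c t using assms unfolding pos_homogeneous_def by blast
  show "f (\<lambda>k. 0) = 0" using h[of 0] by simp
qed (use assms in \<open>unfold pos_homogeneous_def, blast+\<close>)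

lemma pos_homogeneousI:
  assumes "continuous_on UNIV f" "\<And>c t. 0 \<le> c \<Longrightarrow> f (\<lambda>k. c * t k) = c * f t"
    "\<And>s t. (\<And>k. k < n \<Longrightarrow> s k = t k) \<Longrightarrow> f s = f t"
  shows "f \<in> pos_homogeneous n"
  unfolding pos_homogeneous_def using assms by blast

lemma pos_homogeneous_proj: "k < n \<Longrightarrow> (\<lambda>t. t k) \<in> pos_homogeneous n"
  by (rule pos_homogeneousI) (auto intro: continuous_on_product_coordinates)

lemma pos_homogeneous_zero: "(\<lambda>t. 0) \<in> pos_homogeneous n"
  by (rule pos_homogeneousI) auto

lemma pos_homogeneous_add:
  assumes "f \<in> pos_homogeneous n" "g \<in> pos_homogeneous n"
  shows "(\<lambda>t. f t + g t) \<in> pos_homogeneous n"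
proof (rule pos_homogeneousI)
  show "f s + g s = f t + g t" if "\<And>k. k < n \<Longrightarrow> s k = t k" for s t
    using pos_homogeneousD(3)[OF assms(1) that] pos_homogeneousD(3)[OF assms(2) that] by simp
qed (auto simp: pos_homogeneousD(2)[OF assms(1)] pos_homogeneousD(2)[OF assms(2)] algebra_simps
    intro!: continuous_intros pos_homogeneousD(1)[OF assms(1)] pos_homogeneousD(1)[OF assms(2)])

lemma pos_homogeneous_scale:
  assumes "f \<in> pos_homogeneous n"
  shows "(\<lambda>t. c * f t) \<in> pos_homogeneous n"
proof (rule pos_homogeneousI)
  show "c * f s = c * f t" if "\<And>k. k < n \<Longrightarrow> s k = t k" for s t
    using pos_homogeneousD(3)[OF assms that] by simp
qed (auto simp: pos_homogeneousD(2)[OF assms] algebra_simps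
    intro!: continuous_intros pos_homogeneousD(1)[OF assms])

lemma pos_homogeneous_max:
  assumes "f \<in> pos_homogeneous n" "g \<in> pos_homogeneous n"
  shows "(\<lambda>t. max (f t) (g t)) \<in> pos_homogeneous n"
proof (rule pos_homogeneousI)
  show "max (f s) (g s) = max (f t) (g t)" if "\<And>k. k < n \<Longrightarrow> s k = t k" for s t
    using pos_homogeneousD(3)[OF assms(1) that] pos_homogeneousD(3)[OF assms(2) that] by simp
qed (auto simp: pos_homogeneousD(2)[OF assms(1)] pos_homogeneousD(2)[OF assms(2)] max_mult_distrib_left
    intro!: continuous_intros pos_homogeneousD(1)[OF assms(1)] pos_homogeneousD(1)[OF assms(2)])

text \<open>The closure rules mirror the clauses of \<open>krivine_hom\<close>: on these functions a
  homomorphism is determined by its values at the coordinates, and in E they can be evaluated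
  directly.\<close>

inductive_set lattice_linear :: "nat \<Rightarrow> ((nat \<Rightarrow> real) \<Rightarrow> real) set" for n where
  zero: "(\<lambda>t. 0) \<in> lattice_linear n"
| proj: "k < n \<Longrightarrow> (\<lambda>t. t k) \<in> lattice_linear n"
| add: "f \<in> lattice_linear n \<Longrightarrow> g \<in> lattice_linear n \<Longrightarrow> (\<lambda>t. f t + g t) \<in> lattice_linear n"
| scale: "f \<in> lattice_linear n \<Longrightarrow> (\<lambda>t. c * f t) \<in> lattice_linear n"
| max: "f \<in> lattice_linear n \<Longrightarrow> g \<in> lattice_linear n \<Longrightarrow> (\<lambda>t. max (f t) (g t)) \<in> lattice_linear n"

lemma lattice_linear_pos_homogeneous: "f \<in> lattice_linear n \<Longrightarrow> f \<in> pos_homogeneous n"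
  by (induction rule: lattice_linear.induct)
    (auto intro: pos_homogeneous_zero pos_homogeneous_proj pos_homogeneous_add
      pos_homogeneous_scale pos_homogeneous_max)

lemma lattice_linear_abs:
  assumes "f \<in> lattice_linear n" shows "(\<lambda>t. \<bar>f t\<bar>) \<in> lattice_linear n"
proof -
  have "(\<lambda>t. \<bar>f t\<bar>) = (\<lambda>t. max (f t) (-1 * f t))" by (auto simp: fun_eq_iff)
  then show ?thesis using lattice_linear.max[OF assms lattice_linear.scale[OF assms, of "-1"]] by simp
qed

lemma lattice_linear_sum:
  "(\<And>k. k \<in> K \<Longrightarrow> f k \<in> lattice_linear n) \<Longrightarrow> (\<lambda>t. \<Sum>k\<in>K. f k t) \<in> lattice_linear n"
  by (induction K rule: infinite_finite_induct) (auto intro: lattice_linear.zero lattice_linear.add)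

lemma lattice_linear_l1_norm: "l1_norm n \<in> lattice_linear n"
  by (intro lattice_linear_sum lattice_linear_abs lattice_linear.proj) simp

lemma lattice_linear_Max:
  assumes "finite F" "F \<noteq> {}" "\<And>s. s \<in> F \<Longrightarrow> g s \<in> lattice_linear n"
  shows "(\<lambda>t. Max ((\<lambda>s. g s t) ` F)) \<in> lattice_linear n"
  using assms
proof (induction F rule: finite_ne_induct)
  case (insert s F)
  then have "(\<lambda>t. max (g s t) (Max ((\<lambda>s. g s t) ` F))) \<in> lattice_linear n"
    by (intro lattice_linear.max) auto
  then show ?case using insert by simp
qed simp

section \<open>Uniform approximation on the l1 sphere\<close>

definition l1_sphere :: "nat \<Rightarrow> (nat \<Rightarrow> real) set" where
  "l1_sphere n = {t. l1_norm n t = 1 \<and> (\<forall>k\<ge>n. t k = 0)}"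

lemma continuous_l1_dist: "continuous_on UNIV (\<lambda>t. l1_norm n (\<lambda>k. t k - s k))"
  by (intro continuous_intros continuous_on_product_coordinates)

text \<open>Fixing the coordinates from n on at 0 makes this copy of the sphere of \<real>^n a
  closed subset of a product of intervals, which is compact by Tychonoff.\<close>

lemma compact_l1_sphere: "compact (l1_sphere n)"
proof -
  let ?B = "PiE UNIV (\<lambda>_::nat. {-1..1::real})"
  have "compactin (product_topology (\<lambda>_. euclidean) UNIV) ?B"
    by (subst compactin_PiE) (simp add: compactin_euclidean_iff)
  then have B: "compact ?B" by (simp add: euclidean_product_topology compactin_euclidean_iff)
  have "l1_sphere n = {t. l1_norm n t = 1} \<inter> (\<Inter>k\<in>{n..}. {t. t k = 0})"
    by (auto simp: l1_sphere_def)
  also have "closed \<dots>"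
  proof (intro closed_Int closed_INT ballI)
    show "closed {t. l1_norm n t = 1}"
      by (rule closed_Collect_eq) (intro continuous_intros continuous_on_product_coordinates)+
    show "closed {t::nat \<Rightarrow> real. t k = 0}" for k
      by (rule closed_Collect_eq) (intro continuous_intros continuous_on_product_coordinates)+
  qed
  finally have "closed (l1_sphere n)" .
  moreover have "l1_sphere n \<subseteq> ?B"
  proof
    fix t assume t: "t \<in> l1_sphere n"
    have "\<bar>t k\<bar> \<le> 1" for k
    proof (cases "k < n")
      case True
      then have "\<bar>t k\<bar> \<le> l1_norm n t" by (intro member_le_sum) auto
      then show ?thesis using t by (simp add: l1_sphere_def)
    next
      case False then show ?thesis using t by (simp add: l1_sphere_def)
    qed
    then have "t k \<in> {-1..1}" for k using abs_le_D1 abs_le_D2 by (metis atLeastAtMost_iff minus_le_iff)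
    then show "t \<in> ?B" by (intro PiE_I) auto
  qed
  ultimately show ?thesis using compact_Int_closed[OF B, of "l1_sphere n"] by (simp add: Int_absorb1)
qed

text \<open>The function g is a downward cone with apex over s, steep enough to stay below f + e,
  and made homogeneous by multiplying constants by \<open>l1_norm n t\<close>.\<close>

lemma lattice_linear_touching:
  assumes f: "f \<in> pos_homogeneous n" and e: "0 < e" and s: "s \<in> l1_sphere n"
  shows "\<exists>g\<in>lattice_linear n. g s = f s \<and> (\<forall>t\<in>l1_sphere n. g t \<le> f t + e)"
proof -
  have cf: "continuous_on A f" for A using pos_homogeneousD(1)[OF f] continuous_on_subset by blast
  have cd: "continuous_on A (\<lambda>t. l1_norm n (\<lambda>k. t k - s k))" for A
    using continuous_l1_dist continuous_on_subset by blast
  \<comment> \<open>Off K the constant f(s) already lies below f + e; on K the cone must have come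
    down.\<close>
  define K where "K = l1_sphere n \<inter> {t. f t \<le> f s - e}"
  have K: "compact K"
    unfolding K_def by (intro compact_Int_closed compact_l1_sphere closed_Collect_le continuous_intros cf)
  obtain m where m: "0 < m" "\<And>t. t \<in> K \<Longrightarrow> m \<le> l1_norm n (\<lambda>k. t k - s k)"
  proof (cases "K = {}")
    case True then show thesis using that[of 1] by simp
  next
    case False
    obtain t where t: "t \<in> K" "\<And>t'. t' \<in> K \<Longrightarrow> l1_norm n (\<lambda>k. t k - s k) \<le> l1_norm n (\<lambda>k. t' k - s k)"
      using continuous_attains_inf[OF K False cd] by blast
    have "l1_norm n (\<lambda>k. t k - s k) \<noteq> 0"
    proof
      assume "l1_norm n (\<lambda>k. t k - s k) = 0"
      then have "t k = s k" if "k < n" for k using that by (simp add: sum_nonneg_eq_0_iff)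
      then have "f t = f s" by (rule pos_homogeneousD(3)[OF f])
      then show False using t(1) e by (simp add: K_def)
    qed
    then have "0 < l1_norm n (\<lambda>k. t k - s k)" by (simp add: sum_nonneg less_le)
    then show thesis using that t(2) by blast
  qed
  have "compact (f ` l1_sphere n)" by (rule compact_continuous_image[OF cf compact_l1_sphere])
  then obtain M where M: "0 < M" "\<And>y. y \<in> f ` l1_sphere n \<Longrightarrow> norm y \<le> M"
    using compact_imp_bounded bounded_pos by metis
  \<comment> \<open>2 M bounds the oscillation of f on the sphere and m the distance from s to K, so
    with slope 2 M / m the cone has fallen by at least f(s) - f(t) at each t in K.\<close>
  define g where "g t = f s * l1_norm n t + (- (2 * M / m)) * l1_norm n (\<lambda>k. t k + (- s k) * l1_norm n t)" for t
  have gs: "g t = f s - 2 * M / m * l1_norm n (\<lambda>k. t k - s k)" if "t \<in> l1_sphere n" for t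
    using that by (simp add: g_def l1_sphere_def)
  have "g t \<le> f t + e" if t: "t \<in> l1_sphere n" for t
  proof (cases "t \<in> K")
    case True
    have "2 * M \<le> 2 * M / m * l1_norm n (\<lambda>k. t k - s k)"
      using m(2)[OF True] m(1) M(1) by (simp add: field_simps)
    then show ?thesis using gs[OF t] M(2)[of "f s"] M(2)[of "f t"] s t e by (auto simp: abs_le_iff)
  next
    case False
    then have "f s \<le> f t + e" using t by (simp add: K_def)
    moreover have "0 \<le> 2 * M / m * l1_norm n (\<lambda>k. t k - s k)" using m M by (simp add: sum_nonneg)
    ultimately show ?thesis using gs[OF t] by simp
  qed
  moreover have "g s = f s" using gs[OF s] by simp
  moreover have "(\<lambda>t. l1_norm n (\<lambda>k. t k + (- s k) * l1_norm n t)) \<in> lattice_linear n"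
    by (intro lattice_linear_sum lattice_linear_abs lattice_linear.add lattice_linear.scale
        lattice_linear.proj lattice_linear_l1_norm) simp
  then have "g \<in> lattice_linear n"
    unfolding g_def by (intro lattice_linear.add lattice_linear.scale lattice_linear_l1_norm)
  ultimately show ?thesis by blast
qed

lemma pos_homogeneous_bound_sphere:
  assumes f: "f \<in> pos_homogeneous n" and g: "g \<in> pos_homogeneous n"
    and le: "\<And>t. t \<in> l1_sphere n \<Longrightarrow> \<bar>f t - g t\<bar> \<le> e"
  shows "\<bar>f t - g t\<bar> \<le> e * l1_norm n t"
proof (cases "l1_norm n t = 0")
  case True
  then have "t k = 0" if "k < n" for k using that by (simp add: sum_nonneg_eq_0_iff)
  then have "f t = f (\<lambda>k. 0)" "g t = g (\<lambda>k. 0)"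
    by (auto intro: pos_homogeneousD(3)[OF f] pos_homogeneousD(3)[OF g])
  then show ?thesis using True pos_homogeneousD(4)[OF f] pos_homogeneousD(4)[OF g] by simp
next
  case False
  define c where "c = l1_norm n t"
  have c: "0 < c" using False by (simp add: c_def less_le sum_nonneg)
  define s where "s k = (if k < n then t k / c else 0)" for k
  have "l1_norm n s = c / c" unfolding c_def[symmetric] s_def
    using c by (simp add: sum_divide_distrib[symmetric] c_def[symmetric])
  then have s: "s \<in> l1_sphere n" using c by (simp add: l1_sphere_def s_def)
  have hom: "h t = c * h s" if h: "h \<in> pos_homogeneous n" for h
  proof -
    have "h t = h (\<lambda>k. c * s k)" by (rule pos_homogeneousD(3)[OF h]) (use c in \<open>simp add: s_def\<close>)
    then show ?thesis using pos_homogeneousD(2)[OF h, of c s] c by simp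
  qed
  have "\<bar>f t - g t\<bar> = c * \<bar>f s - g s\<bar>"
    using c unfolding hom[OF f] hom[OF g] right_diff_distrib[symmetric] by (simp add: abs_mult)
  then show ?thesis using mult_left_mono[OF le[OF s], of c] c by (simp add: c_def mult.commute)
qed

text \<open>Stone's lattice argument: near s the touching function exceeds f - e, finitely many such
  neighbourhoods cover the sphere, and the maximum of their functions is within e of f. Homogeneity
  spreads the estimate off the sphere.\<close>

theorem lattice_linear_dense:
  assumes f: "f \<in> pos_homogeneous n" and e: "0 < e"
  shows "\<exists>g\<in>lattice_linear n. \<forall>t. \<bar>f t - g t\<bar> \<le> e * l1_norm n t"
proof (cases "l1_sphere n = {}")
  \<comment> \<open>The sphere is empty exactly for n = 0, and then f vanishes identically.\<close>
  case True
  then show ?thesis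
    using pos_homogeneous_bound_sphere[OF f pos_homogeneous_zero, of e] by (intro bexI[of _ "\<lambda>t. 0"]) (auto intro: lattice_linear.zero)
next
  case False
  have "\<forall>s\<in>l1_sphere n. \<exists>g. g \<in> lattice_linear n \<and> g s = f s \<and> (\<forall>t\<in>l1_sphere n. g t \<le> f t + e)"
    using lattice_linear_touching[OF f e] by blast
  from bchoice[OF this] obtain g where g: "\<And>s. s \<in> l1_sphere n \<Longrightarrow> g s \<in> lattice_linear n"
    "\<And>s. s \<in> l1_sphere n \<Longrightarrow> g s s = f s"
    "\<And>s t. s \<in> l1_sphere n \<Longrightarrow> t \<in> l1_sphere n \<Longrightarrow> g s t \<le> f t + e"
    by blast
  define U where "U s = {t. f t - e < g s t}" for s
  have "open (U s)" if "s \<in> l1_sphere n" for s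
    unfolding U_def using pos_homogeneousD(1)[OF f]
      pos_homogeneousD(1)[OF lattice_linear_pos_homogeneous[OF g(1)[OF that]]]
    by (intro open_Collect_less continuous_intros)
  moreover have "l1_sphere n \<subseteq> (\<Union>s\<in>l1_sphere n. U s)" using g(2) e by (force simp: U_def)
  ultimately obtain F where F: "F \<subseteq> l1_sphere n" "finite F" "l1_sphere n \<subseteq> (\<Union>s\<in>F. U s)"
    using compactE_image[OF compact_l1_sphere, of "l1_sphere n" U] by metis
  then have ne: "F \<noteq> {}" using False by auto
  define h where "h t = Max ((\<lambda>s. g s t) ` F)" for t
  have h: "h \<in> lattice_linear n"
    unfolding h_def by (rule lattice_linear_Max[OF F(2) ne]) (use g(1) F(1) in blast)
  have "\<bar>f t - h t\<bar> \<le> e" if t: "t \<in> l1_sphere n" for t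
  proof -
    have "h t \<le> f t + e" unfolding h_def using F(1,2) ne g(3) t by (subst Max_le_iff) auto
    moreover obtain s where "s \<in> F" "f t - e < g s t" using F(3) t by (auto simp: U_def)
    then have "f t - e < h t" unfolding h_def using F(2) ne by (subst Max_gr_iff) auto
    ultimately show ?thesis by simp
  qed
  then show ?thesis
    using pos_homogeneous_bound_sphere[OF f lattice_linear_pos_homogeneous[OF h]] h by blast
qed

section \<open>Krivine's functional calculus\<close>

text \<open>The lattice homomorphisms separate the points of the ideal, so this determines \<open>z\<close>, which turns out
  to be the value \<open>f(x\<^sub>0, \<dots>, x\<^bsub>n-1\<^esub>)\<close> of Krivine's calculus.\<close>

definition represents ::
    "'e::banach_lattice \<Rightarrow> (nat \<Rightarrow> 'e) \<Rightarrow> ((nat \<Rightarrow> real) \<Rightarrow> real) \<Rightarrow> 'e \<Rightarrow> bool" where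
  "represents u x f z \<longleftrightarrow> z \<in> principal_ideal u \<and> (\<forall>\<omega>\<in>lattice_homs u. \<omega> z = f (\<lambda>k. \<omega> (x k)))"

lemma representsD:
  assumes "represents u x f z"
  shows "z \<in> principal_ideal u" "\<omega> \<in> lattice_homs u \<Longrightarrow> \<omega> z = f (\<lambda>k. \<omega> (x k))"
  using assms unfolding represents_def by blast+

lemma represents_unique:
  assumes "0 \<le> u" "represents u x f z" "represents u x f z'" shows "z = z'"
  by (rule eq_by_lattice_homs[OF assms(1)]) (simp_all add: representsD[OF assms(2)] representsD[OF assms(3)])

lemma represents_add:
  "represents u x f y \<Longrightarrow> represents u x g z \<Longrightarrow> represents u x (\<lambda>t. f t + g t) (y + z)"
  unfolding represents_def by (simp add: ideal_add lattice_homsD(3))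

lemma represents_scale: "represents u x f y \<Longrightarrow> represents u x (\<lambda>t. c * f t) (c *\<^sub>R y)"
  unfolding represents_def by (simp add: ideal_scale lattice_homsD(1))

lemma represents_sup:
  "represents u x f y \<Longrightarrow> represents u x g z \<Longrightarrow> represents u x (\<lambda>t. max (f t) (g t)) (sup y z)"
  unfolding represents_def by (simp add: ideal_sup lattice_homsD(5))

lemma represents_mono:
  assumes "0 \<le> u" "represents u x f y" "represents u x g z" "\<And>t. f t \<le> g t"
  shows "y \<le> z"
  by (rule le_by_lattice_homs[OF assms(1)])
    (simp_all add: representsD[OF assms(2)] representsD[OF assms(3)] assms(4))

lemma ex_represents_lattice_linear:
  assumes "g \<in> lattice_linear n" and x: "\<And>k. k < n \<Longrightarrow> x k \<in> principal_ideal u"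
  shows "\<exists>z. represents u x g z"
  using assms(1)
proof (induction rule: lattice_linear.induct)
  case zero
  have "represents u x (\<lambda>t. 0) 0"
    using lattice_homsD(1)[OF _ ideal_zero, of _ u 0] by (simp add: represents_def ideal_zero)
  then show ?case by blast
next
  case (proj k)
  then show ?case using x by (intro exI[of _ "x k"]) (simp add: represents_def)
qed (blast intro: represents_add represents_scale represents_sup)+

text \<open>Approximants of \<open>f\<close> that are close relative to \<open>u\<close> are close in norm, so completeness applies.\<close>

lemma ex_represents:
  fixes x :: "nat \<Rightarrow> 'e::banach_lattice"
  assumes f: "f \<in> pos_homogeneous n" and u: "0 \<le> u" and x: "\<And>k. k < n \<Longrightarrow> x k \<in> principal_ideal u"
  shows "\<exists>z. represents u x f z"
proof -
  \<comment> \<open>The element of E belonging to the l1 norm; all errors below are measured as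
    multiples of w.\<close>
  obtain w where w: "represents u x (l1_norm n) w"
    using ex_represents_lattice_linear[OF lattice_linear_l1_norm, of n x u] x by blast
  have "\<forall>m::nat. \<exists>g. g \<in> lattice_linear n \<and> (\<forall>t. \<bar>f t - g t\<bar> \<le> (1/2)^m * l1_norm n t)"
    using lattice_linear_dense[OF f] by (meson zero_less_power half_gt_zero zero_less_one)
  from choice[OF this] obtain g where g: "\<And>m. g m \<in> lattice_linear n"
    "\<And>m t. \<bar>f t - g m t\<bar> \<le> (1/2)^m * l1_norm n t" by blast
  have "\<forall>m. \<exists>z. represents u x (g m) z"
    using ex_represents_lattice_linear[OF g(1), of x u] x by blast
  from choice[OF this] obtain z where z: "\<And>m. represents u x (g m) (z m)" by blast
  note zg = g z
  \<comment> \<open>The 2 arises because the errors of both g m and g k are at most (1/2)^m times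
    the l1 norm.\<close>
  have zm: "\<bar>z m - z k\<bar> \<le> (2 * (1/2)^m) *\<^sub>R w" if "m \<le> k" for m k
  proof -
    have *: "\<bar>g m t - g k t\<bar> \<le> (2 * (1/2)^m) * l1_norm n t" for t
    proof -
      have "(1/2)^k * l1_norm n t \<le> (1/2)^m * l1_norm n t"
        by (intro mult_right_mono power_decreasing sum_nonneg) (use that in auto)
      then show ?thesis using zg(2)[of t m] zg(2)[of t k] by linarith
    qed
    have r: "represents u x (\<lambda>t. g m t + (-1) * g k t) (z m + (-1) *\<^sub>R z k)"
      by (intro represents_add represents_scale zg)
    have r': "represents u x (\<lambda>t. (-1) * (g m t + (-1) * g k t)) ((-1) *\<^sub>R (z m + (-1) *\<^sub>R z k))"
      by (rule represents_scale[OF r])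
    have rw: "represents u x (\<lambda>t. (2 * (1/2)^m) * l1_norm n t) ((2 * (1/2)^m) *\<^sub>R w)"
      by (rule represents_scale[OF w])
    show ?thesis
    proof (rule abs_leI)
      show "z m - z k \<le> (2 * (1/2)^m) *\<^sub>R w"
        using represents_mono[OF u r rw] * by (force simp: abs_le_iff)
      show "- (z m - z k) \<le> (2 * (1/2)^m) *\<^sub>R w"
        using represents_mono[OF u r' rw] * by (force simp: abs_le_iff)
    qed
  qed
  have nz: "norm (z m - z k) \<le> 2 * (1/2)^m * norm w" if "m \<le> k" for m k
  proof -
    have "norm (z m - z k) \<le> norm ((2 * (1/2)^m) *\<^sub>R w)"
      using norm_mono_pos[OF abs_ge_zero zm[OF that]] by simp
    then show ?thesis by simp
  qed
  have "Cauchy z"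
  proof (rule CauchyI)
    fix e :: real assume e: "0 < e"
    have "(\<lambda>m. 2 * (1/2)^m * norm w) \<longlonglongrightarrow> 2 * 0 * norm w"
      by (intro tendsto_intros LIMSEQ_power_zero) auto
    then have "\<forall>\<^sub>F m in sequentially. 2 * (1/2)^m * norm w < e / 2"
      by (rule order_tendstoD) (use e in auto)
    then obtain M where M: "2 * (1/2)^M * norm w < e / 2" by (auto simp: eventually_sequentially)
    have "norm (z m - z k) < e" if "M \<le> m" "M \<le> k" for m k
    proof -
      have "norm (z m - z k) \<le> norm (z M - z m) + norm (z M - z k)"
        using norm_triangle_ineq4[of "z M - z k" "z M - z m"] by simp
      then show ?thesis using nz[OF that(1)] nz[OF that(2)] M by linarith
    qed
    then show "\<exists>M. \<forall>m\<ge>M. \<forall>k\<ge>M. norm (z m - z k) < e" by blast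
  qed
  then obtain y where y: "z \<longlonglongrightarrow> y" using Cauchy_convergent_iff convergent_def by blast
  \<comment> \<open>The order bound passes to the norm limit, with s = 1 and s = -1 covering both
    signs: the excess s (z k - y) is small in norm.\<close>
  have le: "s *\<^sub>R (z m - y) \<le> (2 * (1/2)^m) *\<^sub>R w" if s: "\<bar>s\<bar> = 1" for m s
  proof -
    have "s *\<^sub>R (z m - y) - (2 * (1/2)^m) *\<^sub>R w \<le> 0"
    proof (rule le_zero_if_le_small)
      fix e :: real assume "0 < e"
      then obtain M where M: "\<And>k. M \<le> k \<Longrightarrow> norm (z k - y) < e" using LIMSEQ_D[OF y] by blast
      define k where "k = max m M"
      have "s *\<^sub>R (z m - z k) \<le> \<bar>s *\<^sub>R (z m - z k)\<bar>" by (rule abs_ge_self)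
      also have "\<dots> = \<bar>z m - z k\<bar>" by (simp add: abs_scaleR_lattice s)
      also have "\<dots> \<le> (2 * (1/2)^m) *\<^sub>R w" by (rule zm) (simp add: k_def)
      finally have "s *\<^sub>R (z m - y) - (2 * (1/2)^m) *\<^sub>R w \<le> s *\<^sub>R (z k - y)"
        by (simp add: algebra_simps)
      moreover have "norm (s *\<^sub>R (z k - y)) < e" using M[of k] s by (simp add: k_def)
      ultimately show "\<exists>d. s *\<^sub>R (z m - y) - (2 * (1/2)^m) *\<^sub>R w \<le> d \<and> norm d < e" by blast
    qed
    then show ?thesis by simp
  qed
  have abs_le: "\<bar>z m - y\<bar> \<le> (2 * (1/2)^m) *\<^sub>R w" for m
    using le[of 1 m] le[of "-1" m] by (intro abs_leI) simp_all
  have wI: "w \<in> principal_ideal u" and zI: "z m \<in> principal_ideal u" for m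
    using representsD(1)[OF w] representsD(1)[OF zg(3)] by simp_all
  have dI: "z m - y \<in> principal_ideal u" for m
    by (rule ideal_solid[OF ideal_scale[OF wI]], rule order_trans[OF abs_le abs_ge_self])
  have yI: "y \<in> principal_ideal u" using ideal_diff[OF zI dI, of 0 0] by simp
  have "\<omega> y = f (\<lambda>k. \<omega> (x k))" if \<omega>: "\<omega> \<in> lattice_homs u" for \<omega>
  proof -
    let ?t = "\<lambda>k. \<omega> (x k)"
    \<comment> \<open>Since \<omega> need not be norm continuous, the convergence of z m to y
      reaches it through the order bound by a multiple of w. The 3 is 2 from z m - y plus 1 from f -
      g m.\<close>
    have "\<bar>\<omega> y - f ?t\<bar> \<le> 3 * (1/2)^m * l1_norm n ?t" for m :: nat
    proof -
      have "\<bar>\<omega> (z m) - \<omega> y\<bar> = \<omega> \<bar>z m - y\<bar>"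
        using lattice_homsD(6)[OF \<omega> dI] lattice_homsD(4)[OF \<omega> zI yI] by simp
      also have "\<dots> \<le> \<omega> ((2 * (1/2)^m) *\<^sub>R w)"
        by (rule lattice_homsD(7)[OF \<omega> ideal_abs[OF dI] ideal_scale[OF wI] abs_le])
      also have "\<dots> = 2 * (1/2)^m * l1_norm n ?t"
        using lattice_homsD(1)[OF \<omega> wI] representsD(2)[OF w \<omega>] by simp
      finally show ?thesis using zg(2)[of ?t m] representsD(2)[OF zg(3)[of m] \<omega>] by simp
    qed
    moreover have "(\<lambda>m. 3 * (1/2)^m * l1_norm n ?t) \<longlonglongrightarrow> 3 * 0 * l1_norm n ?t"
      by (intro tendsto_mult tendsto_const LIMSEQ_power_zero) auto
    ultimately have "\<bar>\<omega> y - f ?t\<bar> \<le> 3 * 0 * l1_norm n ?t" by (intro LIMSEQ_le_const) auto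
    then show ?thesis by simp
  qed
  then show ?thesis using yI by (auto simp: represents_def)
qed

lemma ideal_l1:
  fixes x :: "nat \<Rightarrow> 'e::banach_lattice"
  shows "0 \<le> (\<Sum>k<n. \<bar>x k\<bar>)" "k < n \<Longrightarrow> x k \<in> principal_ideal (\<Sum>k<n. \<bar>x k\<bar>)"
proof -
  show nn: "0 \<le> (\<Sum>k<n. \<bar>x k\<bar>)" by (simp add: sum_nonneg)
  assume "k < n"
  then have "\<bar>x k\<bar> \<le> (\<Sum>k<n. \<bar>x k\<bar>)"
    by (subst sum.remove[of _ k]) (auto simp: sum_nonneg)
  then show "x k \<in> principal_ideal (\<Sum>k<n. \<bar>x k\<bar>)" by (intro ideal_solid[OF ideal_self[OF nn]]) (simp add: nn)
qed

section \<open>Uniqueness and existence of Krivine homomorphisms\<close>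

lemma krivine_homD:
  assumes "krivine_hom n x \<tau>"
  shows "k < n \<Longrightarrow> \<tau> (\<lambda>t. t k) = x k"
    and "f \<in> pos_homogeneous n \<Longrightarrow> g \<in> pos_homogeneous n \<Longrightarrow> \<tau> (\<lambda>t. f t + g t) = \<tau> f + \<tau> g"
    and "f \<in> pos_homogeneous n \<Longrightarrow> \<tau> (\<lambda>t. c * f t) = c *\<^sub>R \<tau> f"
    and "f \<in> pos_homogeneous n \<Longrightarrow> g \<in> pos_homogeneous n \<Longrightarrow> \<tau> (\<lambda>t. max (f t) (g t)) = sup (\<tau> f) (\<tau> g)"
  using assms unfolding krivine_hom_def by blast+

lemma krivine_hom_mono:
  assumes "krivine_hom n x \<tau>" "f \<in> pos_homogeneous n" "g \<in> pos_homogeneous n" "\<And>t. f t \<le> g t"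
  shows "\<tau> f \<le> \<tau> g"
proof -
  have "(\<lambda>t. max (f t) (g t)) = g" using assms(4) by (simp add: fun_eq_iff max_def)
  then have "\<tau> g = sup (\<tau> f) (\<tau> g)" using krivine_homD(4)[OF assms(1-3)] by simp
  then show ?thesis by (metis sup_ge1)
qed

text \<open>Monotonicity takes the place of continuity. Both homomorphisms agree on lattice-linear
  functions by induction; f is squeezed between such functions up to e times the l1 norm, an error
  that the Archimedean property removes.\<close>

lemma krivine_hom_unique:
  fixes x :: "nat \<Rightarrow> 'e::banach_lattice"
  assumes \<tau>: "krivine_hom n x \<tau>" and \<sigma>: "krivine_hom n x \<sigma>" and f: "f \<in> pos_homogeneous n"
  shows "\<tau> f = \<sigma> f"
proof -
  have lin: "\<tau> g = \<sigma> g" if "g \<in> lattice_linear n" for g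
    using that
  proof (induction rule: lattice_linear.induct)
    case zero
    have "\<rho> (\<lambda>t. 0) = 0" if "krivine_hom n x \<rho>" for \<rho>
    proof -
      show ?thesis using krivine_homD(3)[OF that pos_homogeneous_zero, of 0] by simp
    qed
    from this[OF \<tau>] this[OF \<sigma>] show ?case by simp
  next
    case (proj k)
    then show ?case using \<tau> \<sigma> by (simp add: krivine_hom_def)
  next
    case (add f g)
    have "\<rho> (\<lambda>t. f t + g t) = \<rho> f + \<rho> g" if "krivine_hom n x \<rho>" for \<rho>
      by (intro krivine_homD(2)[OF that] lattice_linear_pos_homogeneous add)
    from this[OF \<tau>] this[OF \<sigma>] add show ?case by simp
  next
    case (scale f c)
    have "\<rho> (\<lambda>t. c * f t) = c *\<^sub>R \<rho> f" if "krivine_hom n x \<rho>" for \<rho>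
      by (intro krivine_homD(3)[OF that] lattice_linear_pos_homogeneous scale)
    from this[OF \<tau>] this[OF \<sigma>] scale show ?case by simp
  next
    case (max f g)
    have "\<rho> (\<lambda>t. max (f t) (g t)) = sup (\<rho> f) (\<rho> g)" if "krivine_hom n x \<rho>" for \<rho>
      by (intro krivine_homD(4)[OF that] lattice_linear_pos_homogeneous max)
    from this[OF \<tau>] this[OF \<sigma>] max show ?case by simp
  qed
  have le: "\<rho> f \<le> \<rho>' f"
    if \<rho>: "krivine_hom n x \<rho>" and \<rho>': "krivine_hom n x \<rho>'"
      and eq: "\<And>g. g \<in> lattice_linear n \<Longrightarrow> \<rho> g = \<rho>' g" for \<rho> \<rho>'
  proof (rule le_if_le_add_scaleR)
    fix e :: real assume e: "0 < e"
    obtain g where g: "g \<in> lattice_linear n" "\<And>t. \<bar>f t - g t\<bar> \<le> e / 2 * l1_norm n t"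
      using lattice_linear_dense[OF f, of "e/2"] e by auto
    \<comment> \<open>An approximant within e/2, shifted up by e/2, lies between f and f + e times
      the l1 norm.\<close>
    let ?h = "\<lambda>t. g t + e / 2 * l1_norm n t" and ?h' = "\<lambda>t. f t + e * l1_norm n t"
    have h: "?h \<in> lattice_linear n"
      by (intro lattice_linear.add lattice_linear.scale lattice_linear_l1_norm g)
    note l1 = lattice_linear_pos_homogeneous[OF lattice_linear_l1_norm, of n]
    have h': "?h' \<in> pos_homogeneous n"
      by (intro pos_homogeneous_add pos_homogeneous_scale l1 f)
    have "\<rho> f \<le> \<rho> ?h"
    proof (rule krivine_hom_mono[OF \<rho> f lattice_linear_pos_homogeneous[OF h]])
      fix t show "f t \<le> g t + e / 2 * l1_norm n t" using g(2)[of t] by linarith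
    qed
    also have "\<rho> ?h = \<rho>' ?h" by (rule eq[OF h])
    also have "\<rho>' ?h \<le> \<rho>' ?h'"
    proof (rule krivine_hom_mono[OF \<rho>' lattice_linear_pos_homogeneous[OF h] h'])
      fix t show "g t + e / 2 * l1_norm n t \<le> f t + e * l1_norm n t"
        using g(2)[of t] by linarith
    qed
    also have "\<rho>' ?h' = \<rho>' f + e *\<^sub>R \<rho>' (l1_norm n)"
    proof -
      have "\<rho>' (\<lambda>t. f t + e * l1_norm n t) = \<rho>' f + \<rho>' (\<lambda>t. e * l1_norm n t)"
        by (rule krivine_homD(2)[OF \<rho>' f pos_homogeneous_scale[OF l1]])
      moreover have "\<rho>' (\<lambda>t. e * l1_norm n t) = e *\<^sub>R \<rho>' (l1_norm n)"
        by (rule krivine_homD(3)[OF \<rho>' l1])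
      ultimately show ?thesis by simp
    qed
    finally show "\<rho> f \<le> \<rho>' f + e *\<^sub>R \<rho>' (l1_norm n)" .
  qed
  show ?thesis using le[OF \<tau> \<sigma>] le[OF \<sigma> \<tau>] lin by (simp add: antisym)
qed

text \<open>The representatives in the ideal of w, the sum of the \<bar>x k\<bar>, form a Krivine
  homomorphism, so the description operator in \<open>krivine\<close> denotes the represented
  element. Homomorphisms for an ideal containing all x k also serve the ideal of w, which transfers
  the result to \<open>u\<close>.\<close>

theorem represents_krivine:
  fixes x :: "nat \<Rightarrow> 'e::banach_lattice"
  assumes f: "f \<in> pos_homogeneous n" and u: "0 \<le> u" and x: "\<And>k. k < n \<Longrightarrow> x k \<in> principal_ideal u"
  shows "represents u x f (krivine n x f)"
proof -
  define w where "w = (\<Sum>k<n. \<bar>x k\<bar>)"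
  have w: "0 \<le> w" and xw: "\<And>k. k < n \<Longrightarrow> x k \<in> principal_ideal w"
    unfolding w_def by (rule ideal_l1)+
  define \<tau> where "\<tau> g = (SOME z. represents w x g z)" for g
  have \<tau>: "represents w x g (\<tau> g)" if "g \<in> pos_homogeneous n" for g
    unfolding \<tau>_def by (rule someI_ex[OF ex_represents[OF that w xw]])
  have eq: "\<tau> g = z" if "g \<in> pos_homogeneous n" "represents w x g z" for g z
    by (rule represents_unique[OF w \<tau>[OF that(1)] that(2)])
  have hom: "krivine_hom n x \<tau>"
    unfolding krivine_hom_def
  proof (intro conjI allI impI ballI)
    show "\<tau> (\<lambda>t. t k) = x k" if "k < n" for k
      by (rule eq[OF pos_homogeneous_proj[OF that]]) (unfold represents_def, use xw[OF that] in blast)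
    fix g h assume g: "g \<in> pos_homogeneous n"
    show "\<tau> (\<lambda>t. c * g t) = c *\<^sub>R \<tau> g" for c
      by (rule eq[OF pos_homogeneous_scale[OF g] represents_scale[OF \<tau>[OF g]]])
    assume h: "h \<in> pos_homogeneous n"
    show "\<tau> (\<lambda>t. g t + h t) = \<tau> g + \<tau> h"
      by (rule eq[OF pos_homogeneous_add[OF g h] represents_add[OF \<tau>[OF g] \<tau>[OF h]]])
    show "\<tau> (\<lambda>t. max (g t) (h t)) = sup (\<tau> g) (\<tau> h)"
      by (rule eq[OF pos_homogeneous_max[OF g h] represents_sup[OF \<tau>[OF g] \<tau>[OF h]]])
  qed
  have "krivine n x f = \<tau> f"
    unfolding krivine_def
  proof (rule the_equality)
    show "\<exists>\<tau>'. krivine_hom n x \<tau>' \<and> \<tau> f = \<tau>' f" using hom by blast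
    show "y = \<tau> f" if "\<exists>\<tau>'. krivine_hom n x \<tau>' \<and> y = \<tau>' f" for y
      using that krivine_hom_unique[OF _ hom f] by blast
  qed
  then have r: "represents w x f (krivine n x f)" using \<tau>[OF f] by simp
  have "w \<in> principal_ideal u" unfolding w_def by (intro ideal_sum ideal_abs x) simp
  then show ?thesis
    using r ideal_mono[of w u] lattice_homs_antimono[of w u] w unfolding represents_def by blast
qed

section \<open>The concavification and its dual ball\<close>

lemma spow_0 [simp]: "spow p 0 = 0"
  by (simp add: spow_def)

lemma spow_mult: "spow p (a * b) = spow p a * spow p b"
  by (simp add: spow_def sgn_mult abs_mult powr_mult)

lemma spow_minus: "spow p (- a) = - spow p a"
  by (simp add: spow_def sgn_minus)

lemma spow_nonneg: "0 \<le> a \<Longrightarrow> spow p a = a powr p"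
  by (cases "a = 0") (simp_all add: spow_def)

lemma spow_spow:
  assumes "p * q = 1" shows "spow q (spow p a) = a"
proof (cases "0 \<le> a")
  case True then show ?thesis by (simp add: spow_nonneg powr_powr assms)
next
  case False
  then have "spow q (spow p (- a)) = - a" by (simp add: spow_nonneg powr_powr assms)
  then show ?thesis by (simp add: spow_minus)
qed

lemma spow_inverse: "0 < p \<Longrightarrow> spow (1 / p) (spow p a) = a" "0 < p \<Longrightarrow> spow p (spow (1 / p) a) = a"
  by (simp_all add: spow_spow)

lemma spow_inject: "0 < p \<Longrightarrow> spow p a = spow p b \<Longrightarrow> a = b"
  by (metis spow_inverse(1))

lemma spow_le_powr:
  assumes "0 \<le> b" "a \<le> b" "0 < p" shows "spow p a \<le> b powr p"
proof (cases "0 \<le> a")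
  case True then show ?thesis using assms by (simp add: spow_nonneg powr_mono2)
next
  case False
  then have "spow p a \<le> 0" using spow_minus[of p "- a"] spow_nonneg[of "- a" p] by simp
  then show ?thesis by (meson order_trans powr_ge_zero)
qed

lemma continuous_on_spow:
  fixes f :: "'a::topological_space \<Rightarrow> real"
  assumes "0 < p" "continuous_on A f" shows "continuous_on A (\<lambda>x. spow p (f x))"
proof -
  have "spow p a = max a 0 powr p - max (- a) 0 powr p" for a
    using spow_minus[of p "- a"] spow_nonneg[of a p] spow_nonneg[of "- a" p] by (simp add: max_def)
  then show ?thesis
    using assms by (auto intro!: continuous_intros continuous_on_powr')
qed

section \<open>The vector space operations of E_p\<close>

context
  fixes p :: real and dummy :: "'e::banach_lattice itself"
  assumes p: "0 < p"
begin

lemma pos_homogeneous_padd: "(\<lambda>t. spow (1 / p) (spow p (t 0) + spow p (t 1))) \<in> pos_homogeneous 2"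
proof (rule pos_homogeneousI)
  show "continuous_on UNIV (\<lambda>t::nat \<Rightarrow> real. spow (1 / p) (spow p (t 0) + spow p (t 1)))"
    using p by (intro continuous_on_spow continuous_intros continuous_on_product_coordinates) auto
  fix c :: real and t :: "nat \<Rightarrow> real" assume "0 \<le> c"
  show "spow (1 / p) (spow p (c * t 0) + spow p (c * t 1)) = c * spow (1 / p) (spow p (t 0) + spow p (t 1))"
    unfolding spow_mult distrib_left[symmetric] spow_inverse(1)[OF p] ..
qed simp

lemma pos_homogeneous_p_sum: "(\<lambda>t. (\<Sum>k<n. \<bar>t k\<bar> powr p) powr (1 / p)) \<in> pos_homogeneous n"
proof (rule pos_homogeneousI)
  show "continuous_on UNIV (\<lambda>t::nat \<Rightarrow> real. (\<Sum>k<n. \<bar>t k\<bar> powr p) powr (1 / p))"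
    using p by (intro continuous_on_powr' continuous_intros continuous_on_product_coordinates) (auto intro: sum_nonneg)
  fix c :: real and t :: "nat \<Rightarrow> real" assume c: "0 \<le> c"
  have "(\<Sum>k<n. \<bar>c * t k\<bar> powr p) = c powr p * (\<Sum>k<n. \<bar>t k\<bar> powr p)"
    using c by (simp add: abs_mult powr_mult sum_distrib_left)
  then show "(\<Sum>k<n. \<bar>c * t k\<bar> powr p) powr (1 / p) = c * (\<Sum>k<n. \<bar>t k\<bar> powr p) powr (1 / p)"
    using c p by (simp add: powr_mult sum_nonneg powr_powr)
qed simp

abbreviation padd :: "'e \<Rightarrow> 'e \<Rightarrow> 'e" where
  "padd \<equiv> vadd (concavification p)"

abbreviation pscale :: "real \<Rightarrow> 'e \<Rightarrow> 'e" where
  "pscale \<equiv> vscale (concavification p)"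

lemma pscale_eq: "pscale a x = spow (1 / p) a *\<^sub>R x"
  by (simp add: concavification_def)

text \<open>Applying \<open>spow p\<close> undoes the root in the Krivine expression for the sum, so
  \<omega> followed by \<open>spow p\<close> is additive on E_p.\<close>

lemma padd_hom:
  assumes "0 \<le> u" "x \<in> principal_ideal u" "y \<in> principal_ideal u"
  shows "padd x y \<in> principal_ideal u"
    and "\<omega> \<in> lattice_homs u \<Longrightarrow> spow p (\<omega> (padd x y)) = spow p (\<omega> x) + spow p (\<omega> y)"
proof -
  have "represents u (\<lambda>k. if k = 0 then x else y)
      (\<lambda>t. spow (1 / p) (spow p (t 0) + spow p (t 1))) (padd x y)"
    unfolding concavification_def vs.simps
    by (rule represents_krivine[OF pos_homogeneous_padd assms(1)]) (use assms in simp)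
  note r = representsD[OF this]
  show "padd x y \<in> principal_ideal u" by (rule r(1))
  show "spow p (\<omega> (padd x y)) = spow p (\<omega> x) + spow p (\<omega> y)" if "\<omega> \<in> lattice_homs u"
    using r(2)[OF that] by (simp add: spow_inverse(2)[OF p])
qed

lemma pscale_hom:
  assumes "x \<in> principal_ideal u"
  shows "pscale a x \<in> principal_ideal u"
    and "\<omega> \<in> lattice_homs u \<Longrightarrow> spow p (\<omega> (pscale a x)) = a * spow p (\<omega> x)"
proof -
  show "pscale a x \<in> principal_ideal u" unfolding pscale_eq by (rule ideal_scale[OF assms])
  show "spow p (\<omega> (pscale a x)) = a * spow p (\<omega> x)" if "\<omega> \<in> lattice_homs u"
    unfolding pscale_eq lattice_homsD(1)[OF that assms] spow_mult spow_inverse(2)[OF p] ..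
qed

lemma p_sum_hom:
  fixes x :: "nat \<Rightarrow> 'e"
  assumes "0 \<le> u" "\<And>k. k < n \<Longrightarrow> x k \<in> principal_ideal u"
  shows "p_sum p n x \<in> principal_ideal u"
    and "\<omega> \<in> lattice_homs u \<Longrightarrow> \<omega> (p_sum p n x) = (\<Sum>k<n. \<bar>\<omega> (x k)\<bar> powr p) powr (1 / p)"
  using representsD[OF represents_krivine[OF pos_homogeneous_p_sum assms]]
  unfolding p_sum_def by auto

lemma eq_by_spow:
  fixes x y :: 'e
  assumes "0 \<le> u" "x \<in> principal_ideal u" "y \<in> principal_ideal u"
    "\<And>\<omega>. \<omega> \<in> lattice_homs u \<Longrightarrow> spow p (\<omega> x) = spow p (\<omega> y)"
  shows "x = y"
  by (rule eq_by_lattice_homs[OF assms(1-3)], rule spow_inject[OF p], rule assms(4))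

lemma common_ideal:
  fixes x y z :: 'e
  obtains u where "0 \<le> u" "x \<in> principal_ideal u" "y \<in> principal_ideal u" "z \<in> principal_ideal u"
proof -
  let ?v = "\<lambda>k::nat. if k = 0 then x else if k = 1 then y else z"
  show thesis
    using that[OF ideal_l1(1)[of ?v 3]] ideal_l1(2)[of 0 3 ?v] ideal_l1(2)[of 1 3 ?v] ideal_l1(2)[of 2 3 ?v]
    by simp
qed

lemma real_vs_concavification: "real_vs (concavification p :: 'e nvlat)"
proof
  have simps: "vcarrier (concavification p :: 'e nvlat) = UNIV" "vzero (concavification p :: 'e nvlat) = 0"
    by (simp_all add: concavification_def)
  note simps[simp]
  fix x y z :: 'e and b c :: real
  obtain u where u: "0 \<le> u" and x: "x \<in> principal_ideal u" and y: "y \<in> principal_ideal u"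
    and z: "z \<in> principal_ideal u"
    by (rule common_ideal)
  note I = padd_hom(1)[OF u] pscale_hom(1) x y z ideal_zero
  note H = padd_hom(2)[OF u] pscale_hom(2)[where u = u]
  have zero: "\<omega> 0 = 0" if "\<omega> \<in> lattice_homs u" for \<omega>
    using lattice_homsD(1)[OF that ideal_zero, of 0] by simp
  show "padd (padd x y) z = padd x (padd y z)"
    by (rule eq_by_spow[OF u]) (simp_all add: I H)
  show "padd x y = padd y x"
    by (rule eq_by_spow[OF u]) (simp_all add: I H)
  show "padd x (vzero (concavification p)) = x"
    by (rule eq_by_spow[OF u]) (simp_all add: I H zero)
  show "pscale 0 x = vzero (concavification p)" "pscale 1 x = x" "pscale b (pscale c x) = pscale (b * c) x"
    by (simp_all add: pscale_eq spow_mult spow_nonneg)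
  show "pscale (b + c) x = padd (pscale b x) (pscale c x)"
    by (rule eq_by_spow[OF u]) (simp_all add: I H algebra_simps)
  show "pscale c (padd x y) = padd (pscale c x) (pscale c y)"
    by (rule eq_by_spow[OF u]) (simp_all add: I H algebra_simps)
qed (simp_all add: concavification_def)

lemma p_sum_nonneg: "0 \<le> p_sum p n (x :: nat \<Rightarrow> 'e)"
proof (rule le_by_lattice_homs[OF ideal_l1(1)[of x n] ideal_zero])
  note h = p_sum_hom[OF ideal_l1(1)[of x n] ideal_l1(2)]
  show "p_sum p n x \<in> principal_ideal (\<Sum>k<n. \<bar>x k\<bar>)" by (rule h(1))
  fix \<omega> assume \<omega>: "\<omega> \<in> lattice_homs (\<Sum>k<n. \<bar>x k\<bar>)"
  show "\<omega> 0 \<le> \<omega> (p_sum p n x)"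
    using h(2)[OF _ \<omega>] lattice_homsD(1)[OF \<omega> ideal_zero, of 0] by simp
qed

lemma p_sum_0: "p_sum p 0 (x :: nat \<Rightarrow> 'e) = 0"
proof -
  have "p_sum p 0 x \<in> principal_ideal 0" by (rule p_sum_hom(1)) auto
  then show ?thesis by (simp add: principal_ideal_def)
qed

text \<open>The p-sum in E is the E_p-sum of the moduli. By induction, functionals on E_p split
  p-sums into ordinary sums.\<close>

lemma p_sum_Suc: "p_sum p (Suc n) (x :: nat \<Rightarrow> 'e) = padd (p_sum p n x) \<bar>x n\<bar>"
proof -
  define u where "u = (\<Sum>k<Suc n. \<bar>x k\<bar>)"
  have u: "0 \<le> u" and x: "\<And>k. k < Suc n \<Longrightarrow> x k \<in> principal_ideal u"
    unfolding u_def by (rule ideal_l1)+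
  have s: "p_sum p m x \<in> principal_ideal u"
    "\<And>\<omega>. \<omega> \<in> lattice_homs u \<Longrightarrow> spow p (\<omega> (p_sum p m x)) = (\<Sum>k<m. \<bar>\<omega> (x k)\<bar> powr p)" if "m \<le> Suc n" for m
  proof -
    have xm: "x k \<in> principal_ideal u" if "k < m" for k using x that \<open>m \<le> Suc n\<close> by simp
    show "p_sum p m x \<in> principal_ideal u" by (rule p_sum_hom(1)[OF u xm])
    show "spow p (\<omega> (p_sum p m x)) = (\<Sum>k<m. \<bar>\<omega> (x k)\<bar> powr p)" if "\<omega> \<in> lattice_homs u" for \<omega>
    proof -
      have "\<omega> (p_sum p m x) = (\<Sum>k<m. \<bar>\<omega> (x k)\<bar> powr p) powr (1 / p)"
        by (rule p_sum_hom(2)[OF u _ that]) (rule xm)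
      then show ?thesis using p by (simp add: spow_nonneg powr_powr sum_nonneg)
    qed
  qed
  have xn: "\<bar>x n\<bar> \<in> principal_ideal u" by (intro ideal_abs x) simp
  show ?thesis
  proof (rule eq_by_spow[OF u s(1) padd_hom(1)[OF u s(1) xn]])
    fix \<omega> assume \<omega>: "\<omega> \<in> lattice_homs u"
    have "\<omega> \<bar>x n\<bar> = \<bar>\<omega> (x n)\<bar>" by (rule lattice_homsD(6)[OF \<omega> x]) simp
    then show "spow p (\<omega> (p_sum p (Suc n) x)) = spow p (\<omega> (padd (p_sum p n x) \<bar>x n\<bar>))"
      using s(2)[OF _ \<omega>, of "Suc n"] s(2)[OF _ \<omega>, of n] padd_hom(2)[OF u s(1) xn \<omega>, of n]
      by (simp add: spow_nonneg)
  qed auto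
qed

section \<open>The weak* compact positive dual ball\<close>

abbreviation dual_ball :: "('e \<Rightarrow> real) set" where
  "dual_ball \<equiv> pos_dual_ball (concavification p)"

text \<open>The supremum in \<open>dual_norm\<close> becomes a pointwise bound. The constant from
  \<open>dual_space\<close> makes that supremum meaningful, and the E_p-scalar
  \<open>norm x powr p\<close> reduces a nonzero x to a unit vector.\<close>

lemma dual_ball_iff:
  "\<phi> \<in> dual_ball \<longleftrightarrow> vlinear (concavification p) type_vs \<phi> \<and>
     (\<forall>x. \<bar>\<phi> x\<bar> \<le> norm x powr p) \<and> (\<forall>x\<ge>0. 0 \<le> \<phi> x)"
proof -
  have simps: "vcarrier (concavification p :: 'e nvlat) = UNIV" "vzero (concavification p :: 'e nvlat) = 0"
    "vnorm (concavification p) x = norm x powr p" "vle (concavification p) x y \<longleftrightarrow> x \<le> y" for x y :: 'e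
    by (simp_all add: concavification_def)
  let ?U = "{x::'e. norm x powr p \<le> 1}"
  have "\<bar>\<phi> x\<bar> \<le> norm x powr p"
    if lin: "vlinear (concavification p) type_vs \<phi>" and bd: "\<And>x. \<bar>\<phi> x\<bar> \<le> B * norm x powr p"
      and le1: "(SUP x\<in>?U. \<bar>\<phi> x\<bar>) \<le> 1" for x B
  proof (cases "x = 0")
    case True then show ?thesis using bd[of 0] by simp
  next
    case False
    define y where "y = (1 / norm x) *\<^sub>R x"
    have x: "x = pscale (norm x powr p) y"
      using False p by (simp add: pscale_eq y_def spow_nonneg powr_powr)
    have "bdd_above ((\<lambda>x. \<bar>\<phi> x\<bar>) ` ?U)"
    proof (rule bdd_aboveI2)
      fix x :: 'e assume "x \<in> ?U"
      then have "B * norm x powr p \<le> \<bar>B\<bar> * 1" by (intro mult_mono) auto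
      then show "\<bar>\<phi> x\<bar> \<le> \<bar>B\<bar>" using bd[of x] by simp
    qed
    moreover have "y \<in> ?U" using False by (simp add: y_def)
    ultimately have "\<bar>\<phi> y\<bar> \<le> (SUP x\<in>?U. \<bar>\<phi> x\<bar>)" by (intro cSUP_upper)
    then have "\<bar>\<phi> y\<bar> \<le> 1" using le1 by simp
    moreover have "\<phi> x = norm x powr p * \<phi> y"
    proof -
      have "\<phi> (pscale c y) = c * \<phi> y" for c using lin by (simp add: vlinear_def simps type_vs_def)
      then show ?thesis using x by metis
    qed
    ultimately show ?thesis by (simp add: abs_mult mult_left_le)
  qed
  moreover have "(SUP x\<in>?U. \<bar>\<phi> x\<bar>) \<le> 1" if "\<And>x. \<bar>\<phi> x\<bar> \<le> norm x powr p"
    by (rule cSUP_least) (use that order_trans in \<open>auto intro!: exI[of _ 0]\<close>)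
  moreover have "\<exists>B. \<forall>x. \<bar>\<phi> x\<bar> \<le> B * norm x powr p" if "\<And>x. \<bar>\<phi> x\<bar> \<le> norm x powr p"
    using that by (intro exI[of _ 1]) simp
  ultimately show ?thesis
    unfolding pos_dual_ball_def dual_space_def dual_norm_def simps by auto
qed

lemma dual_ballD:
  assumes "\<phi> \<in> dual_ball"
  shows "\<phi> (padd x y) = \<phi> x + \<phi> y" "\<phi> (pscale c x) = c * \<phi> x" "\<phi> 0 = 0"
    "\<bar>\<phi> x\<bar> \<le> norm x powr p" "0 \<le> x \<Longrightarrow> 0 \<le> \<phi> x"
proof -
  have "vlinear (concavification p) type_vs \<phi>" using assms by (simp add: dual_ball_iff)
  then show "\<phi> (padd x y) = \<phi> x + \<phi> y" "\<phi> (pscale c x) = c * \<phi> x"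
    by (simp_all add: vlinear_def type_vs_def concavification_def)
  show le: "\<bar>\<phi> x\<bar> \<le> norm x powr p" for x using assms by (simp add: dual_ball_iff)
  show "\<phi> 0 = 0" using le[of 0] by simp
  show "0 \<le> x \<Longrightarrow> 0 \<le> \<phi> x" using assms by (simp add: dual_ball_iff)
qed

lemma dual_ball_p_sum:
  assumes "\<phi> \<in> dual_ball" shows "\<phi> (p_sum p n x) = (\<Sum>k<n. \<phi> \<bar>x k\<bar>)"
  by (induction n) (simp_all add: p_sum_0 p_sum_Suc dual_ballD[OF assms])

text \<open>On moduli, multiplication by c in E is multiplication by the scalar \<bar>c\<bar>^p in
  E_p.\<close>

lemma dual_ball_abs_scale:
  assumes "\<phi> \<in> dual_ball" shows "\<phi> \<bar>c *\<^sub>R x\<bar> = \<bar>c\<bar> powr p * \<phi> \<bar>x\<bar>"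
proof -
  have "\<bar>c *\<^sub>R x\<bar> = pscale (\<bar>c\<bar> powr p) \<bar>x\<bar>"
    using p by (simp add: pscale_eq abs_scaleR_lattice spow_nonneg powr_powr)
  then show ?thesis using dual_ballD(2)[OF assms] by simp
qed

lemma zero_dual_ball: "(\<lambda>x. 0) \<in> dual_ball"
  by (simp add: dual_ball_iff vlinear_def type_vs_def)

abbreviation ball_topology :: "('e \<Rightarrow> real) topology" where
  "ball_topology \<equiv> weak_star_pos_dual_ball (concavification p)"

lemma ball_topology_eq: "ball_topology = top_of_set dual_ball"
  unfolding weak_star_pos_dual_ball_def by (simp add: concavification_def euclidean_product_topology)

lemma topspace_ball: "topspace ball_topology = dual_ball"
  by (simp add: ball_topology_eq)

lemma Hausdorff_ball: "Hausdorff_space ball_topology"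
  unfolding weak_star_pos_dual_ball_def
  by (intro Hausdorff_space_subtopology) (simp add: Hausdorff_space_product_topology)

text \<open>Banach-Alaoglu: linearity and positivity are closed conditions, each on finitely many
  coordinates, inside a product of compact intervals.\<close>

lemma compact_ball: "compact_space ball_topology"
proof -
  let ?B = "PiE UNIV (\<lambda>x::'e. {- (norm x powr p)..norm x powr p})"
  have "compactin (product_topology (\<lambda>_. euclidean) UNIV) ?B"
    by (subst compactin_PiE) (simp add: compactin_euclidean_iff)
  then have B: "compact ?B" by (simp add: euclidean_product_topology compactin_euclidean_iff)
  define A1 where "A1 = (\<Inter>x. \<Inter>y. {\<phi>::'e\<Rightarrow>real. \<phi> (padd x y) = \<phi> x + \<phi> y})"
  define A2 where "A2 = (\<Inter>c. \<Inter>x. {\<phi>::'e\<Rightarrow>real. \<phi> (pscale c x) = c * \<phi> x})"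
  define A3 where "A3 = (\<Inter>x\<in>{0..}. {\<phi>::'e\<Rightarrow>real. 0 \<le> \<phi> x})"
  have ev: "continuous_on UNIV (\<lambda>\<phi>::'e\<Rightarrow>real. \<phi> x)" for x by (rule continuous_on_product_coordinates)
  have "closed A1" unfolding A1_def by (intro closed_INT ballI closed_Collect_eq continuous_on_add ev)
  moreover have "closed A2" unfolding A2_def by (intro closed_INT ballI closed_Collect_eq continuous_on_mult continuous_on_const ev)
  moreover have "closed A3" unfolding A3_def by (intro closed_INT ballI closed_Collect_le continuous_on_const ev)
  ultimately have "compact (?B \<inter> (A1 \<inter> A2 \<inter> A3))" using B by (intro compact_Int_closed closed_Int)
  moreover have "dual_ball = ?B \<inter> (A1 \<inter> A2 \<inter> A3)"
  proof -
    have "vlinear (concavification p) type_vs \<phi> \<longleftrightarrow> \<phi> \<in> A1 \<inter> A2" for \<phi> :: "'e \<Rightarrow> real"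
      by (auto simp: vlinear_def type_vs_def concavification_def A1_def A2_def)
    moreover have "(\<forall>x. \<bar>\<phi> x\<bar> \<le> norm x powr p) \<longleftrightarrow> \<phi> \<in> ?B" for \<phi> :: "'e \<Rightarrow> real"
      unfolding abs_le_iff PiE_UNIV_domain Pi_iff by (simp add: minus_le_iff conj_commute)
    moreover have "(\<forall>x\<ge>0. 0 \<le> \<phi> x) \<longleftrightarrow> \<phi> \<in> A3" for \<phi> :: "'e \<Rightarrow> real" by (auto simp: A3_def)
    ultimately show ?thesis unfolding set_eq_iff dual_ball_iff by blast
  qed
  ultimately show ?thesis unfolding ball_topology_eq by (simp add: compact_space_subtopology)
qed

lemma continuous_eval: "continuous_map ball_topology euclideanreal (\<lambda>\<phi>. \<phi> x)"
  unfolding ball_topology_eq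
  by (simp add: continuous_on_product_coordinates continuous_on_subset[OF continuous_on_product_coordinates])

text \<open>The Hahn--Banach theorem on \<open>E\<^sub>p\<close> for the sublinear functional \<open>\<parallel>x\<^sup>+\<parallel>\<^sup>p\<close>; its subadditivity is
  the \<open>p\<close>-convexity of \<open>E\<close>.\<close>

lemma ex_norming:
  assumes conv: "p_convex p 1 TYPE('e)" and w: "0 \<le> w"
  shows "\<exists>\<phi>\<in>dual_ball. \<phi> w = norm w powr p"
proof -
  interpret V: real_vs "concavification p :: 'e nvlat" by (rule real_vs_concavification)
  have V: "vcarrier (concavification p :: 'e nvlat) = UNIV" by (simp add: concavification_def)
  define N where "N x = norm (sup x 0) powr p" for x :: 'e
  have N_le: "N x \<le> norm x powr p" for x
  proof -
    have "norm (sup x 0) \<le> norm \<bar>x\<bar>" by (intro norm_mono_pos le_supI abs_ge_self abs_ge_zero) simp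
    then show ?thesis using p by (simp add: N_def powr_mono2)
  qed
  have "V.sublinear N"
    unfolding V.sublinear_def V
  proof (intro conjI ballI allI impI)
    fix x y :: 'e
    let ?v = "\<lambda>k::nat. if k = 0 then sup x 0 else sup y 0"
    obtain u where u: "0 \<le> u" and x: "x \<in> principal_ideal u" and y: "y \<in> principal_ideal u"
      using common_ideal[of x y x] by blast
    have v: "?v k \<in> principal_ideal u" for k using ideal_sup x y ideal_zero by auto
    \<comment> \<open>Under a lattice homomorphism this says that signed p-th powers add up to at
      most the p-th powers of the positive parts.\<close>
    have "sup (padd x y) 0 \<le> p_sum p 2 ?v"
    proof (rule le_by_lattice_homs[OF u])
      show "sup (padd x y) 0 \<in> principal_ideal u" by (intro ideal_sup padd_hom(1) u x y ideal_zero)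
      show "p_sum p 2 ?v \<in> principal_ideal u" by (rule p_sum_hom(1)[OF u v])
      fix \<omega> assume \<omega>: "\<omega> \<in> lattice_homs u"
      have z: "\<omega> 0 = 0" using lattice_homsD(1)[OF \<omega> ideal_zero, of 0] by simp
      have m: "\<omega> (sup a 0) = max (\<omega> a) 0" if "a \<in> principal_ideal u" for a
        using lattice_homsD(5)[OF \<omega> that ideal_zero] z by simp
      let ?s = "max (\<omega> x) 0 powr p + max (\<omega> y) 0 powr p"
      have "spow p (\<omega> (padd x y)) \<le> ?s"
        unfolding padd_hom(2)[OF u x y \<omega>] by (intro add_mono spow_le_powr p) auto
      then have "spow (1 / p) (spow p (\<omega> (padd x y))) \<le> ?s powr (1 / p)"
        using p by (intro spow_le_powr) auto
      moreover have "\<omega> (p_sum p 2 ?v) = ?s powr (1 / p)"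
        using p_sum_hom(2)[OF u _ \<omega>, of 2 ?v] v m[OF x] m[OF y] by (simp add: numeral_2_eq_2)
      ultimately show "\<omega> (sup (padd x y) 0) \<le> \<omega> (p_sum p 2 ?v)"
        using m[OF padd_hom(1)[OF u x y]] spow_inverse(1)[OF p] by simp
    qed
    then have "norm (sup (padd x y) 0) \<le> norm (p_sum p 2 ?v)" by (intro norm_mono_pos) auto
    also have "\<dots> \<le> 1 * (\<Sum>k<2. norm (?v k) powr p) powr (1 / p)"
      using conv unfolding p_convex_def by blast
    also have "\<dots> = (N x + N y) powr (1 / p)" by (simp add: N_def numeral_2_eq_2)
    finally have "norm (sup (padd x y) 0) powr p \<le> ((N x + N y) powr (1 / p)) powr p"
      using p by (intro powr_mono2) auto
    then show "N (padd x y) \<le> N x + N y"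
      using p by (simp add: N_def powr_powr)
  next
    fix c :: real and x :: 'e assume c: "0 \<le> c"
    have "sup (pscale c x) 0 = c powr (1 / p) *\<^sub>R sup x 0"
      using c by (simp add: pscale_eq spow_nonneg scaleR_sup)
    then show "N (pscale c x) \<le> c * N x"
      using c p by (simp add: N_def powr_mult powr_powr)
  qed
  then obtain \<phi> where \<phi>: "vlinear (concavification p) type_vs \<phi>" "\<And>x. \<phi> x \<le> N x" "\<phi> w = N w"
    using V.ex_linear_le_sublinear[of "{}" N w] V by (auto simp: V.translation_invariant_def max_on_def)
  have neg: "\<phi> (- x) = - \<phi> x" for x
  proof -
    have "- x = pscale (-1) x" by (simp add: pscale_eq spow_minus spow_nonneg)
    then show ?thesis using \<phi>(1) by (simp add: vlinear_def V type_vs_def)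
  qed
  \<comment> \<open>Positivity comes from the positive part in N: for x \<ge> 0 the bound N (-x) is
    0.\<close>
  have "0 \<le> \<phi> x" if "0 \<le> x" for x
  proof -
    have "sup (- x) 0 = 0" using that by (simp add: sup.absorb2)
    then have "N (- x) = 0" by (simp add: N_def)
    then show ?thesis using \<phi>(2)[of "- x"] neg by simp
  qed
  moreover have "\<bar>\<phi> x\<bar> \<le> norm x powr p" for x
    using order_trans[OF \<phi>(2) N_le, of x] order_trans[OF \<phi>(2) N_le, of "- x"] neg by (simp add: abs_le_iff)
  ultimately have "\<phi> \<in> dual_ball" using \<phi>(1) by (simp add: dual_ball_iff)
  moreover have "N w = norm w powr p" using w by (simp add: N_def sup.absorb1)
  ultimately show ?thesis using \<phi>(3) by auto
qed

end

section \<open>The equivalence\<close>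

locale exponents =
  fixes p q :: real and r :: ennreal
  assumes p: "1 \<le> p" and pq: "p \<le> q" and r: "1 / r = ennreal (1 / p - 1 / q)"
begin

text \<open>For p < q the equation in \<open>ennreal\<close> excludes r = 0, whose reciprocal is
  infinite, and r = \<infinity>, whose reciprocal is 0.\<close>

lemma r_cases:
  obtains "p = q" "r = \<infinity>"
  | \<rho> where "p < q" "0 < \<rho>" "1 / \<rho> = 1 / p - 1 / q" "r \<noteq> \<infinity>" "enn2real r = \<rho>"
proof (cases "p = q")
  case True
  then have "r = \<infinity>" using r by (simp add: ennreal_divide_eq_0_iff)
  then show thesis using that(1) True by simp
next
  case False
  then have lt: "p < q" using pq by simp
  then have d: "0 < 1 / p - 1 / q" using p by (simp add: field_simps)
  obtain s where s: "r = ennreal s" "0 \<le> s"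
  proof (cases r)
    case top then show thesis using r d by (simp add: ennreal_eq_0_iff)
  qed (use that in auto)
  have "s \<noteq> 0"
  proof
    assume "s = 0"
    then show False using r s by simp
  qed
  then have "0 < s" using s by simp
  moreover have "ennreal (1 / s) = ennreal (1 / p - 1 / q)"
    using r s(1) \<open>0 < s\<close> divide_ennreal[of 1 s] by simp
  then have "1 / s = 1 / p - 1 / q" using d \<open>0 < s\<close> by (subst (asm) ennreal_inj) auto
  ultimately show thesis using that(2)[of s] lt s by simp
qed

section \<open>Hoelder duality on the unit ball of l_r\<close>

lemma lr_ball_infinity: "r = \<infinity> \<Longrightarrow> \<beta> \<in> lr_ball r n \<longleftrightarrow> (\<forall>i<n. \<bar>\<beta> i\<bar> \<le> 1)"
  by (auto simp: lr_ball_def lr_norm_def)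

lemma lr_ball_finite:
  assumes "r \<noteq> \<infinity>" "enn2real r = \<rho>" "0 < \<rho>"
  shows "\<beta> \<in> lr_ball r n \<longleftrightarrow> (\<Sum>i<n. \<bar>\<beta> i\<bar> powr \<rho>) \<le> 1"
proof -
  have "0 \<le> (\<Sum>i<n. \<bar>\<beta> i\<bar> powr \<rho>)" by (simp add: sum_nonneg)
  then have "(\<Sum>i<n. \<bar>\<beta> i\<bar> powr \<rho>) powr (1 / \<rho>) \<le> 1 \<longleftrightarrow> (\<Sum>i<n. \<bar>\<beta> i\<bar> powr \<rho>) \<le> 1"
    using assms(3) powr_mono2[of "1/\<rho>" "\<Sum>i<n. \<bar>\<beta> i\<bar> powr \<rho>" 1]
      powr_less_mono2[of "1/\<rho>" 1 "\<Sum>i<n. \<bar>\<beta> i\<bar> powr \<rho>"] by (auto simp: not_le[symmetric])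
  then show ?thesis using assms(1,2) by (simp add: lr_ball_def lr_norm_def)
qed

lemma zero_lr_ball: "(\<lambda>i. 0) \<in> lr_ball r n"
  using r_cases
proof cases
  case 1 show ?thesis using lr_ball_infinity[OF 1(2)] by simp
next
  case (2 \<rho>) show ?thesis using lr_ball_finite[OF 2(4,5,2)] by simp
qed

lemma lr_ball_le_1:
  assumes "\<beta> \<in> lr_ball r n" "i < n" shows "\<bar>\<beta> i\<bar> \<le> 1"
  using r_cases
proof cases
  case 1 show ?thesis using assms lr_ball_infinity[OF 1(2)] by simp
next
  case (2 \<rho>)
  have "\<bar>\<beta> i\<bar> powr \<rho> \<le> (\<Sum>i<n. \<bar>\<beta> i\<bar> powr \<rho>)" by (rule member_le_sum) (use assms in auto)
  also have "\<dots> \<le> 1" using assms(1) lr_ball_finite[OF 2(4,5,2)] by simp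
  finally show ?thesis using powr_less_mono2[of \<rho> 1 "\<bar>\<beta> i\<bar>"] 2(2) by (auto simp: not_le[symmetric])
qed

text \<open>Hoelder's inequality with exponents \<sigma> = \<rho>/p and s = q/p, conjugate because
  1/\<rho> = 1/p - 1/q; it follows from Young's inequality after dividing a by its l_s norm. For p =
  q the bound \<bar>\<beta> i\<bar> \<le> 1 suffices.\<close>

lemma holder_lr_ball:
  assumes \<beta>: "\<beta> \<in> lr_ball r n" and a: "\<And>i. i < n \<Longrightarrow> 0 \<le> a i"
  shows "(\<Sum>i<n. \<bar>\<beta> i\<bar> powr p * a i) \<le> (\<Sum>i<n. a i powr (q / p)) powr (p / q)"
  using r_cases
proof cases
  case 1
  have "(\<Sum>i<n. \<bar>\<beta> i\<bar> powr p * a i) \<le> (\<Sum>i<n. a i)"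
  proof (rule sum_mono)
    fix i assume i: "i \<in> {..<n}"
    have "\<bar>\<beta> i\<bar> powr p \<le> 1 powr p" using lr_ball_le_1[OF \<beta>] i p by (intro powr_mono2) auto
    then show "\<bar>\<beta> i\<bar> powr p * a i \<le> a i" using a i by (simp add: mult_left_le_one_le)
  qed
  moreover have "0 \<le> (\<Sum>i<n. a i)" by (rule sum_nonneg) (use a in auto)
  then have "(\<Sum>i<n. a i powr 1) powr 1 = (\<Sum>i<n. a i)" using a by simp
  ultimately show ?thesis using 1 p by simp
next
  case (2 \<rho>)
  define s \<sigma> where "s = q / p" and "\<sigma> = \<rho> / p"
  have pos: "0 < p" "0 < q" using p pq by auto
  have "p / \<rho> = 1 - p / q" using 2(2,3) pos by (simp add: field_simps)
  then have conj: "1 / \<sigma> + 1 / s = 1" by (simp add: s_def \<sigma>_def)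
  have s: "1 < s" using 2(1) pos by (simp add: s_def)
  then have "0 < 1 / s" by simp
  then have "1 / \<sigma> < 1" using conj by linarith
  moreover have "0 < \<sigma>" using 2(2) pos by (simp add: \<sigma>_def)
  ultimately have \<sigma>: "1 < \<sigma>" by (simp add: field_simps)
  define A where "A = (\<Sum>i<n. a i powr s)"
  have A: "0 \<le> A" by (simp add: A_def sum_nonneg)
  show ?thesis
  proof (cases "A = 0")
    case True
    then have "a i = 0" if "i < n" for i using that by (simp add: A_def sum_nonneg_eq_0_iff)
    then show ?thesis by simp
  next
    case False
    then have A: "0 < A" using A by simp
    define c where "c = A powr (1 / s)"
    have c: "0 < c" "c powr s = A" using A s by (simp_all add: c_def powr_powr)
    have "(\<Sum>i<n. \<bar>\<beta> i\<bar> powr p * (a i / c)) \<le> (\<Sum>i<n. \<bar>\<beta> i\<bar> powr \<rho> / \<sigma> + a i powr s / A / s)"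
    proof (rule sum_mono)
      fix i assume "i \<in> {..<n}"
      then have i: "0 \<le> a i" using a by simp
      have "\<bar>\<beta> i\<bar> powr p * (a i / c) \<le> (\<bar>\<beta> i\<bar> powr p) powr \<sigma> / \<sigma> + (a i / c) powr s / s"
        using i c by (intro Youngs_inequality \<sigma> s conj) auto
      also have "(\<bar>\<beta> i\<bar> powr p) powr \<sigma> = \<bar>\<beta> i\<bar> powr \<rho>" using pos by (simp add: powr_powr \<sigma>_def)
      also have "(a i / c) powr s = a i powr s / A" using i c by (simp add: powr_divide)
      finally show "\<bar>\<beta> i\<bar> powr p * (a i / c) \<le> \<bar>\<beta> i\<bar> powr \<rho> / \<sigma> + a i powr s / A / s" .
    qed
    also have "\<dots> = (\<Sum>i<n. \<bar>\<beta> i\<bar> powr \<rho>) / \<sigma> + A / A / s"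
      by (simp add: sum.distrib sum_divide_distrib[symmetric] A_def)
    also have "\<dots> \<le> 1 / \<sigma> + 1 / s"
      using \<beta> lr_ball_finite[OF 2(4,5,2)] \<sigma> s A by (intro add_mono divide_right_mono) auto
    finally have "(\<Sum>i<n. \<bar>\<beta> i\<bar> powr p * a i) / c \<le> 1" using conj by (simp add: sum_divide_distrib)
    then show ?thesis using c by (simp add: c_def A_def s_def field_simps)
  qed
qed

text \<open>The equality case: \<bar>\<beta> i\<bar>^p is proportional to a_i^(s-1) for s = q/p, and
  the divisor \<open>A powr (1 - 1 / s)\<close> puts \<beta> on the unit sphere. For p = q the
  constant 1 serves.\<close>

lemma holder_attained:
  assumes a: "\<And>i. i < n \<Longrightarrow> 0 \<le> a i"
  shows "\<exists>\<beta>\<in>lr_ball r n. (\<Sum>i<n. \<bar>\<beta> i\<bar> powr p * a i) = (\<Sum>i<n. a i powr (q / p)) powr (p / q)"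
  using r_cases
proof cases
  case 1
  have nn: "0 \<le> (\<Sum>i<n. a i)" by (rule sum_nonneg) (use a in auto)
  then have "(\<Sum>i<n. a i powr 1) powr 1 = (\<Sum>i<n. a i)" using a by simp
  moreover have "(\<lambda>i. 1) \<in> lr_ball r n" using lr_ball_infinity[OF 1(2)] by simp
  ultimately show ?thesis using 1(1) p nn by (intro bexI[of _ "\<lambda>i. 1"]) simp_all
next
  case (2 \<rho>)
  define s where "s = q / p"
  have pos: "0 < p" "0 < q" using p pq by auto
  have s: "1 < s" using 2(1) pos by (simp add: s_def)
  \<comment> \<open>Conjugacy of \<rho>/p and s in the form that turns the \<rho>-th power of
    \<beta> i into a_i^s / A.\<close>
  have "\<rho> * q - \<rho> * p = p * q" using 2(2,3) pos by (simp add: field_simps)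
  moreover have "(s - 1) * (\<rho> / p) = (\<rho> * q - \<rho> * p) / (p * p)"
    using pos by (simp add: s_def field_simps)
  ultimately have \<rho>: "(s - 1) * (\<rho> / p) = s" using pos by (simp add: s_def)
  define A where "A = (\<Sum>i<n. a i powr s)"
  have A: "0 \<le> A" by (simp add: A_def sum_nonneg)
  show ?thesis
  proof (cases "A = 0")
    case True
    then show ?thesis using zero_lr_ball by (intro bexI[of _ "\<lambda>i. 0"]) (simp_all add: A_def s_def)
  next
    case False
    then have A: "0 < A" using A by simp
    define \<beta> where "\<beta> i = (a i powr (s - 1) / A powr (1 - 1 / s)) powr (1 / p)" for i
    have "\<bar>\<beta> i\<bar> powr \<rho> = a i powr s / A" for i
    proof -
      have *: "(1 - 1 / s) * (\<rho> / p) = 1" using \<rho> s by (simp add: field_simps)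
      have "\<bar>\<beta> i\<bar> powr \<rho> = (a i powr (s - 1) / A powr (1 - 1 / s)) powr (\<rho> / p)"
        by (simp add: \<beta>_def powr_powr)
      also have "\<dots> = a i powr ((s - 1) * (\<rho> / p)) / A powr ((1 - 1 / s) * (\<rho> / p))"
        unfolding powr_powr[symmetric] by (rule powr_divide)
      finally show ?thesis using A unfolding \<rho> * by simp
    qed
    then have "(\<Sum>i<n. \<bar>\<beta> i\<bar> powr \<rho>) = 1"
      using A by (simp add: sum_divide_distrib[symmetric] A_def)
    then have "\<beta> \<in> lr_ball r n" using lr_ball_finite[OF 2(4,5,2)] by simp
    have "\<bar>\<beta> i\<bar> powr p * a i = a i powr s / A powr (1 - 1 / s)" if "i < n" for i
    proof -
      have "a i powr (s - 1) * a i = a i powr s"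
        using powr_mult_base[OF a[OF that], of "s - 1"] by (simp add: mult.commute)
      then show ?thesis using pos by (simp add: \<beta>_def powr_powr)
    qed
    then have "(\<Sum>i<n. \<bar>\<beta> i\<bar> powr p * a i) = A / A powr (1 - 1 / s)"
      by (simp add: sum_divide_distrib[symmetric] A_def)
    also have "\<dots> = A powr (1 / s)" using A by (simp add: powr_diff)
    finally show ?thesis using \<open>\<beta> \<in> lr_ball r n\<close> unfolding A_def s_def by auto
  qed
qed

section \<open>The supremum in (i) in terms of the dual ball\<close>

context
  fixes y :: "nat \<Rightarrow> 'e::banach_lattice"
  assumes conv: "p_convex p 1 TYPE('e)"
begin

lemma dual_ball_scaled_p_sum:
  assumes "\<phi> \<in> pos_dual_ball (concavification p)"
  shows "\<phi> (p_sum p n (\<lambda>i. \<beta> i *\<^sub>R y i)) = (\<Sum>i<n. \<bar>\<beta> i\<bar> powr p * \<phi> \<bar>y i\<bar>)"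
  using dual_ball_p_sum[OF _ assms] dual_ball_abs_scale[OF _ assms] p by simp

text \<open>A real \<open>SUP\<close> is meaningful only for a bounded family; p-convexity and
  \<bar>\<beta> i\<bar> \<le> 1 bound this one.\<close>

lemma bdd_p_sum: "bdd_above ((\<lambda>\<beta>. norm (p_sum p n (\<lambda>i. \<beta> i *\<^sub>R y i))) ` lr_ball r n)"
proof (rule bdd_aboveI2)
  fix \<beta> assume \<beta>: "\<beta> \<in> lr_ball r n"
  have "norm (p_sum p n (\<lambda>i. \<beta> i *\<^sub>R y i)) \<le> 1 * (\<Sum>i<n. norm (\<beta> i *\<^sub>R y i) powr p) powr (1 / p)"
    using conv unfolding p_convex_def by blast
  also have "\<dots> \<le> (\<Sum>i<n. norm (y i) powr p) powr (1 / p)"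
  proof -
    have "norm (\<beta> i *\<^sub>R y i) powr p \<le> norm (y i) powr p" if "i < n" for i
      using lr_ball_le_1[OF \<beta> that] p by (intro powr_mono2) (auto intro: mult_left_le_one_le)
    then have "(\<Sum>i<n. norm (\<beta> i *\<^sub>R y i) powr p) \<le> (\<Sum>i<n. norm (y i) powr p)"
      by (intro sum_mono) simp
    then show ?thesis using p powr_mono2[of "1 / p"] by (simp add: sum_nonneg)
  qed
  finally show "norm (p_sum p n (\<lambda>i. \<beta> i *\<^sub>R y i)) \<le> (\<Sum>i<n. norm (y i) powr p) powr (1 / p)" .
qed

text \<open>A p-sum is positive, so \<open>ex_norming\<close> gives a \<phi> attaining its norm, and
  Hoelder's inequality finishes. The bound M on the whole ball has the form in which
  \<open>dom\<close> of \<open>pietsch_domination\<close> supplies it.\<close>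

lemma SUP_p_sum_le:
  assumes M: "\<And>\<phi>. \<phi> \<in> pos_dual_ball (concavification p) \<Longrightarrow> (\<Sum>i<n. \<phi> \<bar>y i\<bar> powr (q / p)) \<le> M"
  shows "(SUP \<beta>\<in>lr_ball r n. norm (p_sum p n (\<lambda>i. \<beta> i *\<^sub>R y i))) \<le> M powr (1 / q)"
proof (rule cSUP_least)
  have pos: "0 < p" "0 < q" using p pq by auto
  show "lr_ball r n \<noteq> {}" using zero_lr_ball by blast
  fix \<beta> assume \<beta>: "\<beta> \<in> lr_ball r n"
  let ?w = "p_sum p n (\<lambda>i. \<beta> i *\<^sub>R y i)"
  obtain \<phi> where \<phi>: "\<phi> \<in> pos_dual_ball (concavification p)" "\<phi> ?w = norm ?w powr p"
    using ex_norming[OF pos(1) conv p_sum_nonneg[OF pos(1)]] by blast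
  have "norm ?w powr p = (\<Sum>i<n. \<bar>\<beta> i\<bar> powr p * \<phi> \<bar>y i\<bar>)"
    using \<phi>(2) dual_ball_scaled_p_sum[OF \<phi>(1)] by simp
  also have "\<dots> \<le> (\<Sum>i<n. \<phi> \<bar>y i\<bar> powr (q / p)) powr (p / q)"
    by (rule holder_lr_ball[OF \<beta>]) (use dual_ballD(5)[OF pos(1) \<phi>(1)] in simp)
  also have "\<dots> \<le> M powr (p / q)" using M[OF \<phi>(1)] pos by (intro powr_mono2) (auto simp: sum_nonneg)
  finally have "(norm ?w powr p) powr (1 / p) \<le> (M powr (p / q)) powr (1 / p)"
    using pos by (intro powr_mono2) auto
  then show "norm ?w \<le> M powr (1 / q)" using pos by (simp add: powr_powr)
qed

text \<open>The extremal \<beta> of \<open>holder_attained\<close> for the values \<phi> \<bar>y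
  i\<bar> is a witness in the supremum.\<close>

lemma le_SUP_p_sum:
  assumes \<phi>: "\<phi> \<in> pos_dual_ball (concavification p)"
  shows "(\<Sum>i<n. \<phi> \<bar>y i\<bar> powr (q / p)) powr (1 / q)
    \<le> (SUP \<beta>\<in>lr_ball r n. norm (p_sum p n (\<lambda>i. \<beta> i *\<^sub>R y i)))"
proof -
  have pos: "0 < p" "0 < q" using p pq by auto
  obtain \<beta> where \<beta>: "\<beta> \<in> lr_ball r n"
    "(\<Sum>i<n. \<bar>\<beta> i\<bar> powr p * \<phi> \<bar>y i\<bar>) = (\<Sum>i<n. \<phi> \<bar>y i\<bar> powr (q / p)) powr (p / q)"
    using holder_attained[of n "\<lambda>i. \<phi> \<bar>y i\<bar>"] dual_ballD(5)[OF pos(1) \<phi>] by auto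
  let ?w = "p_sum p n (\<lambda>i. \<beta> i *\<^sub>R y i)"
  have "(\<Sum>i<n. \<phi> \<bar>y i\<bar> powr (q / p)) powr (p / q) = \<phi> ?w"
    using \<beta>(2) dual_ball_scaled_p_sum[OF \<phi>] by simp
  also have "\<dots> \<le> norm ?w powr p" using dual_ballD(4)[OF pos(1) \<phi>, of ?w] by simp
  finally have "((\<Sum>i<n. \<phi> \<bar>y i\<bar> powr (q / p)) powr (p / q)) powr (1 / p) \<le> (norm ?w powr p) powr (1 / p)"
    using pos by (intro powr_mono2) auto
  then have "(\<Sum>i<n. \<phi> \<bar>y i\<bar> powr (q / p)) powr (1 / q) \<le> norm ?w" using pos by (simp add: powr_powr)
  also have "\<dots> \<le> (SUP \<beta>\<in>lr_ball r n. norm (p_sum p n (\<lambda>i. \<beta> i *\<^sub>R y i)))"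
    by (rule cSUP_upper[OF \<beta>(1) bdd_p_sum])
  finally show ?thesis .
qed

end

end

lemma multilinear_scale:
  assumes "multilinear X W f" "x \<in> family X"
  shows "f (x(j := vscale (X j) c (x j))) = vscale W c (f x)"
proof -
  have "vlinear (X j) W (\<lambda>u. f (x(j := u)))" using assms unfolding multilinear_def by blast
  moreover have "x j \<in> vcarrier (X j)" using assms(2) by (simp add: family_def)
  ultimately have "f (x(j := vscale (X j) c (x j))) = vscale W c (f (x(j := x j)))"
    unfolding vlinear_def by blast
  then show ?thesis by simp
qed

lemma family_scale:
  assumes "x \<in> family X" "real_vs (X j)" shows "x(j := vscale (X j) c (x j)) \<in> family X"
  using assms real_vs.scale_closed[OF assms(2)] by (simp add: family_def)

theorem theorem4p1:
  fixes p q :: real and r :: ennreal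
    and X :: "'i::finite \<Rightarrow> 'a nvlat"
    and T :: "('i \<Rightarrow> 'a) \<Rightarrow> 'y::banach"
    and tensor :: "('i \<Rightarrow> 'a) \<Rightarrow> 'z::banach_lattice"
    and \<iota> :: "'z \<Rightarrow> 'e::banach_lattice"
  assumes "1 \<le> p" and "p \<le> q" and "1 / r = ennreal (1 / p - 1 / q)"
    and "\<And>j. banach_lattice_space (X j)"
    and "multilinear X type_vs T"
    and "pos_proj_tensor_product X tensor"
    and "bounded_linear \<iota>" and "inj \<iota>"
    and "p_convex p 1 TYPE('e)"
  shows
    "(\<exists>C>0. \<forall>n (x :: nat \<Rightarrow> 'i \<Rightarrow> 'a). (\<forall>i<n. x i \<in> family X) \<longrightarrow>
        (\<Sum>i<n. norm (T (x i)) powr q) powr (1 / q)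
          \<le> C * (SUP \<beta>\<in>lr_ball r n. norm (p_sum p n (\<lambda>i. \<beta> i *\<^sub>R \<iota> (tensor (x i))))))
     \<longleftrightarrow>
     (\<exists>C>0. \<exists>\<nu>. regular_borel_prob (weak_star_pos_dual_ball (concavification p :: 'e nvlat)) \<nu> \<and>
        (\<forall>x\<in>family X. norm (T x)
          \<le> C * (\<integral>\<phi>. \<phi> \<bar>\<iota> (tensor x)\<bar> powr (q / p) \<partial>\<nu>) powr (1 / q)))"
proof -
  interpret exponents p q r using assms(1-3) by unfold_locales
  have pos: "0 < p" "0 < q" using assms(1,2) by auto
  note conv = assms(9)
  let ?K = "pos_dual_ball (concavification p :: 'e nvlat)"
  let ?B = "weak_star_pos_dual_ball (concavification p :: 'e nvlat)"
  define y where "y x = \<iota> (tensor x)" for x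
  define F where "F x \<phi> = \<phi> \<bar>y x\<bar> powr (q / p)" for x and \<phi> :: "'e \<Rightarrow> real"
  note K = topspace_ball[OF pos(1), where 'e = 'e]
  have nn: "0 \<le> \<phi> \<bar>z\<bar>" if "\<phi> \<in> ?K" for \<phi> z using dual_ballD(5)[OF pos(1) that] by simp
  have F_cont: "continuous_map ?B euclideanreal (F x)" for x
  proof -
    have "continuous_on ?K (\<lambda>\<phi>. \<phi> \<bar>y x\<bar>)"
      using continuous_eval[OF pos(1), of "\<bar>y x\<bar>"] ball_topology_eq[OF pos(1), where 'e = 'e] by simp
    then have "continuous_on ?K (F x)"
      unfolding F_def using nn pos by (intro continuous_on_powr' continuous_on_const) auto
    then show ?thesis using ball_topology_eq[OF pos(1), where 'e = 'e] by simp
  qed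
  obtain D where "riesz_multimorphism X (sub_vlat D) tensor"
    using assms(6) unfolding pos_proj_tensor_product_def fremlin_tensor_product_def by blast
  then have tensor: "multilinear X (sub_vlat D) tensor" by (simp add: riesz_multimorphism_def)
  have y_scale: "y (x(j := vscale (X j) c (x j))) = c *\<^sub>R y x" if "x \<in> family X" for x j c
    using multilinear_scale[OF tensor that] linear_scale[OF bounded_linear.linear[OF assms(7)]]
    by (simp add: y_def sub_vlat_def)
  have T_scale: "T (x(j := vscale (X j) c (x j))) = c *\<^sub>R T x" if "x \<in> family X" for x j c
    using multilinear_scale[OF assms(5) that] by (simp add: type_vs_def)
  have X: "real_vs (X j)" for j
    using assms(4)[of j] by (simp add: banach_lattice_space_def riesz_space_def)
  \<comment> \<open>In the form with q-th powers the estimates can be summed and integrated.\<close>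
  have bound_iff: "a \<le> C * I powr (1 / q) \<longleftrightarrow> a powr q / C powr q \<le> I"
    if "0 \<le> a" "0 < C" "0 \<le> I" for a C I
  proof -
    have "a \<le> C * I powr (1 / q) \<longleftrightarrow> a powr q \<le> (C * I powr (1 / q)) powr q"
      using that pos powr_mono2[of q a "C * I powr (1 / q)"] powr_less_mono2[of q "C * I powr (1 / q)" a]
      by (auto simp: not_le[symmetric])
    also have "(C * I powr (1 / q)) powr q = C powr q * I" using that pos by (simp add: powr_mult powr_powr)
    finally show ?thesis using that by (simp add: field_simps)
  qed
  have F_nonneg: "0 \<le> F x \<phi>" for x \<phi> by (simp add: F_def)
  show ?thesis
    unfolding y_def[symmetric] F_def[symmetric]
  proof (intro iffI; elim exE conjE)
    fix C :: real
    assume C: "0 < C" and dom: "\<forall>n x. (\<forall>i<n. x i \<in> family X) \<longrightarrow>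
        (\<Sum>i<n. norm (T (x i)) powr q) powr (1 / q)
          \<le> C * (SUP \<beta>\<in>lr_ball r n. norm (p_sum p n (\<lambda>i. \<beta> i *\<^sub>R y (x i))))"
    have "\<exists>\<nu>. regular_borel_prob ?B \<nu> \<and> (\<forall>x\<in>family X. norm (T x) powr q / C powr q \<le> (\<integral>\<phi>. F x \<phi> \<partial>\<nu>))"
    proof (rule pietsch_domination[OF compact_ball[OF pos(1)] Hausdorff_ball[OF pos(1)] _ F_cont F_nonneg])
      show "topspace ?B \<noteq> {}" unfolding K using zero_dual_ball[OF pos(1)] by blast
    next
      fix x and c :: real assume x: "x \<in> family X" and c: "0 < c"
      \<comment> \<open>any coordinate can absorb the factor, for instance \<open>undefined\<close>\<close>
      define x' where "x' = x(undefined := vscale (X undefined) (c powr (1 / q)) (x undefined))"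
      \<comment> \<open>A factor d in one coordinate multiplies F by \<bar>d\<bar>^q: the scalar in
        E_p is \<bar>d\<bar>^p, then comes the power q/p. Hence the choice d = c^(1/q).\<close>
      have "F x' \<phi> = c * F x \<phi>" if \<phi>: "\<phi> \<in> ?K" for \<phi>
      proof -
        have "F x' \<phi> = ((c powr (1 / q)) powr p * \<phi> \<bar>y x\<bar>) powr (q / p)"
          unfolding F_def x'_def y_scale[OF x] dual_ball_abs_scale[OF pos(1) \<phi>] by simp
        then show ?thesis using c pos nn[OF \<phi>] by (simp add: F_def powr_mult powr_powr)
      qed
      moreover have "norm (T x') powr q / C powr q = c * (norm (T x) powr q / C powr q)"
        using c pos by (simp add: x'_def T_scale[OF x] powr_mult powr_powr)
      moreover have "x' \<in> family X" unfolding x'_def by (rule family_scale[OF x X])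
      ultimately show "\<exists>x'\<in>family X. (\<forall>\<phi>\<in>topspace ?B. F x' \<phi> = c * F x \<phi>) \<and>
          norm (T x') powr q / C powr q = c * (norm (T x) powr q / C powr q)"
        unfolding K by blast
    next
      fix n :: nat and x and M :: real
      assume x: "\<And>i. i < n \<Longrightarrow> x i \<in> family X"
        and M: "\<And>\<phi>. \<phi> \<in> topspace ?B \<Longrightarrow> (\<Sum>i<n. F (x i) \<phi>) \<le> M"
      \<comment> \<open>At the zero functional all F vanish; the sign of M is a premise of
        \<open>bound_iff\<close>.\<close>
      have "0 \<le> M"
        using M[of "\<lambda>x. 0"] zero_dual_ball[OF pos(1), where 'e = 'e] unfolding K
        by (simp add: F_def pos)
      have "(\<Sum>i<n. norm (T (x i)) powr q) powr (1 / q) \<le> C * M powr (1 / q)"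
      proof -
        have "(SUP \<beta>\<in>lr_ball r n. norm (p_sum p n (\<lambda>i. \<beta> i *\<^sub>R y (x i)))) \<le> M powr (1 / q)"
          by (rule SUP_p_sum_le[OF conv]) (use M K in \<open>simp add: F_def\<close>)
        then have "C * (SUP \<beta>\<in>lr_ball r n. norm (p_sum p n (\<lambda>i. \<beta> i *\<^sub>R y (x i)))) \<le> C * M powr (1 / q)"
          using C by simp
        then show ?thesis using dom x by (meson order_trans)
      qed
      then have "((\<Sum>i<n. norm (T (x i)) powr q) powr (1 / q)) powr q / C powr q \<le> M"
        using bound_iff[of _ C M] C \<open>0 \<le> M\<close> by simp
      then show "(\<Sum>i<n. norm (T (x i)) powr q / C powr q) \<le> M"
        using pos by (simp add: powr_powr sum_nonneg sum_divide_distrib)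
    qed
    then obtain \<nu> where \<nu>: "regular_borel_prob ?B \<nu>"
      "\<And>x. x \<in> family X \<Longrightarrow> norm (T x) powr q / C powr q \<le> (\<integral>\<phi>. F x \<phi> \<partial>\<nu>)" by blast
    have "norm (T x) \<le> C * (\<integral>\<phi>. F x \<phi> \<partial>\<nu>) powr (1 / q)" if "x \<in> family X" for x
      using \<nu>(2)[OF that] bound_iff[of "norm (T x)" C "\<integral>\<phi>. F x \<phi> \<partial>\<nu>"] C F_nonneg by simp
    then show "\<exists>C>0. \<exists>\<nu>. regular_borel_prob ?B \<nu> \<and>
        (\<forall>x\<in>family X. norm (T x) \<le> C * (\<integral>\<phi>. F x \<phi> \<partial>\<nu>) powr (1 / q))"
      using C \<nu>(1) by blast
  next
    fix C :: real and \<nu>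
    assume C: "0 < C" and \<nu>: "regular_borel_prob ?B \<nu>"
      and T: "\<forall>x\<in>family X. norm (T x) \<le> C * (\<integral>\<phi>. F x \<phi> \<partial>\<nu>) powr (1 / q)"
    interpret prob_space \<nu> using \<nu> by (simp add: regular_borel_prob_def)
    have space: "space \<nu> = ?K" using \<nu> K by (simp add: regular_borel_prob_def)
    have int: "integrable \<nu> (F x)" for x
      by (rule continuous_map_integrable[OF \<nu> compact_ball[OF pos(1)] F_cont])
    have "(\<Sum>i<n. norm (T (x i)) powr q) powr (1 / q)
          \<le> C * (SUP \<beta>\<in>lr_ball r n. norm (p_sum p n (\<lambda>i. \<beta> i *\<^sub>R y (x i))))" (is "_ \<le> C * ?S")
      if x: "\<And>i. i < n \<Longrightarrow> x i \<in> family X" for n x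
    proof -
      have S: "(\<Sum>i<n. F (x i) \<phi>) powr (1 / q) \<le> ?S" if "\<phi> \<in> ?K" for \<phi>
        unfolding F_def by (rule le_SUP_p_sum[OF conv that])
      \<comment> \<open>Read off at the zero functional; the sign lets the q-th root of ?S^q return
        ?S at the end.\<close>
      have S0: "0 \<le> ?S"
        using S[OF zero_dual_ball[OF pos(1)]] by (meson order_trans powr_ge_zero)
      have "(\<Sum>i<n. norm (T (x i)) powr q / C powr q) \<le> (\<Sum>i<n. \<integral>\<phi>. F (x i) \<phi> \<partial>\<nu>)"
      proof (rule sum_mono)
        fix i assume "i \<in> {..<n}"
        then show "norm (T (x i)) powr q / C powr q \<le> (\<integral>\<phi>. F (x i) \<phi> \<partial>\<nu>)"
          using T x bound_iff[of "norm (T (x i))" C "\<integral>\<phi>. F (x i) \<phi> \<partial>\<nu>"] C F_nonneg by simp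
      qed
      also have "\<dots> = (\<integral>\<phi>. (\<Sum>i<n. F (x i) \<phi>) \<partial>\<nu>)"
        by (rule Bochner_Integration.integral_sum[OF int, symmetric])
      \<comment> \<open>The bound ?S^q holds at every point of the ball, and \<nu> has mass
        1.\<close>
      also have "\<dots> \<le> (\<integral>\<phi>. ?S powr q \<partial>\<nu>)"
      proof (rule integral_mono)
        fix \<phi> assume "\<phi> \<in> space \<nu>"
        then have "((\<Sum>i<n. F (x i) \<phi>) powr (1 / q)) powr q \<le> ?S powr q"
          using S pos by (intro powr_mono2) (auto simp: space)
        then show "(\<Sum>i<n. F (x i) \<phi>) \<le> ?S powr q"
          using pos F_nonneg by (simp add: powr_powr sum_nonneg)
      qed (simp_all add: int)
      also have "\<dots> = ?S powr q" by (simp add: prob_space)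
      finally have "(\<Sum>i<n. norm (T (x i)) powr q) / C powr q \<le> ?S powr q"
        by (simp add: sum_divide_distrib)
      then have "((\<Sum>i<n. norm (T (x i)) powr q) powr (1 / q)) powr q / C powr q \<le> ?S powr q"
        using pos by (simp add: powr_powr sum_nonneg)
      then have "(\<Sum>i<n. norm (T (x i)) powr q) powr (1 / q) \<le> C * (?S powr q) powr (1 / q)"
        by (subst bound_iff) (use C in auto)
      then show ?thesis using S0 pos by (simp add: powr_powr)
    qed
    then show "\<exists>C>0. \<forall>n x. (\<forall>i<n. x i \<in> family X) \<longrightarrow>
        (\<Sum>i<n. norm (T (x i)) powr q) powr (1 / q)
          \<le> C * (SUP \<beta>\<in>lr_ball r n. norm (p_sum p n (\<lambda>i. \<beta> i *\<^sub>R y (x i))))"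
      using C by blast
  qed
qed

end
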